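(* Let $\Gamma$ be an infinite finitely generated amenable group and let $\mu$ be an admissible probability measure on $\Gamma$. Let $N_\mu$ be the spectral distribution and $\Lambda_\mu$ the $L^2$-isoperimetric profile of the Laplace operator $\Delta_\mu$. Let $L:(0,\infty)\to(0,\infty)$ be a decreasing function such that $\lim_{x\to\infty}L(x)=0$, and assume that $L\circ\exp$ is doubling near infinity. Let $L^{-1}$ be the generalized inverse of $L$. (1) If $L(v)\preceq\Lambda_\mu(v)$ near infinity, then $N_\mu(\lambda)\preceq\frac{1}{L^{-1}(\lambda)}$ near zero in the dilatational sense. (2) If $L(v)\succeq\Lambda_\mu(v)$ near infinity, then $N_\mu(\lambda)\succeq\frac{1}{L^{-1}(\lambda)}$ near zero in the dilatational sense.
   Context: "Decreasing" means non-increasing. Admissible measures: a probability measure $\mu$ on a finitely generated group $\Gamma$ is admissible if it is symmetric ($\mu(\{\gamma\})=\mu(\{\gamma^{-1}\})$ for all $\gamma$), has finite second moment ($\int_\Gamma l(\gamma)^2\,d\mu(\gamma)<\infty$, with $l$ the length function of some word metric on $\Gamma$), and its support contains a finite generating set of $\Gamma$. Operators: $R_\mu:l^2(\Gamma)\to l^2(\Gamma)$, $R_\mu(f)(x)=\sum_{\gamma\in\Gamma}f(x\gamma^{-1})\mu(\gamma)$, and $\Delta_\mu=\mathrm{id}-R_\mu$, a positive bounded operator. For a bounded self-adjoint operator $A$ put $E^A_\lambda=\chi_{(-\infty,\lambda]}(A)$. For a bounded operator $A$ on $l^2(\Gamma)$ commuting with the left $\Gamma$-action, $\mathrm{tr}_\Gamma(A)=\langle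 A\delta_e,\delta_e\rangle$. The spectral distribution of $\Delta_\mu$ is $N_\mu:[0,\infty)\to[0,\infty)$, $N_\mu(\lambda)=\mathrm{tr}_\Gamma(E^{\Delta_\mu}_\lambda)$. $L^2$-isoperimetric profile: $\Lambda_\mu:[1,\infty)\to(0,\infty)$, $\Lambda_\mu(v)=\inf_{1\le|\Omega|\le v}\lambda_1(\Omega)$ over finite subsets $\Omega\subset\Gamma$, where $\lambda_1(\Omega)=\inf_{\emptyset\ne\mathrm{supp}(f)\subset\Omega}\langle\Delta_\mu f,f\rangle/\|f\|_2^2$. Generalized inverse: for decreasing $L:(0,\infty)\to(0,\infty)$, $L^{-1}(x)=\inf\{v>0: L(v)\le x\}$, defined for $x>\inf L$. Doubling near infinity: a decreasing positive function $g$ is doubling near infinity if there is $c>0$ with $g(2x)\ge c\,g(x)$ for all sufficiently large $x$. Asymptotic comparison: $f\preceq g$ near infinity means there are $C,D,x_0>0$ with $f(x)\le Cg(Dx)$ for all $x\ge x_0$. For $f,g:[0,\infty)\to[0,\infty)$, $f\preceq g$ near zero in the dilatational sense means there are $D,\epsilon>0$ with $f(\lambda)\le g(D\lambda)$ for all $\lambda\in[0,\epsilon)$. $f\succeq g$ means $g\preceq f$. An expression defined only for $\lambda>0$ (such as $1/L^{-1}(\lambda)$) is given the value $0$ at $\lambda=0$. *)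

theory Defs
  imports "HOL-Algebra.Generated_Groups" "HOL-Probability.Probability"
begin

section \<open>Groups and admissible measures\<close>

definition finite_generating_set :: "('g, 'b) monoid_scheme \<Rightarrow> 'g set \<Rightarrow> bool" where
  "finite_generating_set G S \<longleftrightarrow>
     finite S \<and> S \<subseteq> carrier G \<and> generate G S = carrier G"

definition finitely_generated_group :: "('g, 'b) monoid_scheme \<Rightarrow> bool" where
  "finitely_generated_group G \<longleftrightarrow> group G \<and> (\<exists>S. finite_generating_set G S)"

text \<open>Amenability in the sense of von Neumann: a left-invariant finitely additive probability
  measure defined on all subsets of the group.\<close>

definition amenable_group :: "('g, 'b) monoid_scheme \<Rightarrow> bool" where
  "amenable_group G \<longleftrightarrow> group G \<and>
     (\<exists>m :: 'g set \<Rightarrow> real.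
        m (carrier G) = 1 \<and>
        (\<forall>A. A \<subseteq> carrier G \<longrightarrow> 0 \<le> m A) \<and>
        (\<forall>A B. A \<subseteq> carrier G \<longrightarrow> B \<subseteq> carrier G \<longrightarrow> A \<inter> B = {} \<longrightarrow>
           m (A \<union> B) = m A + m B) \<and>
        (\<forall>x \<in> carrier G. \<forall>A. A \<subseteq> carrier G \<longrightarrow> m (x <#\<^bsub>G\<^esub> A) = m A))"

definition word_length :: "('g, 'b) monoid_scheme \<Rightarrow> 'g set \<Rightarrow> 'g \<Rightarrow> nat" where
  "word_length G S x =
     (LEAST n. \<exists>ws. length ws = n \<and> set ws \<subseteq> S \<union> m_inv G ` S \<and>
                    foldr (\<lambda>a b. a \<otimes>\<^bsub>G\<^esub> b) ws \<one>\<^bsub>G\<^esub> = x)"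

text \<open>A finitely generated group is countable, so its probability measures are exactly the
  probability mass functions supported in the carrier.\<close>

definition admissible_measure :: "('g, 'b) monoid_scheme \<Rightarrow> 'g pmf \<Rightarrow> bool" where
  "admissible_measure G \<mu> \<longleftrightarrow>
     set_pmf \<mu> \<subseteq> carrier G \<and>
     (\<forall>x \<in> carrier G. pmf \<mu> x = pmf \<mu> (inv\<^bsub>G\<^esub> x)) \<and>
     (\<exists>S. finite_generating_set G S \<and>
        integrable (measure_pmf \<mu>) (\<lambda>x. (real (word_length G S x))\<^sup>2)) \<and>
     (\<exists>S. finite_generating_set G S \<and> S \<subseteq> set_pmf \<mu>)"


section \<open>The Hilbert space of square-summable functions\<close>

text \<open>Functions on the group are functions on the ambient type that vanish off the carrier.
  Operators are functions on all of \<open>'g \<Rightarrow> complex\<close>; only their values on the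
  Hilbert space are meaningful.\<close>

definition ell2 :: "('g, 'b) monoid_scheme \<Rightarrow> ('g \<Rightarrow> complex) set" where
  "ell2 G = {f. (\<forall>x. x \<notin> carrier G \<longrightarrow> f x = 0) \<and>
                (\<lambda>x. (cmod (f x))\<^sup>2) summable_on carrier G}"

definition ell2_inner ::
    "('g, 'b) monoid_scheme \<Rightarrow> ('g \<Rightarrow> complex) \<Rightarrow> ('g \<Rightarrow> complex) \<Rightarrow> complex" where
  "ell2_inner G f g = (\<Sum>\<^sub>\<infinity>x\<in>carrier G. f x * cnj (g x))"

definition ell2_norm :: "('g, 'b) monoid_scheme \<Rightarrow> ('g \<Rightarrow> complex) \<Rightarrow> real" where
  "ell2_norm G f = sqrt (\<Sum>\<^sub>\<infinity>x\<in>carrier G. (cmod (f x))\<^sup>2)"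

definition bounded_operator ::
    "('g, 'b) monoid_scheme \<Rightarrow> (('g \<Rightarrow> complex) \<Rightarrow> ('g \<Rightarrow> complex)) \<Rightarrow> bool" where
  "bounded_operator G A \<longleftrightarrow>
     (\<forall>f \<in> ell2 G. A f \<in> ell2 G) \<and>
     (\<forall>f \<in> ell2 G. \<forall>g \<in> ell2 G. A (\<lambda>x. f x + g x) = (\<lambda>x. A f x + A g x)) \<and>
     (\<forall>c. \<forall>f \<in> ell2 G. A (\<lambda>x. c * f x) = (\<lambda>x. c * A f x)) \<and>
     (\<exists>C. \<forall>f \<in> ell2 G. ell2_norm G (A f) \<le> C * ell2_norm G f)"

definition orthogonal_projection ::
    "('g, 'b) monoid_scheme \<Rightarrow> (('g \<Rightarrow> complex) \<Rightarrow> ('g \<Rightarrow> complex)) \<Rightarrow> bool" where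
  "orthogonal_projection G P \<longleftrightarrow>
     bounded_operator G P \<and>
     (\<forall>f \<in> ell2 G. P (P f) = P f) \<and>
     (\<forall>f \<in> ell2 G. \<forall>g \<in> ell2 G. ell2_inner G (P f) g = ell2_inner G f (P g))"


section \<open>Spectral projections\<close>

text \<open>Projection-valued measures on the Borel sets of the real line with bounded support;
  countable additivity is in the strong operator topology.\<close>

definition projection_valued_measure ::
    "('g, 'b) monoid_scheme \<Rightarrow> (real set \<Rightarrow> ('g \<Rightarrow> complex) \<Rightarrow> ('g \<Rightarrow> complex)) \<Rightarrow> bool" where
  "projection_valued_measure G E \<longleftrightarrow>
     (\<forall>B \<in> sets borel. orthogonal_projection G (E B)) \<and>
     (\<exists>a. \<forall>f \<in> ell2 G. E {-a<..<a} f = f) \<and>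
     (\<forall>f \<in> ell2 G. E {} f = (\<lambda>x. 0)) \<and>
     (\<forall>B \<in> sets borel. \<forall>C \<in> sets borel. \<forall>f \<in> ell2 G. E B (E C f) = E (B \<inter> C) f) \<and>
     (\<forall>B :: nat \<Rightarrow> real set. range B \<subseteq> sets borel \<longrightarrow> disjoint_family B \<longrightarrow>
        (\<forall>f \<in> ell2 G.
           (\<lambda>n. ell2_norm G (\<lambda>x. E (\<Union>i. B i) f x - (\<Sum>i<n. E (B i) f x)))
             \<longlonglongrightarrow> 0))"

definition scalar_spectral_measure ::
    "('g, 'b) monoid_scheme \<Rightarrow> (real set \<Rightarrow> ('g \<Rightarrow> complex) \<Rightarrow> ('g \<Rightarrow> complex)) \<Rightarrow>
     ('g \<Rightarrow> complex) \<Rightarrow> real measure" where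
  "scalar_spectral_measure G E f =
     measure_of UNIV (sets borel) (\<lambda>B. ennreal (Re (ell2_inner G (E B f) f)))"

text \<open>\<open>A = \<integral> t dE(t)\<close>, in the weak sense; the diagonal determines \<open>A\<close> by polarization.\<close>

definition spectral_measure_for ::
    "('g, 'b) monoid_scheme \<Rightarrow> (('g \<Rightarrow> complex) \<Rightarrow> ('g \<Rightarrow> complex)) \<Rightarrow>
     (real set \<Rightarrow> ('g \<Rightarrow> complex) \<Rightarrow> ('g \<Rightarrow> complex)) \<Rightarrow> bool" where
  "spectral_measure_for G A E \<longleftrightarrow>
     projection_valued_measure G E \<and>
     (\<forall>f \<in> ell2 G.
        ell2_inner G (A f) f =
          complex_of_real (\<integral>t. t \<partial>scalar_spectral_measure G E f))"

text \<open>\<open>\<chi>\<^bsub>B\<^esub>(A)\<close> for a bounded self-adjoint operator \<open>A\<close>. By the spectral theorem the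
  spectral measure of \<open>A\<close> exists and is unique on Borel sets and on the Hilbert space, so the
  choice made here is immaterial.\<close>

definition spectral_measure ::
    "('g, 'b) monoid_scheme \<Rightarrow> (('g \<Rightarrow> complex) \<Rightarrow> ('g \<Rightarrow> complex)) \<Rightarrow>
     real set \<Rightarrow> ('g \<Rightarrow> complex) \<Rightarrow> ('g \<Rightarrow> complex)" where
  "spectral_measure G A = (SOME E. spectral_measure_for G A E)"

definition spectral_projection ::
    "('g, 'b) monoid_scheme \<Rightarrow> (('g \<Rightarrow> complex) \<Rightarrow> ('g \<Rightarrow> complex)) \<Rightarrow>
     real \<Rightarrow> ('g \<Rightarrow> complex) \<Rightarrow> ('g \<Rightarrow> complex)" where
  "spectral_projection G A l = spectral_measure G A {..l}"

definition group_trace ::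
    "('g, 'b) monoid_scheme \<Rightarrow> (('g \<Rightarrow> complex) \<Rightarrow> ('g \<Rightarrow> complex)) \<Rightarrow> complex" where
  "group_trace G A = ell2_inner G (A (indicator {\<one>\<^bsub>G\<^esub>})) (indicator {\<one>\<^bsub>G\<^esub>})"


section \<open>The Laplace operator\<close>

definition markov_operator ::
    "('g, 'b) monoid_scheme \<Rightarrow> 'g pmf \<Rightarrow> ('g \<Rightarrow> complex) \<Rightarrow> ('g \<Rightarrow> complex)" where
  "markov_operator G \<mu> f = (\<lambda>x. if x \<in> carrier G
     then (\<Sum>\<^sub>\<infinity>y\<in>carrier G. f (x \<otimes>\<^bsub>G\<^esub> inv\<^bsub>G\<^esub> y) * complex_of_real (pmf \<mu> y)) else 0)"

definition laplace_operator ::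
    "('g, 'b) monoid_scheme \<Rightarrow> 'g pmf \<Rightarrow> ('g \<Rightarrow> complex) \<Rightarrow> ('g \<Rightarrow> complex)" where
  "laplace_operator G \<mu> f = (\<lambda>x. f x - markov_operator G \<mu> f x)"

definition spectral_distribution :: "('g, 'b) monoid_scheme \<Rightarrow> 'g pmf \<Rightarrow> real \<Rightarrow> real" where
  "spectral_distribution G \<mu> l =
     Re (group_trace G (spectral_projection G (laplace_operator G \<mu>) l))"

definition lambda1 :: "('g, 'b) monoid_scheme \<Rightarrow> 'g pmf \<Rightarrow> 'g set \<Rightarrow> real" where
  "lambda1 G \<mu> \<Omega> =
     Inf {Re (ell2_inner G (laplace_operator G \<mu> f) f) / (ell2_norm G f)\<^sup>2 | f.
            f \<in> ell2 G \<and> {x. f x \<noteq> 0} \<noteq> {} \<and> {x. f x \<noteq> 0} \<subseteq> \<Omega>}"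

definition isoperimetric_profile :: "('g, 'b) monoid_scheme \<Rightarrow> 'g pmf \<Rightarrow> real \<Rightarrow> real" where
  "isoperimetric_profile G \<mu> v =
     Inf {lambda1 G \<mu> \<Omega> | \<Omega>.
            finite \<Omega> \<and> \<Omega> \<subseteq> carrier G \<and> 1 \<le> card \<Omega> \<and> real (card \<Omega>) \<le> v}"


section \<open>Asymptotic comparison\<close>

definition generalized_inverse :: "(real \<Rightarrow> real) \<Rightarrow> real \<Rightarrow> real" where
  "generalized_inverse L x = Inf {v. 0 < v \<and> L v \<le> x}"

definition recip_generalized_inverse :: "(real \<Rightarrow> real) \<Rightarrow> real \<Rightarrow> real" where
  "recip_generalized_inverse L l = (if l = 0 then 0 else 1 / generalized_inverse L l)"

definition doubling_near_infinity :: "(real \<Rightarrow> real) \<Rightarrow> bool" where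
  "doubling_near_infinity g \<longleftrightarrow> (\<exists>c>0. \<forall>\<^sub>F x in at_top. g (2 * x) \<ge> c * g x)"

text \<open>Functions defined only on some \<open>[a, \<infinity>)\<close> may be compared as well: enlarging
  \<open>x0\<close> keeps both \<open>x\<close> and \<open>D * x\<close> inside the domains.\<close>

definition preceq_near_infinity :: "(real \<Rightarrow> real) \<Rightarrow> (real \<Rightarrow> real) \<Rightarrow> bool" where
  "preceq_near_infinity f g \<longleftrightarrow>
     (\<exists>C>0. \<exists>D>0. \<exists>x0>0. \<forall>x\<ge>x0. f x \<le> C * g (D * x))"

definition dil_preceq_near_zero :: "(real \<Rightarrow> real) \<Rightarrow> (real \<Rightarrow> real) \<Rightarrow> bool" where
  "dil_preceq_near_zero f g \<longleftrightarrow>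
     (\<exists>D>0. \<exists>\<epsilon>>0. \<forall>l. 0 \<le> l \<and> l < \<epsilon> \<longrightarrow> f l \<le> g (D * l))"

end

theory Submission
  imports Defs
begin

text \<open>
  Let \<open>E\<^sub>l\<close> be the spectral projection of \<open>\<Delta>\<close> on \<open>(-\<infinity>, l]\<close>, so that \<open>N(l) = \<parallel>E\<^sub>l \<delta>\<parallel>\<^sup>2\<close>.

  Lower bound on \<open>N\<close>: a function \<open>f\<close> on \<open>\<Omega>\<close> with Rayleigh quotient at most \<open>l\<close> keeps half of its
  mass under \<open>E\<^bsub>2l\<^esub>\<close>, while invariance under left translations gives
  \<open>\<parallel>E\<^bsub>2l\<^esub> f\<parallel>\<^sup>2 \<le> card \<Omega> N(2l) \<parallel>f\<parallel>\<^sup>2\<close>; hence \<open>\<Lambda>(v) < l\<close> implies \<open>N(2l) \<ge> 1 / (2v)\<close>.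

  Upper bound on \<open>N\<close>: if \<open>N(l) \<ge> 1 / v\<close>, the lazy walk \<open>f\<^sub>n = (1 - \<Delta>/2)\<^sup>n \<delta>\<close> satisfies
  \<open>\<parallel>f\<^sub>n\<parallel>\<^sup>2 \<ge> (1 - l/2)\<^bsup>2n\<^esup> / v\<close>. Up to time \<open>2 ln v / l\<close> this is polynomial in \<open>1 / v\<close>, so at some
  such time the energy of \<open>f\<^sub>n\<close> is at most a multiple of \<open>l\<close> times its mass, and truncating the
  probability density \<open>f\<^sub>n\<close> yields \<open>\<Lambda>(C v\<^sup>5) \<le> 6l\<close>. Doubling of \<open>L \<circ> exp\<close> absorbs the powers of \<open>v\<close>.

  Existence of \<open>E\<^sub>l\<close> is the spectral theorem. For a positive operator \<open>A\<close>, the range of \<open>E\<^sub>l\<close> is the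
  space of vectors with \<open>\<parallel>A\<^sup>n x\<parallel> = O(l\<^sup>n)\<close>; this description gives uniqueness and the commutation
  of \<open>E\<^sub>l\<close> with every bounded operator that, together with its adjoint, commutes with \<open>A\<close>.
\<close>

section \<open>Orthogonal projections in real Hilbert spaces\<close>

definition self_adjoint :: "('a::real_inner \<Rightarrow> 'a) \<Rightarrow> bool" where
  "self_adjoint T \<longleftrightarrow> bounded_linear T \<and> (\<forall>x y. inner (T x) y = inner x (T y))"

definition orth_proj :: "('a::real_inner \<Rightarrow> 'a) \<Rightarrow> bool" where
  "orth_proj P \<longleftrightarrow> self_adjoint P \<and> (\<forall>x. P (P x) = P x)"

lemma
  assumes "self_adjoint T"
  shows self_adjoint_bounded_linear: "bounded_linear T"
    and self_adjoint_inner: "inner (T x) y = inner x (T y)"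
    and self_adjoint_add: "T (x + y) = T x + T y"
    and self_adjoint_diff: "T (x - y) = T x - T y"
    and self_adjoint_scaleR: "T (r *\<^sub>R x) = r *\<^sub>R T x"
    and self_adjoint_0: "T 0 = 0"
  using assms bounded_linear.linear[of T]
  by (auto simp: self_adjoint_def linear_add linear_diff linear_scale linear_0)

lemma self_adjoint_ident: "self_adjoint (\<lambda>x. x)"
  by (simp add: self_adjoint_def bounded_linear_ident)

lemma self_adjoint_zero: "self_adjoint (\<lambda>x. 0)"
  by (simp add: self_adjoint_def bounded_linear_zero)

lemma self_adjoint_plus:
  "self_adjoint S \<Longrightarrow> self_adjoint T \<Longrightarrow> self_adjoint (\<lambda>x. S x + T x)"
  by (auto simp: self_adjoint_def inner_simps intro: bounded_linear_add)

lemma self_adjoint_minus: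
  "self_adjoint S \<Longrightarrow> self_adjoint T \<Longrightarrow> self_adjoint (\<lambda>x. S x - T x)"
  by (auto simp: self_adjoint_def inner_simps intro: bounded_linear_sub)

lemma self_adjoint_scaled: "self_adjoint T \<Longrightarrow> self_adjoint (\<lambda>x. r *\<^sub>R T x)"
  by (auto simp: self_adjoint_def intro: bounded_linear_const_scaleR)

lemma self_adjoint_square: "self_adjoint T \<Longrightarrow> self_adjoint (\<lambda>x. T (T x))"
  by (auto simp: self_adjoint_def intro: bounded_linear_compose)

lemma self_adjoint_eqI:
  fixes S T :: "'a::real_inner \<Rightarrow> 'a"
  assumes "self_adjoint S" "self_adjoint T" and eq_form: "\<And>x. inner (S x) x = inner (T x) x"
  shows "S = T"
proof
  fix x
  define U where "U y = S y - T y" for y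
  have "self_adjoint U"
    unfolding U_def[abs_def] by (intro self_adjoint_minus assms)
  then have "inner (U (x + U x)) (x + U x)
      = inner (U x) x + 2 * inner (U x) (U x) + inner (U (U x)) (U x)"
    by (simp add: self_adjoint_add self_adjoint_inner inner_simps inner_commute[of "U x" x])
  moreover have "inner (U y) y = 0" for y
    by (simp add: U_def inner_diff_left eq_form)
  ultimately show "S x = T x"
    by (simp add: U_def)
qed

lemma
  assumes "orth_proj P"
  shows orth_proj_self_adjoint: "self_adjoint P"
    and orth_proj_idem: "P (P x) = P x"
    and inner_orth_proj: "inner (P x) x = (norm (P x))\<^sup>2"
    and norm_diff_orth_proj: "(norm (x - P x))\<^sup>2 = (norm x)\<^sup>2 - (norm (P x))\<^sup>2"
    and norm_orth_proj_le: "norm (P x) \<le> norm x"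
proof -
  show self_adjoint_P: "self_adjoint P" and idem: "P (P x) = P x" for x
    using assms by (auto simp: orth_proj_def)
  show inner_eq: "inner (P x) x = (norm (P x))\<^sup>2" for x
    by (metis idem power2_norm_eq_inner self_adjoint_inner[OF self_adjoint_P])
  show norm_diff_eq: "(norm (x - P x))\<^sup>2 = (norm x)\<^sup>2 - (norm (P x))\<^sup>2"
    using inner_eq[of x] unfolding power2_norm_eq_inner by (simp add: inner_simps inner_commute)
  show "norm (P x) \<le> norm x"
    by (rule power2_le_imp_le)
      (use norm_diff_eq zero_le_power2[of "norm (x - P x)"] in \<open>linarith, simp\<close>)
qed

lemmas orth_proj_bounded_linear = self_adjoint_bounded_linear[OF orth_proj_self_adjoint]
  and orth_proj_inner = self_adjoint_inner[OF orth_proj_self_adjoint]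
  and orth_proj_add = self_adjoint_add[OF orth_proj_self_adjoint]
  and orth_proj_diff = self_adjoint_diff[OF orth_proj_self_adjoint]
  and orth_proj_scaleR = self_adjoint_scaleR[OF orth_proj_self_adjoint]
  and orth_proj_0 = self_adjoint_0[OF orth_proj_self_adjoint]

lemma orth_proj_zero: "orth_proj (\<lambda>x. 0)"
  by (simp add: orth_proj_def self_adjoint_zero)

lemma orth_proj_complement:
  assumes "orth_proj P"
  shows "orth_proj (\<lambda>x. x - P x)"
  using self_adjoint_minus[OF self_adjoint_ident orth_proj_self_adjoint[OF assms]]
  by (simp add: orth_proj_def orth_proj_diff[OF assms] orth_proj_idem[OF assms])

lemma orth_proj_fixed_iff:
  assumes "orth_proj P"
  shows "P x = x \<longleftrightarrow> (norm x)\<^sup>2 \<le> inner (P x) x"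
proof -
  have "(norm x)\<^sup>2 \<le> inner (P x) x \<longleftrightarrow> (norm (x - P x))\<^sup>2 \<le> 0"
    by (simp only: inner_orth_proj[OF assms] norm_diff_orth_proj[OF assms] diff_le_0_iff_le)
  then show ?thesis by auto
qed

lemma orth_proj_orthogonal:
  assumes P: "orth_proj P" and Q: "orth_proj Q"
    and sum_le: "\<And>x. inner (P x) x + inner (Q x) x \<le> (norm x)\<^sup>2"
  shows "P (Q x) = 0"
  using sum_le[of "Q x"]
  by (simp add: inner_orth_proj[OF P] inner_orth_proj[OF Q] orth_proj_idem[OF Q] dot_square_norm)

lemma Cauchy_of_dist_sq_le:
  fixes f :: "nat \<Rightarrow> 'a::metric_space" and u :: "nat \<Rightarrow> real"
  assumes dist_le: "\<And>m n. (dist (f m) (f n))\<^sup>2 \<le> u m + u n" and u_lim: "u \<longlonglongrightarrow> 0"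
  shows "Cauchy f"
proof (rule metric_CauchyI)
  fix e :: real assume e_pos: "0 < e"
  then obtain N where u_small: "\<And>n. N \<le> n \<Longrightarrow> u n < e\<^sup>2 / 2"
    using order_tendstoD(2)[OF u_lim, of "e\<^sup>2 / 2"] by (auto simp: eventually_sequentially)
  have "dist (f m) (f n) < e" if "N \<le> m" "N \<le> n" for m n
  proof (rule power_less_imp_less_base)
    show "(dist (f m) (f n))\<^sup>2 < e\<^sup>2"
      using dist_le[of m n] u_small[OF that(1)] u_small[OF that(2)] by simp
  qed (use e_pos in simp)
  then show "\<exists>N. \<forall>m\<ge>N. \<forall>n\<ge>N. dist (f m) (f n) < e" by blast
qed

lemma Cauchy_of_dist_sq_le_abs_diff:
  fixes f :: "nat \<Rightarrow> 'a::metric_space" and c :: "nat \<Rightarrow> real"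
  assumes dist_le: "\<And>m n. m \<le> n \<Longrightarrow> (dist (f m) (f n))\<^sup>2 \<le> \<bar>c m - c n\<bar>" and "convergent c"
  shows "Cauchy f"
proof -
  obtain l where c_lim: "c \<longlonglongrightarrow> l" using \<open>convergent c\<close> by (auto simp: convergent_def)
  have dist_le_sym: "(dist (f m) (f n))\<^sup>2 \<le> \<bar>c m - c n\<bar>" for m n
    using dist_le[of m n] dist_le[of n m]
    by (cases "m \<le> n") (auto simp: dist_commute abs_minus_commute)
  show ?thesis
  proof (rule Cauchy_of_dist_sq_le)
    show "(dist (f m) (f n))\<^sup>2 \<le> \<bar>c m - l\<bar> + \<bar>c n - l\<bar>" for m n
      using dist_le_sym[of m n] by linarith
    show "(\<lambda>n. \<bar>c n - l\<bar>) \<longlonglongrightarrow> 0"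
      using c_lim by (simp add: tendsto_rabs_zero LIM_zero)
  qed
qed

lemma norm_diff_sq_midpoint:
  fixes x p q :: "'a::real_inner"
  shows "(norm (p - q))\<^sup>2 + 4 * (norm (x - ((1/2) *\<^sub>R p + (1/2) *\<^sub>R q)))\<^sup>2
    = 2 * (norm (x - p))\<^sup>2 + 2 * (norm (x - q))\<^sup>2"
  unfolding power2_norm_eq_inner by (simp add: inner_simps inner_commute algebra_simps)

lemma ex_nearest_point:
  fixes M :: "'a::{real_inner, banach} set"
  assumes M: "convex M" "closed M" "M \<noteq> {}"
  shows "\<exists>p\<in>M. \<forall>m\<in>M. norm (x - p) \<le> norm (x - m)"
proof -
  define d where "d = (INF m\<in>M. (norm (x - m))\<^sup>2)"
  have bdd: "bdd_below ((\<lambda>m. (norm (x - m))\<^sup>2) ` M)"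
    by (rule bdd_belowI[of _ 0]) auto
  have d_le: "d \<le> (norm (x - m))\<^sup>2" if "m \<in> M" for m
    unfolding d_def using bdd that by (rule cINF_lower)
  have "\<exists>m\<in>M. (norm (x - m))\<^sup>2 < d + inverse (real (Suc n))" for n
    using cINF_less_iff[OF M(3) bdd, of "d + inverse (real (Suc n))"] by (simp add: d_def)
  then obtain p where p_mem: "p n \<in> M"
    and p_dist: "(norm (x - p n))\<^sup>2 < d + inverse (real (Suc n))" for n
    by metis
  have "Cauchy p"
  proof (rule Cauchy_of_dist_sq_le)
    fix m n
    have "(1/2) *\<^sub>R p m + (1/2) *\<^sub>R p n \<in> M"
      using M(1) p_mem p_mem by (rule convexD) auto
    from d_le[OF this] have "d \<le> (norm (x - ((1/2) *\<^sub>R p m + (1/2) *\<^sub>R p n)))\<^sup>2" .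
    with norm_diff_sq_midpoint[of "p m" "p n" x]
    show "(dist (p m) (p n))\<^sup>2 \<le> 2 * inverse (real (Suc m)) + 2 * inverse (real (Suc n))"
      using p_dist[of m] p_dist[of n] by (simp add: dist_norm)
  qed (use tendsto_mult_left[OF LIMSEQ_inverse_real_of_nat, of 2] in simp)
  then obtain q where p_lim: "p \<longlonglongrightarrow> q" using Cauchy_convergent convergent_def by blast
  have le_d: "(norm (x - q))\<^sup>2 \<le> d + 0"
  proof (rule LIMSEQ_le)
    show "(\<lambda>n. (norm (x - p n))\<^sup>2) \<longlonglongrightarrow> (norm (x - q))\<^sup>2" by (intro tendsto_intros p_lim)
    show "(\<lambda>n. d + inverse (real (Suc n))) \<longlonglongrightarrow> d + 0"
      by (intro tendsto_intros LIMSEQ_inverse_real_of_nat)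
    show "\<exists>N. \<forall>n\<ge>N. (norm (x - p n))\<^sup>2 \<le> d + inverse (real (Suc n))"
      using p_dist less_imp_le by blast
  qed
  have "norm (x - q) \<le> norm (x - m)" if "m \<in> M" for m
    using order_trans[OF le_d[simplified] d_le[OF that]] by (rule power2_le_imp_le) simp
  moreover have "q \<in> M" using M(2) p_lim p_mem closed_sequentially by blast
  ultimately show ?thesis by blast
qed

lemma ex_orthogonal_decomposition:
  fixes M :: "'a::{real_inner, banach} set"
  assumes M: "subspace M" "closed M"
  shows "\<exists>p\<in>M. \<forall>m\<in>M. inner (x - p) m = 0"
proof -
  have "M \<noteq> {}" using subspace_0[OF M(1)] by blast
  then obtain p where p_mem: "p \<in> M" and nearest: "\<And>m. m \<in> M \<Longrightarrow> norm (x - p) \<le> norm (x - m)"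
    using ex_nearest_point[OF subspace_imp_convex[OF M(1)] M(2), of x] by blast
  have "inner (x - p) m = 0" if m_mem: "m \<in> M" for m
  proof -
    define t where "t = inner (x - p) m / (inner m m + 1)"
    have denominator_pos: "inner m m + 1 > 0" by (simp add: add_nonneg_pos)
    then have inner_eq: "inner (x - p) m = t * (inner m m + 1)" by (simp add: t_def)
    have "p + t *\<^sub>R m \<in> M" using M(1) p_mem m_mem by (simp add: subspace_add subspace_scale)
    then have "(norm (x - p))\<^sup>2 \<le> (norm (x - (p + t *\<^sub>R m)))\<^sup>2"
      by (intro power_mono nearest) auto
    also have "\<dots> = (norm (x - p))\<^sup>2 - 2 * t * inner (x - p) m + t\<^sup>2 * inner m m"
      unfolding power2_norm_eq_inner
      by (simp add: inner_simps inner_commute algebra_simps power2_eq_square)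
    finally have "t\<^sup>2 * (inner m m + 2) \<le> 0"
      unfolding inner_eq by (simp add: algebra_simps power2_eq_square)
    then have "t = 0" using denominator_pos by (simp add: mult_le_0_iff)
    then show ?thesis by (simp add: inner_eq)
  qed
  then show ?thesis using p_mem by blast
qed

definition proj_onto :: "'a::{real_inner, banach} set \<Rightarrow> 'a \<Rightarrow> 'a" where
  "proj_onto M x = (SOME p. p \<in> M \<and> (\<forall>m\<in>M. inner (x - p) m = 0))"

context
  fixes M :: "'a::{real_inner, banach} set"
  assumes subspace: "subspace M" and closed: "closed M"
begin

lemma proj_onto_mem: "proj_onto M x \<in> M"
  and inner_diff_proj_onto: "m \<in> M \<Longrightarrow> inner (x - proj_onto M x) m = 0"
proof -
  have "\<exists>p. p \<in> M \<and> (\<forall>m\<in>M. inner (x - p) m = 0)"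
    using ex_orthogonal_decomposition[OF subspace closed] by blast
  from someI_ex[OF this]
  show "proj_onto M x \<in> M" "m \<in> M \<Longrightarrow> inner (x - proj_onto M x) m = 0"
    unfolding proj_onto_def by blast+
qed

lemma proj_onto_eqI:
  assumes "p \<in> M" "\<And>m. m \<in> M \<Longrightarrow> inner (x - p) m = 0"
  shows "proj_onto M x = p"
proof -
  have diff: "proj_onto M x - p \<in> M"
    using subspace assms(1) proj_onto_mem by (simp add: subspace_diff)
  have "inner (proj_onto M x - p) (proj_onto M x - p)
      = inner (x - p) (proj_onto M x - p) - inner (x - proj_onto M x) (proj_onto M x - p)"
    by (simp add: inner_simps)
  also have "\<dots> = 0" using assms(2)[OF diff] inner_diff_proj_onto[OF diff] by simp
  finally show ?thesis by simp
qed

lemma proj_onto_fixed: "x \<in> M \<Longrightarrow> proj_onto M x = x"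
  by (rule proj_onto_eqI) auto

lemma orth_proj_proj_onto: "orth_proj (proj_onto M)"
proof -
  have add: "proj_onto M (x + y) = proj_onto M x + proj_onto M y" for x y
  proof (rule proj_onto_eqI)
    show "inner (x + y - (proj_onto M x + proj_onto M y)) m = 0" if "m \<in> M" for m
      using inner_diff_proj_onto[OF that, of x] inner_diff_proj_onto[OF that, of y]
      by (simp add: inner_simps)
  qed (use subspace proj_onto_mem in \<open>simp add: subspace_add\<close>)
  have scale: "proj_onto M (r *\<^sub>R x) = r *\<^sub>R proj_onto M x" for r x
  proof (rule proj_onto_eqI)
    show "inner (r *\<^sub>R x - r *\<^sub>R proj_onto M x) m = 0" if "m \<in> M" for m
      using inner_diff_proj_onto[OF that, of x] by (simp add: inner_simps)
  qed (use subspace proj_onto_mem in \<open>simp add: subspace_scale\<close>)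
  have norm_le: "norm (proj_onto M x) \<le> norm x" for x
  proof (rule power2_le_imp_le)
    have "(norm x)\<^sup>2 = (norm (proj_onto M x))\<^sup>2 + (norm (x - proj_onto M x))\<^sup>2"
      using inner_diff_proj_onto[OF proj_onto_mem, of x x] unfolding power2_norm_eq_inner
      by (simp add: inner_simps inner_commute)
    then show "(norm (proj_onto M x))\<^sup>2 \<le> (norm x)\<^sup>2" by simp
  qed simp
  have "bounded_linear (proj_onto M)"
    by (rule bounded_linear_intro[where K=1]) (simp_all add: add scale norm_le)
  moreover have "inner (proj_onto M x) y = inner x (proj_onto M y)" for x y
    using inner_diff_proj_onto[OF proj_onto_mem, of x y]
      inner_diff_proj_onto[OF proj_onto_mem, of y x]
    by (simp add: inner_simps inner_commute)
  ultimately show ?thesis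
    by (simp add: orth_proj_def self_adjoint_def proj_onto_fixed proj_onto_mem)
qed

lemma proj_onto_commute:
  assumes T: "bounded_linear T" "\<And>x y. inner (T x) y = inner x (T' y)"
    and M: "\<And>m. m \<in> M \<Longrightarrow> T m \<in> M" "\<And>m. m \<in> M \<Longrightarrow> T' m \<in> M"
  shows "proj_onto M (T x) = T (proj_onto M x)"
proof (rule proj_onto_eqI)
  show "inner (T x - T (proj_onto M x)) m = 0" if "m \<in> M" for m
    using inner_diff_proj_onto[OF M(2)[OF that], of x]
    by (simp add: linear_diff[OF bounded_linear.linear[OF T(1)], symmetric] T(2))
qed (simp add: M(1) proj_onto_mem)

lemma orth_proj_eq_proj_onto:
  assumes P: "orth_proj P" and "\<And>x. P x \<in> M" "\<And>x. x \<in> M \<Longrightarrow> P x = x"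
  shows "P = proj_onto M"
proof
  show "P x = proj_onto M x" for x
    using assms(2,3) orth_proj_inner[OF P, of x]
    by (intro proj_onto_eqI[symmetric]) (simp_all add: inner_diff_left)
qed

end

lemma proj_onto_proj_onto_subset:
  assumes "subspace M" "closed M" "subspace N" "closed N" "M \<subseteq> N"
  shows "proj_onto M (proj_onto N x) = proj_onto M x"
proof (rule proj_onto_eqI[OF assms(1,2) proj_onto_mem[OF assms(1,2)]])
  fix m assume "m \<in> M"
  then have "inner (x - proj_onto M x) m = 0" "inner (x - proj_onto N x) m = 0"
    using assms inner_diff_proj_onto by blast+
  then show "inner (proj_onto N x - proj_onto M x) m = 0" by (simp add: inner_simps)
qed

lemma LIMSEQ_proj_onto_INT:
  fixes M :: "nat \<Rightarrow> 'a::{real_inner, banach} set"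
  assumes sub: "\<And>n. subspace (M n)" and closed: "\<And>n. closed (M n)" and "decseq M"
  shows "(\<lambda>n. proj_onto (M n) x) \<longlonglongrightarrow> proj_onto (\<Inter>n. M n) x"
proof -
  let ?p = "\<lambda>n. proj_onto (M n) x"
  have anti: "M n \<subseteq> M m" if "m \<le> n" for m n using \<open>decseq M\<close> that by (simp add: decseq_def)
  have mem: "?p n \<in> M n" for n by (rule proj_onto_mem[OF sub closed])
  have diff: "(norm (?p m - ?p n))\<^sup>2 = (norm (?p m))\<^sup>2 - (norm (?p n))\<^sup>2" if "m \<le> n" for m n
    using norm_diff_orth_proj[OF orth_proj_proj_onto[OF sub closed], of "?p m" n]
      proj_onto_proj_onto_subset[OF sub closed sub closed anti[OF that], of x] by simp
  have "convergent (\<lambda>n. (norm (?p n))\<^sup>2)"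
  proof (rule decseq_convergent[of _ 0])
    show "decseq (\<lambda>n. (norm (?p n))\<^sup>2)"
      unfolding decseq_def using diff zero_le_power2 by (metis diff_ge_0_iff_ge)
  qed (auto simp: convergent_def)
  then have "Cauchy ?p"
    by (rule Cauchy_of_dist_sq_le_abs_diff[rotated]) (simp add: dist_norm diff)
  then obtain q where p_lim: "?p \<longlonglongrightarrow> q" using Cauchy_convergent convergent_def by blast
  have "proj_onto (\<Inter>n. M n) x = q"
  proof (rule proj_onto_eqI)
    show "q \<in> (\<Inter>n. M n)"
    proof
      fix n
      show "q \<in> M n"
      proof (rule closed_sequentially[OF closed])
        show "?p (k + n) \<in> M n" for k using mem anti[of n "k + n"] by auto
        show "(\<lambda>k. ?p (k + n)) \<longlonglongrightarrow> q" using p_lim by (rule LIMSEQ_ignore_initial_segment)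
      qed
    qed
    show "inner (x - q) m = 0" if "m \<in> (\<Inter>n. M n)" for m
    proof (rule LIMSEQ_unique)
      show "(\<lambda>n. inner (x - ?p n) m) \<longlonglongrightarrow> inner (x - q) m" by (intro tendsto_intros p_lim)
      show "(\<lambda>n. inner (x - ?p n) m) \<longlonglongrightarrow> 0"
        using that inner_diff_proj_onto[OF sub closed] by simp
    qed
  qed (use sub closed in \<open>auto intro: subspace_Inter\<close>)
  then show ?thesis using p_lim by simp
qed

lemma orth_proj_LIMSEQ:
  fixes P :: "nat \<Rightarrow> 'a::real_inner \<Rightarrow> 'a"
  assumes P: "\<And>n. orth_proj (P n)" and lim: "\<And>x. (\<lambda>n. P n x) \<longlonglongrightarrow> Q x"
  shows "orth_proj Q"
proof -
  have "Q (x + y) = Q x + Q y" for x y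
    using LIMSEQ_unique[OF lim[of "x + y"]] tendsto_add[OF lim[of x] lim[of y]]
    by (simp add: orth_proj_add[OF P])
  moreover have "Q (r *\<^sub>R x) = r *\<^sub>R Q x" for r x
    using LIMSEQ_unique[OF lim[of "r *\<^sub>R x"]] tendsto_scaleR[OF tendsto_const lim[of x], of r]
    by (simp add: orth_proj_scaleR[OF P])
  moreover have "norm (Q x) \<le> norm x" for x
    by (rule LIMSEQ_le_const2[OF tendsto_norm[OF lim]]) (simp add: norm_orth_proj_le[OF P])
  ultimately have "bounded_linear Q" by (intro bounded_linear_intro[where K=1]) simp_all
  moreover have Q_inner: "inner (Q x) y = inner x (Q y)" for x y
  proof (rule LIMSEQ_unique)
    show "(\<lambda>n. inner (P n x) y) \<longlonglongrightarrow> inner (Q x) y" by (intro tendsto_intros lim)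
    show "(\<lambda>n. inner (P n x) y) \<longlonglongrightarrow> inner x (Q y)"
      unfolding orth_proj_inner[OF P] by (intro tendsto_intros lim)
  qed
  moreover have "Q (Q x) = Q x" for x
  proof -
    have "inner (Q x) (Q y) = inner (Q x) y" for y
    proof (rule LIMSEQ_unique)
      show "(\<lambda>n. inner (P n x) (P n y)) \<longlonglongrightarrow> inner (Q x) (Q y)" by (intro tendsto_intros lim)
      have "inner (P n x) (P n y) = inner (P n x) y" for n
        using orth_proj_inner[OF P, of n "P n x" y] by (simp add: orth_proj_idem[OF P])
      then show "(\<lambda>n. inner (P n x) (P n y)) \<longlonglongrightarrow> inner (Q x) y"
        using tendsto_inner[OF lim tendsto_const] by simp
    qed
    then have "inner (Q (Q x) - Q x) y = 0" for y by (simp add: inner_diff_left Q_inner)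
    then show ?thesis by (metis inner_eq_zero_iff right_minus_eq)
  qed
  ultimately show ?thesis by (auto simp: orth_proj_def self_adjoint_def)
qed

context
  fixes P :: "nat \<Rightarrow> 'a::real_inner \<Rightarrow> 'a"
  assumes P: "\<And>i. orth_proj (P i)" and orth: "\<And>i j x. i \<noteq> j \<Longrightarrow> P i (P j x) = 0"
begin

lemma orth_proj_sum: "finite I \<Longrightarrow> orth_proj (\<lambda>x. \<Sum>i\<in>I. P i x)"
proof (induction rule: finite_induct)
  case empty
  show ?case by (simp add: orth_proj_zero)
next
  case (insert j I)
  let ?Q = "\<lambda>x. \<Sum>i\<in>I. P i x"
  have "i \<noteq> j" if "i \<in> I" for i using insert.hyps that by blast
  then have "P j (P i x) = 0" "P i (P j x) = 0" if "i \<in> I" for i x using that orth by metis+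
  then have "P j (?Q x) = 0" "?Q (P j x) = 0" for x
    by (simp_all add: linear_sum[OF bounded_linear.linear[OF orth_proj_bounded_linear[OF P]]])
  moreover have "self_adjoint (\<lambda>x. P j x + ?Q x)"
    by (intro self_adjoint_plus orth_proj_self_adjoint P insert.IH)
  ultimately show ?case
    using insert.hyps
    by (simp add: orth_proj_def orth_proj_add[OF P] orth_proj_idem[OF P] sum.distrib
        orth_proj_idem[OF insert.IH])
qed

lemma norm_sum_orth_proj: "finite I \<Longrightarrow> (norm (\<Sum>i\<in>I. P i x))\<^sup>2 = (\<Sum>i\<in>I. (norm (P i x))\<^sup>2)"
  using inner_orth_proj[OF orth_proj_sum, of I x]
  by (simp add: inner_sum_left inner_orth_proj[OF P])

end

lemma ex_orth_proj_suminf: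
  fixes P :: "nat \<Rightarrow> 'a::{real_inner, banach} \<Rightarrow> 'a"
  assumes P: "\<And>i. orth_proj (P i)" and orth: "\<And>i j x. i \<noteq> j \<Longrightarrow> P i (P j x) = 0"
  shows "\<exists>Q. orth_proj Q \<and> (\<forall>x. (\<lambda>n. \<Sum>i<n. P i x) \<longlonglongrightarrow> Q x)"
proof -
  let ?S = "\<lambda>x n. \<Sum>i<n. P i x" and ?s = "\<lambda>x n. \<Sum>i<n. (norm (P i x))\<^sup>2"
  have "convergent (?S x)" for x
  proof (rule Cauchy_convergent, rule Cauchy_of_dist_sq_le_abs_diff)
    show "convergent (?s x)"
    proof (rule incseq_convergent)
      show "incseq (?s x)" by (auto simp: incseq_def intro!: sum_mono2)
      have "norm (?S x n) \<le> norm x" for n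
        by (rule norm_orth_proj_le[OF orth_proj_sum[OF P orth finite_lessThan]])
      then have "(norm (?S x n))\<^sup>2 \<le> (norm x)\<^sup>2" for n
        by (rule power_mono) simp
      then show "\<forall>n. ?s x n \<le> (norm x)\<^sup>2"
        by (simp only: norm_sum_orth_proj[OF P orth finite_lessThan] simp_thms)
    qed (auto simp: convergent_def)
    show "(dist (?S x m) (?S x n))\<^sup>2 \<le> \<bar>?s x m - ?s x n\<bar>" if "m \<le> n" for m n
    proof -
      have split: "sum f {..<n} = sum f {..<m} + sum f {m..<n}" for f :: "nat \<Rightarrow> 'b::comm_monoid_add"
        using that by (simp add: sum.atLeastLessThan_concat flip: atLeast0LessThan)
      show ?thesis
        by (simp add: split dist_norm norm_sum_orth_proj[OF P orth finite_atLeastLessThan] sum_nonneg)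
    qed
  qed
  then obtain Q where Q_lim: "\<And>x. ?S x \<longlonglongrightarrow> Q x" unfolding convergent_def by metis
  have "orth_proj (\<lambda>x. ?S x n)" for n by (rule orth_proj_sum[OF P orth finite_lessThan])
  from orth_proj_LIMSEQ[OF this Q_lim] show ?thesis using Q_lim by blast
qed

section \<open>Square roots of positive operators\<close>

locale positive_operator =
  fixes A :: "'a::{real_inner, banach} \<Rightarrow> 'a"
  assumes self_adjoint: "self_adjoint A" and nonneg: "0 \<le> inner (A x) x"
begin

lemmas bounded_linear = self_adjoint_bounded_linear[OF self_adjoint]
  and op_inner = self_adjoint_inner[OF self_adjoint]
  and op_add = self_adjoint_add[OF self_adjoint]
  and op_diff = self_adjoint_diff[OF self_adjoint]
  and op_scaleR = self_adjoint_scaleR[OF self_adjoint]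
  and op_0 = self_adjoint_0[OF self_adjoint]

lemma Cauchy_Schwarz_quadratic_form: "(inner (A x) y)\<^sup>2 \<le> inner (A x) x * inner (A y) y"
proof -
  define a b c where "a = inner (A x) x" and "b = inner (A x) y" and "c = inner (A y) y"
  have quadratic: "0 \<le> a + 2 * t * b + t\<^sup>2 * c" for t
  proof -
    have "inner (A (x + t *\<^sub>R y)) (x + t *\<^sub>R y) = a + 2 * t * b + t\<^sup>2 * c"
      using op_inner[of y x]
      by (simp add: a_def b_def c_def op_add op_scaleR inner_simps inner_commute[of y "A x"]
          power2_eq_square algebra_simps)
    then show ?thesis using nonneg by metis
  qed
  have "b\<^sup>2 \<le> a * c"
  proof (cases "c = 0")
    case True
    have "b = 0"
    proof (rule ccontr)
      assume "b \<noteq> 0"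
      then show False using quadratic[of "- (a + 1) / (2 * b)"] True by (simp add: field_simps)
    qed
    then show ?thesis using True by simp
  next
    case False
    then have "0 < c" using nonneg[of y] by (simp add: c_def)
    then show ?thesis using quadratic[of "- b / c"] by (simp add: power2_eq_square field_simps)
  qed
  then show ?thesis by (simp only: a_def b_def c_def)
qed

lemma norm_power4_le: "((norm (A x))\<^sup>2)\<^sup>2 \<le> inner (A x) x * inner (A (A x)) (A x)"
  using Cauchy_Schwarz_quadratic_form[of x "A x"] by (simp add: power2_norm_eq_inner)

lemma norm_sq_le_quadratic_form:
  assumes "\<And>x. norm (A x) \<le> K * norm x"
  shows "(norm (A x))\<^sup>2 \<le> K * inner (A x) x"
proof (cases "A x = 0")
  case False
  have "inner (A (A x)) (A x) \<le> norm (A (A x)) * norm (A x)" by (rule norm_cauchy_schwarz)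
  also have "\<dots> \<le> K * (norm (A x))\<^sup>2"
    using mult_right_mono[OF assms, of "norm (A x)" "A x"]
    by (simp add: power2_eq_square mult.assoc)
  finally have "inner (A x) x * inner (A (A x)) (A x) \<le> inner (A x) x * (K * (norm (A x))\<^sup>2)"
    by (rule mult_left_mono) (rule nonneg)
  with norm_power4_le[of x]
  have "(norm (A x))\<^sup>2 * (norm (A x))\<^sup>2 \<le> (K * inner (A x) x) * (norm (A x))\<^sup>2"
    by (simp add: power2_eq_square mult_ac)
  then show ?thesis by (rule mult_right_le_imp_le) (use False in simp)
qed simp

lemma norm_diff_scaled_le:
  assumes K_pos: "0 < K" and norm_le: "\<And>x. norm (A x) \<le> K * norm x"
  shows "norm (x - (1 / K) *\<^sub>R A x) \<le> norm x"
proof (rule power2_le_imp_le)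
  have "(norm (A x))\<^sup>2 / K\<^sup>2 \<le> inner (A x) x / K"
    using norm_sq_le_quadratic_form[OF norm_le, of x] K_pos
    by (simp add: power2_eq_square divide_simps mult.commute)
  moreover have "(norm (x - (1 / K) *\<^sub>R A x))\<^sup>2
      = (norm x)\<^sup>2 - 2 * (inner (A x) x / K) + (norm (A x))\<^sup>2 / K\<^sup>2"
    unfolding power2_norm_eq_inner by (simp add: inner_simps inner_commute power2_eq_square)
  moreover have "0 \<le> inner (A x) x / K" using nonneg K_pos by simp
  ultimately show "(norm (x - (1 / K) *\<^sub>R A x))\<^sup>2 \<le> (norm x)\<^sup>2" by linarith
qed simp

lemma norm_le_of_quadratic_form_le:
  assumes l_nonneg: "0 \<le> l"
    and form_x: "inner (A x) x \<le> l * (norm x)\<^sup>2"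
    and form_Ax: "inner (A (A x)) (A x) \<le> l * (norm (A x))\<^sup>2"
  shows "norm (A x) \<le> l * norm x"
proof (cases "A x = 0")
  case False
  note norm_power4_le[of x]
  also have "inner (A x) x * inner (A (A x)) (A x) \<le> (l * (norm x)\<^sup>2) * (l * (norm (A x))\<^sup>2)"
    using l_nonneg by (intro mult_mono form_x form_Ax nonneg) auto
  finally have "(norm (A x))\<^sup>2 * (norm (A x))\<^sup>2 \<le> (l * norm x)\<^sup>2 * (norm (A x))\<^sup>2"
    by (simp add: power2_eq_square mult_ac)
  then have "(norm (A x))\<^sup>2 \<le> (l * norm x)\<^sup>2" by (rule mult_right_le_imp_le) (use False in simp)
  then show ?thesis by (rule power2_le_imp_le) (use l_nonneg in simp)
qed (use l_nonneg in simp)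

end

text \<open>For \<open>\<parallel>X\<parallel> \<le> 1\<close> the iteration \<open>Y \<mapsto> (X + Y\<^sup>2) / 2\<close> converges to \<open>1 - \<surd>(1 - X)\<close>, because it is
  majorized by the scalar iteration with \<open>X\<close> replaced by \<open>1\<close>, which increases and stays below \<open>1\<close>.\<close>

primrec sqrt_iter :: "('a::real_normed_vector \<Rightarrow>\<^sub>L 'a) \<Rightarrow> nat \<Rightarrow> 'a \<Rightarrow>\<^sub>L 'a" where
  "sqrt_iter X 0 = 0"
| "sqrt_iter X (Suc n) = (1/2) *\<^sub>R (X + (sqrt_iter X n o\<^sub>L sqrt_iter X n))"

primrec sqrt_majorant :: "nat \<Rightarrow> real" where
  "sqrt_majorant 0 = 0"
| "sqrt_majorant (Suc n) = (1 + (sqrt_majorant n)\<^sup>2) / 2"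

lemma sqrt_majorant_bounds: "0 \<le> sqrt_majorant n \<and> sqrt_majorant n \<le> 1"
  by (induction n) (auto simp: power_le_one)

lemma incseq_sqrt_majorant: "incseq sqrt_majorant"
proof (rule incseq_SucI)
  show "sqrt_majorant n \<le> sqrt_majorant (Suc n)" for n
    using zero_le_power2[of "1 - sqrt_majorant n"] by (simp add: power2_diff)
qed

lemma convergent_sqrt_majorant: "convergent sqrt_majorant"
  by (metis convergent_def incseq_convergent incseq_sqrt_majorant sqrt_majorant_bounds)

context
  fixes X :: "'a::banach \<Rightarrow>\<^sub>L 'a"
  assumes X: "norm X \<le> 1"
begin

lemma norm_sqrt_iter_le: "norm (sqrt_iter X n) \<le> sqrt_majorant n"
proof (induction n)
  case (Suc n)
  have "norm (X + (sqrt_iter X n o\<^sub>L sqrt_iter X n)) \<le> 1 + sqrt_majorant n * sqrt_majorant n"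
    by (intro norm_triangle_mono X order_trans[OF norm_blinfun_compose] mult_mono Suc)
      (use sqrt_majorant_bounds in auto)
  then show ?case by (simp add: power2_eq_square)
qed simp

lemma norm_sqrt_iter_step_le:
  "norm (sqrt_iter X (Suc n) - sqrt_iter X n) \<le> sqrt_majorant (Suc n) - sqrt_majorant n"
proof (induction n)
  case 0
  show ?case using X by simp
next
  case (Suc n)
  define Y Z y z where "Y = sqrt_iter X n" and "Z = sqrt_iter X (Suc n)"
    and "y = sqrt_majorant n" and "z = sqrt_majorant (Suc n)"
  have "0 \<le> y" "0 \<le> z" "norm Y \<le> y" "norm Z \<le> z" "norm (Z - Y) \<le> z - y"
    using sqrt_majorant_bounds norm_sqrt_iter_le Suc.IH by (simp_all only: Y_def Z_def y_def z_def)
  then have norm_sum_le: "norm (((Z - Y) o\<^sub>L Z) + (Y o\<^sub>L (Z - Y))) \<le> (z - y) * z + y * (z - y)"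
    by (intro norm_triangle_mono order_trans[OF norm_blinfun_compose] mult_mono)
      (auto intro: order_trans[OF norm_ge_zero] simp del: diff_ge_0_iff_ge)
  have "sqrt_iter X (Suc (Suc n)) - sqrt_iter X (Suc n) = (1/2) *\<^sub>R ((Z o\<^sub>L Z) - (Y o\<^sub>L Y))"
    unfolding sqrt_iter.simps(2)[of X "Suc n"] sqrt_iter.simps(2)[of X n]
    by (simp add: Y_def Z_def scaleR_diff_right[symmetric])
  also have "(Z o\<^sub>L Z) - (Y o\<^sub>L Y) = ((Z - Y) o\<^sub>L Z) + (Y o\<^sub>L (Z - Y))"
    by (simp add: bounded_bilinear.diff_left[OF bounded_bilinear_blinfun_compose]
        bounded_bilinear.diff_right[OF bounded_bilinear_blinfun_compose])
  also have "norm ((1/2) *\<^sub>R \<dots>) \<le> 1/2 * ((z - y) * z + y * (z - y))"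
    using norm_sum_le by simp
  also have "\<dots> = sqrt_majorant (Suc (Suc n)) - sqrt_majorant (Suc n)"
    by (simp add: y_def z_def power2_eq_square algebra_simps)
  finally show ?case .
qed

lemma convergent_sqrt_iter: "convergent (sqrt_iter X)"
proof (rule Cauchy_convergent, rule Cauchy_of_dist_sq_le_abs_diff[OF _ convergent_sqrt_majorant])
  fix m n :: nat assume "m \<le> n"
  then have "norm (sqrt_iter X n - sqrt_iter X m) \<le> sqrt_majorant n - sqrt_majorant m"
  proof (induction rule: dec_induct)
    case (step k)
    show ?case
      using norm_triangle_mono[OF norm_sqrt_iter_step_le[of k] step.IH]
      by (simp del: sqrt_iter.simps sqrt_majorant.simps)
  qed simp
  then have "dist (sqrt_iter X m) (sqrt_iter X n) \<le> \<bar>sqrt_majorant m - sqrt_majorant n\<bar>"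
    by (simp add: dist_norm norm_minus_commute)
  moreover have "\<bar>sqrt_majorant m - sqrt_majorant n\<bar> \<le> 1"
    using sqrt_majorant_bounds[of m] sqrt_majorant_bounds[of n] by linarith
  ultimately show "(dist (sqrt_iter X m) (sqrt_iter X n))\<^sup>2 \<le> \<bar>sqrt_majorant m - sqrt_majorant n\<bar>"
    by (smt (verit) power2_eq_square mult_left_le zero_le_dist power_mono)
qed

lemma ex_sqrt_iter_limit:
  obtains Y where "sqrt_iter X \<longlonglongrightarrow> Y" "2 *\<^sub>R Y = X + (Y o\<^sub>L Y)" "norm Y \<le> 1"
proof -
  obtain Y where Y_lim: "sqrt_iter X \<longlonglongrightarrow> Y"
    using convergent_sqrt_iter by (auto simp: convergent_def)
  have "(\<lambda>n. sqrt_iter X (Suc n)) \<longlonglongrightarrow> (1/2) *\<^sub>R (X + (Y o\<^sub>L Y))"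
    unfolding sqrt_iter.simps(2) by (intro tendsto_intros Y_lim)
  then have "Y = (1/2) *\<^sub>R (X + (Y o\<^sub>L Y))"
    using Y_lim LIMSEQ_Suc LIMSEQ_unique by blast
  then have "2 *\<^sub>R Y = X + (Y o\<^sub>L Y)" by (metis scaleR_half_double scaleR_2 scaleR_right_distrib)
  moreover have "norm (sqrt_iter X n) \<le> 1" for n
    using norm_sqrt_iter_le sqrt_majorant_bounds order_trans by blast
  then have "norm Y \<le> 1" by (intro LIMSEQ_le_const2[OF tendsto_norm[OF Y_lim]]) auto
  ultimately show ?thesis using that Y_lim by blast
qed

end

lemma sqrt_iter_commute:
  assumes "T o\<^sub>L X = X o\<^sub>L T"
  shows "T o\<^sub>L sqrt_iter X n = sqrt_iter X n o\<^sub>L T"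
proof (induction n)
  case (Suc n)
  have T_commute_X: "T (X x) = X (T x)" for x
    using arg_cong[OF assms, of "\<lambda>S. blinfun_apply S x"] by simp
  have T_commute_iter: "T (sqrt_iter X n x) = sqrt_iter X n (T x)" for x
    using arg_cong[OF Suc.IH, of "\<lambda>S. blinfun_apply S x"] by simp
  show ?case
    by (rule blinfun_eqI)
      (simp add: T_commute_X T_commute_iter blinfun.add_left blinfun.add_right
        blinfun.scaleR_left blinfun.scaleR_right)
qed (rule blinfun_eqI, simp)

lemma inner_sqrt_iter:
  assumes "self_adjoint (blinfun_apply X)"
  shows "inner (sqrt_iter X n x) y = inner x (sqrt_iter X n y)"
  by (induction n arbitrary: x y)
    (simp_all add: blinfun.add_left blinfun.scaleR_left inner_simps self_adjoint_inner[OF assms])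

lemma sqrt_iter_limit_commute:
  assumes lim: "sqrt_iter X \<longlonglongrightarrow> Y" and comm: "T o\<^sub>L X = X o\<^sub>L T"
  shows "T o\<^sub>L Y = Y o\<^sub>L T"
proof (rule LIMSEQ_unique)
  show "(\<lambda>n. T o\<^sub>L sqrt_iter X n) \<longlonglongrightarrow> (T o\<^sub>L Y)" by (intro tendsto_intros lim)
  show "(\<lambda>n. T o\<^sub>L sqrt_iter X n) \<longlonglongrightarrow> (Y o\<^sub>L T)"
    unfolding sqrt_iter_commute[OF comm] by (intro tendsto_intros lim)
qed

lemma self_adjoint_sqrt_iter_limit:
  assumes lim: "sqrt_iter X \<longlonglongrightarrow> Y" and X: "self_adjoint (blinfun_apply X)"
  shows "self_adjoint (blinfun_apply Y)"
proof -
  have "inner (Y x) y = inner x (Y y)" for x y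
  proof (rule LIMSEQ_unique)
    show "(\<lambda>n. inner (sqrt_iter X n x) y) \<longlonglongrightarrow> inner (Y x) y" by (intro tendsto_intros lim)
    show "(\<lambda>n. inner (sqrt_iter X n x) y) \<longlonglongrightarrow> inner x (Y y)"
      unfolding inner_sqrt_iter[OF X] by (intro tendsto_intros lim)
  qed
  then show ?thesis by (simp add: self_adjoint_def blinfun.bounded_linear_right)
qed

lemma inner_blinfun_le_of_norm_le_1:
  fixes Y :: "'a::real_inner \<Rightarrow>\<^sub>L 'a"
  assumes "norm Y \<le> 1"
  shows "inner (Y x) x \<le> inner x x"
proof -
  have "inner (Y x) x \<le> norm (Y x) * norm x" by (rule norm_cauchy_schwarz)
  also have "\<dots> \<le> (1 * norm x) * norm x"
    using order_trans[OF norm_blinfun mult_right_mono[OF assms]] by (intro mult_right_mono) auto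
  finally show ?thesis by (simp add: dot_square_norm power2_eq_square)
qed

lemma ex_sqrt_id_minus:
  fixes X :: "'a::{real_inner, banach} \<Rightarrow>\<^sub>L 'a"
  assumes X: "self_adjoint (blinfun_apply X)" "norm X \<le> 1"
  obtains Q where "positive_operator Q" "\<And>x. Q (Q x) = x - X x"
    "\<And>T x. bounded_linear T \<Longrightarrow> (\<And>x. T (X x) = X (T x)) \<Longrightarrow> T (Q x) = Q (T x)"
proof -
  obtain Y where Y_lim: "sqrt_iter X \<longlonglongrightarrow> Y" and Y_fixpoint: "2 *\<^sub>R Y = X + (Y o\<^sub>L Y)"
    and norm_Y_le: "norm Y \<le> 1"
    by (rule ex_sqrt_iter_limit[OF X(2)])
  define Q where "Q x = x - Y x" for x
  have "self_adjoint Q"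
    unfolding Q_def[abs_def]
    by (intro self_adjoint_minus self_adjoint_ident self_adjoint_sqrt_iter_limit[OF Y_lim X(1)])
  moreover have "0 \<le> inner (Q x) x" for x
    using inner_blinfun_le_of_norm_le_1[OF norm_Y_le, of x] by (simp add: Q_def inner_diff_left)
  ultimately have "positive_operator Q" by unfold_locales
  moreover have "Q (Q x) = x - X x" for x
  proof -
    have "2 *\<^sub>R Y x = X x + Y (Y x)"
      using arg_cong[OF Y_fixpoint, of "\<lambda>S. blinfun_apply S x"]
      by (simp add: blinfun.add_left blinfun.scaleR_left)
    then show ?thesis by (simp add: Q_def blinfun.diff_right scaleR_2 algebra_simps)
  qed
  moreover have "T (Q x) = Q (T x)"
    if T: "bounded_linear T" and T_commute: "\<And>x. T (X x) = X (T x)" for T x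
  proof -
    have "Blinfun T o\<^sub>L X = X o\<^sub>L Blinfun T"
      by (rule blinfun_eqI) (simp add: bounded_linear_Blinfun_apply[OF T] T_commute)
    from arg_cong[OF sqrt_iter_limit_commute[OF Y_lim this], of "\<lambda>S. blinfun_apply S x"]
    show ?thesis
      by (simp add: Q_def bounded_linear_Blinfun_apply[OF T]
          linear_diff[OF bounded_linear.linear[OF T]])
  qed
  ultimately show ?thesis by (rule that)
qed

lemma ex_sqrt_operator:
  fixes B :: "'a::{real_inner, banach} \<Rightarrow> 'a"
  assumes "positive_operator B"
  obtains Q where "positive_operator Q" "\<And>x. Q (Q x) = B x"
    "\<And>T x. bounded_linear T \<Longrightarrow> (\<And>x. T (B x) = B (T x)) \<Longrightarrow> T (Q x) = Q (T x)"
proof -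
  interpret B: positive_operator B by fact
  define K where "K = onorm B + 1"
  have K_pos: "0 < K" using onorm_pos_le[OF B.bounded_linear] by (simp add: K_def)
  define X where "X = Blinfun (\<lambda>x. x - (1 / K) *\<^sub>R B x)"
  have self_adjoint_X: "self_adjoint (\<lambda>x. x - (1 / K) *\<^sub>R B x)"
    by (intro self_adjoint_minus self_adjoint_ident self_adjoint_scaled B.self_adjoint)
  then have X_apply: "blinfun_apply X = (\<lambda>x. x - (1 / K) *\<^sub>R B x)"
    unfolding X_def by (intro bounded_linear_Blinfun_apply self_adjoint_bounded_linear)
  have "norm (B x) \<le> K * norm x" for x
    using onorm[OF B.bounded_linear, of x] by (simp add: K_def distrib_right add_increasing2)
  then have "norm X \<le> 1"
    by (intro norm_blinfun_bound) (simp_all add: X_apply B.norm_diff_scaled_le[OF K_pos])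
  then obtain R where "positive_operator R" and R_square: "\<And>x. R (R x) = x - X x"
    and R_commute: "\<And>T x. bounded_linear T \<Longrightarrow> (\<And>x. T (X x) = X (T x)) \<Longrightarrow> T (R x) = R (T x)"
    using ex_sqrt_id_minus[of X] self_adjoint_X unfolding X_apply by blast
  interpret R: positive_operator R by fact
  show ?thesis
  proof (rule that[of "\<lambda>x. sqrt K *\<^sub>R R x"])
    show "positive_operator (\<lambda>x. sqrt K *\<^sub>R R x)"
      by unfold_locales (use K_pos R.nonneg in \<open>simp_all add: self_adjoint_scaled R.self_adjoint\<close>)
    show "sqrt K *\<^sub>R R (sqrt K *\<^sub>R R x) = B x" for x
      using K_pos by (simp add: R.op_scaleR R_square X_apply)
    show "T (sqrt K *\<^sub>R R x) = sqrt K *\<^sub>R R (T x)"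
      if T: "bounded_linear T" and T_commute: "\<And>x. T (B x) = B (T x)" for T x
    proof -
      note linear = bounded_linear.linear[OF T]
      have "T (R x) = R (T x)"
        by (rule R_commute[OF T])
          (simp add: X_apply linear_diff[OF linear] linear_scale[OF linear] T_commute)
      then show ?thesis by (simp add: linear_scale[OF linear])
    qed
  qed
qed

lemma ex_abs_operator:
  fixes S :: "'a::{real_inner, banach} \<Rightarrow> 'a"
  assumes S: "self_adjoint S"
  obtains W where "positive_operator W" "\<And>x. W (W x) = S (S x)"
    "\<And>T x. bounded_linear T \<Longrightarrow> (\<And>x. T (S x) = S (T x)) \<Longrightarrow> T (W x) = W (T x)"
proof -
  have "inner (S (S x)) x = inner (S x) (S x)" for x
    by (simp add: self_adjoint_inner[OF S])
  then have "positive_operator (\<lambda>x. S (S x))"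
    by unfold_locales (simp_all add: self_adjoint_square[OF S])
  then obtain W where "positive_operator W" "\<And>x. W (W x) = S (S x)"
    "\<And>T x. bounded_linear T \<Longrightarrow> (\<And>x. T (S (S x)) = S (S (T x))) \<Longrightarrow> T (W x) = W (T x)"
    by (rule ex_sqrt_operator) blast
  then show ?thesis using that by metis
qed

section \<open>The spectral subspaces of a positive operator\<close>

lemma bounded_linear_funpow:
  fixes T :: "'a::real_normed_vector \<Rightarrow> 'a"
  assumes "bounded_linear T"
  shows "bounded_linear (T ^^ n)"
proof (induction n)
  case (Suc n)
  then show ?case using bounded_linear_compose[OF assms] by (simp add: o_def)
qed (simp add: id_def bounded_linear_ident)

lemma funpow_commute:
  assumes "\<And>x. T (X x) = X (T x)"
  shows "T ((X ^^ n) x) = (X ^^ n) (T x)"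
  by (induction n) (simp_all add: assms)

lemma log_convex_seq_ge_geometric:
  fixes u :: "nat \<Rightarrow> real"
  assumes log_convex: "\<And>n. (u (Suc n))\<^sup>2 \<le> u n * u (Suc (Suc n))" and u_pos: "0 < u 0" "0 < u 1"
  shows "(u 1 / u 0) ^ n * u 0 \<le> u n"
proof -
  define r where "r = u 1 / u 0"
  have r_pos: "0 < r" using u_pos by (simp add: r_def)
  have step: "0 < u n \<and> r * u n \<le> u (Suc n)" for n
  proof (induction n)
    case 0
    then show ?case using u_pos by (simp add: r_def)
  next
    case (Suc n)
    then have "0 < u (Suc n)" using r_pos by (meson less_le_trans mult_pos_pos)
    then have "r * u n * u (Suc n) \<le> (u (Suc n))\<^sup>2" using Suc by (simp add: power2_eq_square)
    also note log_convex
    finally have "u n * (r * u (Suc n)) \<le> u n * u (Suc (Suc n))" by (simp add: mult_ac)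
    then show ?case using Suc \<open>0 < u (Suc n)\<close> by simp
  qed
  have "r ^ n * u 0 \<le> u n"
  proof (induction n)
    case (Suc n)
    then have "r ^ Suc n * u 0 \<le> r * u n" using r_pos by (simp add: mult.assoc)
    then show ?case using step order_trans by blast
  qed simp
  then show ?thesis by (simp add: r_def)
qed

lemma log_convex_seq_ratio_le:
  fixes u :: "nat \<Rightarrow> real"
  assumes nonneg: "\<And>n. 0 \<le> u n" and log_convex: "\<And>n. (u (Suc n))\<^sup>2 \<le> u n * u (Suc (Suc n))"
    and l_nonneg: "0 \<le> l" and growth: "\<And>n. u n \<le> C * l ^ n"
  shows "u 1 \<le> l * u 0"
proof (rule ccontr)
  assume ratio_gt: "\<not> u 1 \<le> l * u 0"
  then have u1_pos: "0 < u 1" using mult_nonneg_nonneg[OF l_nonneg nonneg[of 0]] by linarith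
  then have "u 0 \<noteq> 0" using log_convex[of 0] by auto
  then have u0_pos: "0 < u 0" using nonneg[of 0] by simp
  have geometric_le: "(u 1 / u 0) ^ n * u 0 \<le> C * l ^ n" for n
    using log_convex_seq_ge_geometric[of u, OF log_convex u0_pos u1_pos] growth order_trans by blast
  have "l \<noteq> 0"
  proof
    assume "l = 0"
    then show False using geometric_le[of 1] u0_pos u1_pos by simp
  qed
  then have "(u 1 / u 0 / l) ^ n \<le> C / u 0" for n
    using geometric_le[of n] l_nonneg u0_pos by (simp add: power_divide field_simps)
  moreover have "1 < u 1 / u 0 / l" using ratio_gt l_nonneg u0_pos \<open>l \<noteq> 0\<close>
    by (simp add: field_simps)
  then obtain n where "C / u 0 < (u 1 / u 0 / l) ^ n" using real_arch_pow by blast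
  ultimately show False by (meson not_le)
qed

context positive_operator
begin

lemmas linear_funpow = bounded_linear.linear[OF bounded_linear_funpow[OF bounded_linear]]

text \<open>The range of the spectral projection on \<open>(-\<infinity>, l]\<close> consists of the vectors whose orbit under
  \<open>A\<close> grows at rate at most \<open>l\<close>; for \<open>l < 0\<close> the condition at \<open>n = 0\<close> leaves only the zero vector.\<close>

definition low_space :: "real \<Rightarrow> 'a set" where
  "low_space l = {x. \<forall>n. norm ((A ^^ Suc n) x) \<le> l * norm ((A ^^ n) x)}"

lemma norm_le_of_low_space: "x \<in> low_space l \<Longrightarrow> norm (A x) \<le> l * norm x"
  unfolding low_space_def by (drule CollectD, drule spec[of _ 0]) simp

lemma quadratic_form_le_of_low_space:
  assumes "x \<in> low_space l"
  shows "inner (A x) x \<le> l * (norm x)\<^sup>2"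
  using norm_cauchy_schwarz[of "A x" x]
    mult_right_mono[OF norm_le_of_low_space[OF assms], of "norm x"]
  by (simp add: power2_eq_square)

lemma low_space_neg:
  assumes "l < 0"
  shows "low_space l = {0}"
proof
  show "low_space l \<subseteq> {0}"
  proof
    fix x assume "x \<in> low_space l"
    then have "0 \<le> l * norm x"
      using norm_le_of_low_space order_trans[OF norm_ge_zero] by blast
    then show "x \<in> {0}" using assms by (auto simp: zero_le_mult_iff)
  qed
  show "{0} \<subseteq> low_space l"
    by (simp add: low_space_def linear_0[OF linear_funpow] del: funpow.simps)
qed

lemma low_space_iff_growth:
  assumes l_nonneg: "0 \<le> l"
  shows "x \<in> low_space l \<longleftrightarrow> (\<exists>C. \<forall>n. norm ((A ^^ n) x) \<le> C * l ^ n)"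
proof
  assume x_low: "x \<in> low_space l"
  have "norm ((A ^^ n) x) \<le> norm x * l ^ n" for n
  proof (induction n)
    case (Suc n)
    have "norm ((A ^^ Suc n) x) \<le> l * norm ((A ^^ n) x)" using x_low by (simp add: low_space_def)
    also have "\<dots> \<le> l * (norm x * l ^ n)" using Suc l_nonneg by (intro mult_left_mono)
    finally show ?case by (simp add: mult_ac)
  qed simp
  then show "\<exists>C. \<forall>n. norm ((A ^^ n) x) \<le> C * l ^ n" by blast
next
  assume "\<exists>C. \<forall>n. norm ((A ^^ n) x) \<le> C * l ^ n"
  then obtain C where growth: "\<And>n. norm ((A ^^ n) x) \<le> C * l ^ n" by blast
  have log_convex: "(norm (A y))\<^sup>2 \<le> norm y * norm (A (A y))" for y
    using norm_cauchy_schwarz[of y "A (A y)"] by (simp add: power2_norm_eq_inner op_inner)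
  have "norm ((A ^^ (k + 1)) x) \<le> l * norm ((A ^^ (k + 0)) x)" for k
  proof (rule log_convex_seq_ratio_le[OF _ _ l_nonneg])
    show "(norm ((A ^^ (k + Suc n)) x))\<^sup>2
        \<le> norm ((A ^^ (k + n)) x) * norm ((A ^^ (k + Suc (Suc n))) x)" for n
      using log_convex[of "(A ^^ (k + n)) x"] by simp
    show "norm ((A ^^ (k + n)) x) \<le> C * l ^ k * l ^ n" for n
      using growth[of "k + n"] by (simp add: power_add mult.assoc)
  qed simp
  then show "x \<in> low_space l" by (simp add: low_space_def)
qed

lemma low_space_invariant:
  assumes T: "bounded_linear T" "\<And>x. T (A x) = A (T x)" and x_low: "x \<in> low_space l"
  shows "T x \<in> low_space l"
proof (cases "l < 0")
  case True
  then show ?thesis using x_low linear_0[OF bounded_linear.linear[OF T(1)]]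
    by (simp add: low_space_neg)
next
  case False
  then have l_nonneg: "0 \<le> l" by simp
  obtain C where growth: "\<And>n. norm ((A ^^ n) x) \<le> C * l ^ n"
    using x_low low_space_iff_growth[OF l_nonneg] by blast
  have "norm ((A ^^ n) (T x)) \<le> (onorm T * C) * l ^ n" for n
  proof -
    have "norm ((A ^^ n) (T x)) \<le> onorm T * norm ((A ^^ n) x)"
      using onorm[OF T(1)] by (simp add: funpow_commute[of T A, OF T(2), symmetric])
    also have "\<dots> \<le> onorm T * (C * l ^ n)" by (intro mult_left_mono growth onorm_pos_le T(1))
    finally show ?thesis by (simp add: mult.assoc)
  qed
  then show ?thesis using low_space_iff_growth[OF l_nonneg] by blast
qed

lemma subspace_low_space: "subspace (low_space l)"
proof (cases "l < 0")
  case True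
  then show ?thesis by (simp add: low_space_neg subspace_single_0)
next
  case False
  then have l_nonneg: "0 \<le> l" by simp
  show ?thesis
  proof (rule subspaceI)
    show "0 \<in> low_space l" by (simp add: low_space_def linear_0[OF linear_funpow] del: funpow.simps)
  next
    fix x y assume "x \<in> low_space l" "y \<in> low_space l"
    then obtain C D where "\<And>n. norm ((A ^^ n) x) \<le> C * l ^ n" "\<And>n. norm ((A ^^ n) y) \<le> D * l ^ n"
      unfolding low_space_iff_growth[OF l_nonneg] by blast
    then have "norm ((A ^^ n) (x + y)) \<le> (C + D) * l ^ n" for n
      by (simp only: linear_add[OF linear_funpow] distrib_right norm_triangle_mono)
    then show "x + y \<in> low_space l" unfolding low_space_iff_growth[OF l_nonneg] by blast
  next
    show "c *\<^sub>R x \<in> low_space l" if "x \<in> low_space l" for c x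
      by (rule low_space_invariant[OF bounded_linear_scaleR_right _ that]) (simp add: op_scaleR)
  qed
qed

lemma closed_low_space: "closed (low_space l)"
proof -
  have "low_space l = (\<Inter>n. {x. norm ((A ^^ Suc n) x) \<le> l * norm ((A ^^ n) x)})"
    by (auto simp: low_space_def)
  moreover have "closed {x. norm ((A ^^ Suc n) x) \<le> l * norm ((A ^^ n) x)}" for n
    by (intro closed_Collect_le continuous_intros linear_continuous_on bounded_linear_funpow
        bounded_linear)
  ultimately show ?thesis by (simp add: closed_INT)
qed

lemma low_space_mono: "l \<le> m \<Longrightarrow> low_space l \<subseteq> low_space m"
  unfolding low_space_def by (auto intro!: order_trans[OF _ mult_right_mono[of l m]])

lemma INT_low_space:
  assumes s_lim: "decseq s" "s \<longlonglongrightarrow> l"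
  shows "(\<Inter>n. low_space (s n)) = low_space l"
proof
  show "low_space l \<subseteq> (\<Inter>n. low_space (s n))"
    using low_space_mono[OF decseq_ge[OF s_lim]] by blast
  show "(\<Inter>n. low_space (s n)) \<subseteq> low_space l"
  proof
    fix x assume x_mem: "x \<in> (\<Inter>n. low_space (s n))"
    have "norm ((A ^^ Suc k) x) \<le> l * norm ((A ^^ k) x)" for k
    proof (rule LIMSEQ_le_const)
      show "(\<lambda>n. s n * norm ((A ^^ k) x)) \<longlonglongrightarrow> l * norm ((A ^^ k) x)" by (intro tendsto_intros s_lim)
      show "\<exists>N. \<forall>n\<ge>N. norm ((A ^^ Suc k) x) \<le> s n * norm ((A ^^ k) x)"
        using x_mem by (auto simp: low_space_def)
    qed
    then show "x \<in> low_space l" by (simp add: low_space_def)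
  qed
qed

definition low_proj :: "real \<Rightarrow> 'a \<Rightarrow> 'a" where
  "low_proj l = proj_onto (low_space l)"

lemmas low_proj_mem =
    proj_onto_mem[OF subspace_low_space closed_low_space, folded low_proj_def]
  and inner_diff_low_proj =
    inner_diff_proj_onto[OF subspace_low_space closed_low_space, folded low_proj_def]
  and low_proj_fixed =
    proj_onto_fixed[OF subspace_low_space closed_low_space, folded low_proj_def]
  and orth_proj_low_proj =
    orth_proj_proj_onto[OF subspace_low_space closed_low_space, folded low_proj_def]

lemma low_proj_commute:
  assumes T: "bounded_linear T" "\<And>x. T (A x) = A (T x)"
    and T': "bounded_linear T'" "\<And>x y. inner (T x) y = inner x (T' y)"
  shows "low_proj l (T x) = T (low_proj l x)"
  unfolding low_proj_def
proof (rule proj_onto_commute[OF subspace_low_space closed_low_space T(1) T'(2)])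
  have "inner y (T' (A x)) = inner y (A (T' x))" for x y
    by (metis T(2) T'(2) op_inner)
  then have "T' (A x) = A (T' x)" for x using vector_eq_ldot by blast
  then show "T' m \<in> low_space l" if "m \<in> low_space l" for m
    by (rule low_space_invariant[OF T'(1) _ that])
qed (rule low_space_invariant[OF T])

lemma low_proj_op: "low_proj l (A x) = A (low_proj l x)"
  by (rule low_proj_commute[OF bounded_linear refl bounded_linear op_inner])

lemma low_proj_low_proj:
  assumes "l \<le> m"
  shows "low_proj l (low_proj m x) = low_proj l x"
  unfolding low_proj_def
  by (intro proj_onto_proj_onto_subset subspace_low_space closed_low_space low_space_mono assms)

lemma LIMSEQ_low_proj:
  assumes s_lim: "decseq s" "s \<longlonglongrightarrow> l"
  shows "(\<lambda>n. low_proj (s n) x) \<longlonglongrightarrow> low_proj l x"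
  unfolding low_proj_def INT_low_space[OF s_lim, symmetric]
proof (rule LIMSEQ_proj_onto_INT[OF subspace_low_space closed_low_space])
  show "decseq (\<lambda>n. low_space (s n))"
    using s_lim(1) low_space_mono by (simp add: decseq_def)
qed

lemma low_proj_neg: "l < 0 \<Longrightarrow> low_proj l x = 0"
  using low_proj_mem[of l x] by (simp add: low_space_neg)

lemma low_proj_onorm: "low_proj (onorm A) x = x"
  by (rule low_proj_fixed) (simp add: low_space_def onorm[OF bounded_linear])

text \<open>With \<open>W = |A - l|\<close>, the kernel of \<open>W + (A - l)\<close> lies in the low space, and on its orthogonal
  complement \<open>A - l = W \<ge> 0\<close>.\<close>

lemma kernel_abs_plus_shift_subset_low_space:
  assumes l_nonneg: "0 \<le> l" and W: "positive_operator W" and A_commute_W: "\<And>x. A (W x) = W (A x)"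
    and x_kernel: "W x + (A x - l *\<^sub>R x) = 0"
  shows "x \<in> low_space l"
proof -
  interpret W: positive_operator W by fact
  define N where "N = {x. W x + (A x - l *\<^sub>R x) = 0}"
  have invariant: "A y \<in> N" if "y \<in> N" for y
  proof -
    have "W (A y) + (A (A y) - l *\<^sub>R A y) = A (W y + (A y - l *\<^sub>R y))"
      by (simp add: A_commute_W op_add op_diff op_scaleR)
    then show ?thesis using that by (simp add: N_def op_0)
  qed
  have "inner (A y) y \<le> l * (norm y)\<^sup>2" if "y \<in> N" for y
  proof -
    have "inner (W y + (A y - l *\<^sub>R y)) y = 0" using that by (simp add: N_def)
    then show ?thesis using W.nonneg[of y] by (simp add: inner_simps power2_norm_eq_inner)
  qed
  then have "norm (A y) \<le> l * norm y" if "y \<in> N" for y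
    using norm_le_of_quadratic_form_le[OF l_nonneg] that invariant by blast
  moreover have "(A ^^ n) x \<in> N" for n
    using x_kernel by (induction n) (simp_all add: N_def[symmetric] invariant, simp add: N_def)
  ultimately show ?thesis by (simp add: low_space_def)
qed

lemma quadratic_form_ge_of_low_space_orth:
  assumes orth: "\<And>m. m \<in> low_space l \<Longrightarrow> inner x m = 0"
  shows "l * (norm x)\<^sup>2 \<le> inner (A x) x"
proof (cases "l < 0")
  case True
  then have "l * (norm x)\<^sup>2 \<le> 0" by (simp add: mult_le_0_iff)
  then show ?thesis using nonneg[of x] by linarith
next
  case False
  define S where "S y = A y - l *\<^sub>R y" for y
  have S: "self_adjoint S"
    unfolding S_def[abs_def]
    by (intro self_adjoint_minus self_adjoint self_adjoint_scaled self_adjoint_ident)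
  obtain W where "positive_operator W" and W_square: "\<And>y. W (W y) = S (S y)"
    and commute: "\<And>T y. bounded_linear T \<Longrightarrow> (\<And>y. T (S y) = S (T y)) \<Longrightarrow> T (W y) = W (T y)"
    using ex_abs_operator[OF S] by blast
  interpret W: positive_operator W by fact
  have A_commute_W: "A (W y) = W (A y)" for y
    by (rule commute[OF bounded_linear]) (simp add: S_def op_diff op_scaleR)
  have S_commute_W: "S (W y) = W (S y)" for y
    by (rule commute[OF self_adjoint_bounded_linear[OF S] refl])
  define y where "y = W x - S x"
  have "W (W y - S y) + S (W y - S y) = 0"
    by (simp add: W.op_diff self_adjoint_diff[OF S] W_square S_commute_W)
  then have "W y - S y \<in> low_space l"
    using False \<open>positive_operator W\<close> A_commute_W
    by (intro kernel_abs_plus_shift_subset_low_space[of l W]) (simp_all add: S_def)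
  moreover have "inner y y = inner x (W y - S y)"
    by (simp add: y_def inner_diff_left inner_diff_right W.op_inner self_adjoint_inner[OF S]
        W.op_diff self_adjoint_diff[OF S])
  ultimately have "W x = S x" using orth by (simp add: y_def)
  then show ?thesis using W.nonneg[of x] by (simp add: S_def inner_simps power2_norm_eq_inner)
qed

end

section \<open>Projection-valued measures\<close>

definition projection_measure :: "(real set \<Rightarrow> 'a::{real_inner, banach} \<Rightarrow> 'a) \<Rightarrow> bool" where
  "projection_measure E \<longleftrightarrow>
     (\<forall>B\<in>sets borel. orth_proj (E B)) \<and>
     (\<exists>a. \<forall>x. E {-a<..<a} x = x) \<and>
     (\<forall>x. E {} x = 0) \<and>
     (\<forall>B\<in>sets borel. \<forall>C\<in>sets borel. \<forall>x. E B (E C x) = E (B \<inter> C) x) \<and>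
     (\<forall>B :: nat \<Rightarrow> real set. range B \<subseteq> sets borel \<longrightarrow> disjoint_family B \<longrightarrow>
        (\<forall>x. (\<lambda>n. \<Sum>i<n. E (B i) x) \<longlonglongrightarrow> E (\<Union>i. B i) x))"

definition diagonal_measure :: "(real set \<Rightarrow> 'a::{real_inner, banach} \<Rightarrow> 'a) \<Rightarrow> 'a \<Rightarrow> real measure" where
  "diagonal_measure E x = measure_of UNIV (sets borel) (\<lambda>B. ennreal (inner (E B x) x))"

definition resolves :: "('a::{real_inner, banach} \<Rightarrow> 'a) \<Rightarrow> (real set \<Rightarrow> 'a \<Rightarrow> 'a) \<Rightarrow> bool" where
  "resolves A E \<longleftrightarrow>
     projection_measure E \<and> (\<forall>x. inner (A x) x = (\<integral>t. t \<partial>diagonal_measure E x))"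

lemma borel_induct_atMost [consumes 1, case_names atMost empty compl union]:
  fixes Q :: "real set \<Rightarrow> bool"
  assumes B: "B \<in> sets borel"
    and atMost: "\<And>l. Q {..l}"
    and empty: "Q {}"
    and compl: "\<And>B. B \<in> sets borel \<Longrightarrow> Q B \<Longrightarrow> Q (- B)"
    and union: "\<And>B :: nat \<Rightarrow> real set. range B \<subseteq> sets borel \<Longrightarrow> disjoint_family B \<Longrightarrow>
      (\<And>i. Q (B i)) \<Longrightarrow> Q (\<Union>i. B i)"
  shows "Q B"
proof -
  have borel: "sets borel = sigma_sets UNIV (range (\<lambda>a::real. {..a}))"
    by (subst borel_eq_atMost) simp
  have "Int_stable (range (\<lambda>a::real. {..a}))" by (auto simp: Int_stable_def)
  moreover have "range (\<lambda>a::real. {..a}) \<subseteq> Pow UNIV" by simp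
  moreover note B[unfolded borel]
  ultimately show ?thesis
  proof (induction rule: sigma_sets_induct_disjoint)
    case (compl B)
    then show ?case using assms(4) by (simp add: borel Compl_eq_Diff_UNIV)
  qed (use assms in \<open>auto simp: borel\<close>)
qed

context
  fixes E :: "real set \<Rightarrow> 'a::{real_inner, banach} \<Rightarrow> 'a"
  assumes E: "projection_measure E"
begin

lemma projection_measure_orth_proj: "B \<in> sets borel \<Longrightarrow> orth_proj (E B)"
  and projection_measure_empty: "E {} x = 0"
  and projection_measure_Int: "B \<in> sets borel \<Longrightarrow> C \<in> sets borel \<Longrightarrow> E B (E C x) = E (B \<inter> C) x"
  and projection_measure_UN: "range D \<subseteq> sets borel \<Longrightarrow> disjoint_family D \<Longrightarrow>
    (\<lambda>n. \<Sum>i<n. E (D i) x) \<longlonglongrightarrow> E (\<Union>i. D i) x"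
  using E unfolding projection_measure_def by blast+

lemma projection_measure_nonneg: "B \<in> sets borel \<Longrightarrow> 0 \<le> inner (E B x) x"
  using inner_orth_proj[OF projection_measure_orth_proj] by simp

lemma projection_measure_UNIV: "E UNIV x = x"
proof -
  obtain a where "\<And>x. E {-a<..<a} x = x" using E unfolding projection_measure_def by blast
  then show ?thesis using projection_measure_Int[of UNIV "{-a<..<a}" x] by simp
qed

lemma projection_measure_Compl:
  assumes B_borel: "B \<in> sets borel"
  shows "E (- B) x = x - E B x"
proof -
  have "(\<Union>i. binaryset B (- B) i) = UNIV" by (simp add: UN_binaryset_eq)
  moreover have "(\<lambda>n. \<Sum>i<n. E (binaryset B (- B) i) x) \<longlonglongrightarrow> E (\<Union>i. binaryset B (- B) i) x"
    using B_borel
    by (intro projection_measure_UN)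
      (auto simp: range_binaryset_eq disjoint_family_on_def binaryset_def)
  ultimately have "(\<lambda>i. E (binaryset B (- B) i) x) sums x"
    by (simp add: sums_def projection_measure_UNIV)
  moreover have "(\<lambda>i. E (binaryset B (- B) i) x) sums (E B x + E (- B) x)"
    by (rule binaryset_sums) (simp add: projection_measure_empty)
  ultimately have "x = E B x + E (- B) x" by (rule sums_unique2)
  then show ?thesis by (simp add: algebra_simps)
qed

lemma projection_measure_commute:
  assumes T: "bounded_linear T" and atMost: "\<And>l x. T (E {..l} x) = E {..l} (T x)"
    and B_borel: "B \<in> sets borel"
  shows "T (E B x) = E B (T x)"
  using B_borel
proof (induction arbitrary: x rule: borel_induct_atMost)
  case (compl B)
  then show ?case
    by (simp add: projection_measure_Compl linear_diff[OF bounded_linear.linear[OF T]])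
next
  case (union B)
  note lim = projection_measure_UN[OF union(1,2)]
  have "(\<lambda>n. T (\<Sum>i<n. E (B i) x)) \<longlonglongrightarrow> T (E (\<Union>i. B i) x)"
    by (rule bounded_linear.tendsto[OF T lim])
  moreover have "T (\<Sum>i<n. E (B i) x) = (\<Sum>i<n. E (B i) (T x))" for n
    by (simp add: linear_sum[OF bounded_linear.linear[OF T]] union(3))
  ultimately have "(\<lambda>n. \<Sum>i<n. E (B i) (T x)) \<longlonglongrightarrow> T (E (\<Union>i. B i) x)" by simp
  then show ?case by (rule LIMSEQ_unique[OF _ lim])
qed (simp_all add: atMost projection_measure_empty linear_0[OF bounded_linear.linear[OF T]])

lemma sets_diagonal_measure: "sets (diagonal_measure E x) = sets borel"
  and space_diagonal_measure: "space (diagonal_measure E x) = UNIV"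
  using sets.sigma_sets_eq[of "borel :: real measure"] by (simp_all add: diagonal_measure_def)

lemmas measurable_diagonal_measure = measurable_cong_sets[OF sets_diagonal_measure refl]

lemma emeasure_diagonal_measure:
  assumes "B \<in> sets borel"
  shows "emeasure (diagonal_measure E x) B = ennreal (inner (E B x) x)"
  unfolding diagonal_measure_def
proof (rule emeasure_measure_of_sigma[OF _ _ _ assms])
  show "sigma_algebra UNIV (sets (borel :: real measure))"
    using sets.sigma_algebra_axioms[of "borel :: real measure"] by simp
  show "positive (sets borel) (\<lambda>B. ennreal (inner (E B x) x))"
    by (simp add: positive_def projection_measure_empty)
  show "countably_additive (sets borel) (\<lambda>B. ennreal (inner (E B x) x))"
  proof (rule countably_additiveI)
    fix D :: "nat \<Rightarrow> real set" assume D_disjoint: "range D \<subseteq> sets borel" "disjoint_family D"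
    have "(\<lambda>n. inner (\<Sum>i<n. E (D i) x) x) \<longlonglongrightarrow> inner (E (\<Union>i. D i) x) x"
      by (intro tendsto_intros projection_measure_UN D_disjoint)
    then have "(\<lambda>i. inner (E (D i) x) x) sums inner (E (\<Union>i. D i) x) x"
      by (simp add: sums_def inner_sum_left)
    then have "(\<lambda>i. ennreal (inner (E (D i) x) x)) sums ennreal (inner (E (\<Union>i. D i) x) x)"
      using D_disjoint(1) by (subst sums_ennreal) (auto intro!: projection_measure_nonneg)
    then show "(\<Sum>i. ennreal (inner (E (D i) x) x)) = ennreal (inner (E (\<Union>i. D i) x) x)"
      by (simp add: sums_iff)
  qed
qed

lemma measure_diagonal_measure:
  "B \<in> sets borel \<Longrightarrow> measure (diagonal_measure E x) B = inner (E B x) x"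
  by (simp add: measure_def emeasure_diagonal_measure projection_measure_nonneg)

lemma finite_diagonal_measure: "finite_measure (diagonal_measure E x)"
  by (rule finite_measureI) (simp add: emeasure_diagonal_measure space_diagonal_measure)

lemma AE_diagonal_measure_bounded: "\<exists>a. AE t in diagonal_measure E x. \<bar>t\<bar> < a"
proof -
  obtain a where E_bounded: "\<And>x. E {-a<..<a} x = x"
    using E unfolding projection_measure_def by blast
  then have "E (- {-a<..<a}) x = 0" by (simp add: projection_measure_Compl)
  then have "- {-a<..<a} \<in> null_sets (diagonal_measure E x)"
    by (auto simp: null_sets_def emeasure_diagonal_measure sets_diagonal_measure)
  from AE_not_in[OF this] have "AE t in diagonal_measure E x. \<bar>t\<bar> < a"
    by eventually_elim auto
  then show ?thesis by blast
qed

lemma integrable_diagonal_measure: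
  assumes "B \<in> sets borel"
  shows "integrable (diagonal_measure E x) (\<lambda>t. indicator B t * t)"
    and "integrable (diagonal_measure E x) (\<lambda>t. indicator B t * (c::real))"
proof -
  interpret finite_measure "diagonal_measure E x" by (rule finite_diagonal_measure)
  obtain a where t_bounded: "AE t in diagonal_measure E x. \<bar>t\<bar> < a"
    using AE_diagonal_measure_bounded by blast
  show "integrable (diagonal_measure E x) (\<lambda>t. indicator B t * t)"
  proof (rule integrable_const_bound)
    show "AE t in diagonal_measure E x. norm (indicator B t * t) \<le> \<bar>a\<bar>"
      using t_bounded by eventually_elim (auto simp: indicator_def)
  qed (use assms in \<open>simp add: measurable_diagonal_measure\<close>)
  show "integrable (diagonal_measure E x) (\<lambda>t. indicator B t * c)"
    by (rule integrable_const_bound[of _ "\<bar>c\<bar>"])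
      (use assms in \<open>auto simp: indicator_def measurable_diagonal_measure\<close>)
qed

lemma diagonal_measure_proj:
  assumes B_borel: "B \<in> sets borel"
  shows "diagonal_measure E (E B x) = density (diagonal_measure E x) (\<lambda>t. ennreal (indicator B t))"
proof (rule measure_eqI)
  fix C assume "C \<in> sets (diagonal_measure E (E B x))"
  then have C_borel: "C \<in> sets borel" by (simp add: sets_diagonal_measure)
  have "inner (E C (E B x)) (E B x) = inner (E (B \<inter> C) x) x"
    using orth_proj_inner[OF projection_measure_orth_proj[OF B_borel], of "E C (E B x)" x]
      B_borel C_borel
    by (simp add: projection_measure_Int Int_ac)
  moreover have "(\<integral>\<^sup>+ t. ennreal (indicator B t) * indicator C t \<partial>diagonal_measure E x)
      = (\<integral>\<^sup>+ t. indicator (B \<inter> C) t \<partial>diagonal_measure E x)"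
    by (intro nn_integral_cong) (auto simp: indicator_def)
  moreover have "(\<lambda>t. ennreal (indicator B t)) \<in> borel_measurable (diagonal_measure E x)"
    using B_borel by (simp add: measurable_diagonal_measure)
  ultimately show "emeasure (diagonal_measure E (E B x)) C
      = emeasure (density (diagonal_measure E x) (\<lambda>t. ennreal (indicator B t))) C"
    using B_borel C_borel
    by (simp add: emeasure_density emeasure_diagonal_measure sets_diagonal_measure)
qed (simp add: sets_diagonal_measure)

end

locale spectral_family =
  fixes P :: "real \<Rightarrow> 'a::{real_inner, banach} \<Rightarrow> 'a" and a b :: real
  assumes orth_proj: "orth_proj (P l)"
    and nested: "l \<le> m \<Longrightarrow> P l (P m x) = P l x"
    and right_continuous: "decseq s \<Longrightarrow> s \<longlonglongrightarrow> l \<Longrightarrow> (\<lambda>n. P (s n) x) \<longlonglongrightarrow> P l x"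
    and lower: "P a x = 0"
    and upper: "P b x = x"
begin

definition distribution :: "'a \<Rightarrow> real \<Rightarrow> real" where
  "distribution x l = (norm (P l x))\<^sup>2"

lemma distribution_diff:
  assumes "l \<le> m"
  shows "distribution x m - distribution x l = (norm (P m x - P l x))\<^sup>2"
  using norm_diff_orth_proj[OF orth_proj, of "P m x" l]
  by (simp add: distribution_def nested[OF assms])

lemma distribution_mono: "l \<le> m \<Longrightarrow> distribution x l \<le> distribution x m"
  using distribution_diff[of l m x] zero_le_power2[of "norm (P m x - P l x)"] by linarith

lemma distribution_right_continuous: "continuous (at_right l) (distribution x)"
  unfolding continuous_within
proof (rule tendsto_at_right_sequentially[of l "l + 1"])
  fix s assume "decseq s" "s \<longlonglongrightarrow> l"
  then show "(\<lambda>n. distribution x (s n)) \<longlonglongrightarrow> distribution x l"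
    unfolding distribution_def by (intro tendsto_intros right_continuous)
qed simp

lemma below: "l \<le> a \<Longrightarrow> P l x = 0"
  using nested[of l a x] orth_proj_0[OF orth_proj] by (simp add: lower)

lemma above:
  assumes "b \<le> l"
  shows "P l x = x"
proof -
  have "distribution x b \<le> distribution x l" by (rule distribution_mono[OF assms])
  then show ?thesis
    by (simp add: orth_proj_fixed_iff[OF orth_proj] inner_orth_proj[OF orth_proj]
        distribution_def upper)
qed

definition vector_measure :: "'a \<Rightarrow> real measure" where
  "vector_measure x = interval_measure (distribution x)"

lemma sets_vector_measure [simp, measurable_cong]: "sets (vector_measure x) = sets borel"
  and space_vector_measure [simp]: "space (vector_measure x) = UNIV"
  by (simp_all add: vector_measure_def)

lemma emeasure_vector_measure_Ioc:
  "l \<le> m \<Longrightarrow> emeasure (vector_measure x) {l<..m} = ennreal (distribution x m - distribution x l)"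
  unfolding vector_measure_def
  by (rule emeasure_interval_measure_Ioc)
    (auto intro: distribution_mono distribution_right_continuous)

lemma emeasure_vector_measure_below: "emeasure (vector_measure x) {..a} = 0"
proof -
  have "emeasure (vector_measure x) (\<Union>n::nat. {a - real n<..a}) = 0"
    by (rule emeasure_UN_eq_0) (auto simp: emeasure_vector_measure_Ioc distribution_def below)
  moreover have "\<exists>n::nat. a - real n < t" for t
    using reals_Archimedean2[of "a - t"] by (auto simp: algebra_simps)
  then have "(\<Union>n::nat. {a - real n<..a}) = {..a}" by auto
  ultimately show ?thesis by simp
qed

lemma emeasure_vector_measure_above: "emeasure (vector_measure x) {b<..} = 0"
proof -
  have "emeasure (vector_measure x) (\<Union>n::nat. {b<..b + real n}) = 0"
    by (rule emeasure_UN_eq_0) (auto simp: emeasure_vector_measure_Ioc distribution_def above)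
  moreover have "\<exists>n::nat. t \<le> b + real n" for t
    using real_arch_simple[of "t - b"] by (auto simp: algebra_simps)
  then have "(\<Union>n::nat. {b<..b + real n}) = {b<..}" by auto
  ultimately show ?thesis by simp
qed

lemma AE_vector_measure: "AE t in vector_measure x. a < t \<and> t \<le> b"
proof -
  have "{..a} \<in> null_sets (vector_measure x)" "{b<..} \<in> null_sets (vector_measure x)"
    by (auto simp: null_sets_def emeasure_vector_measure_below emeasure_vector_measure_above)
  from AE_not_in[OF this(1)] AE_not_in[OF this(2)] show ?thesis by eventually_elim auto
qed

lemma emeasure_vector_measure_Iic: "emeasure (vector_measure x) {..l} = ennreal (distribution x l)"
proof -
  have "emeasure (vector_measure x) {..l} = emeasure (vector_measure x) {min a l<..l}"
    by (rule emeasure_eq_AE) (use AE_vector_measure[of x] in \<open>auto elim: eventually_mono\<close>)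
  then show ?thesis
    by (simp add: emeasure_vector_measure_Ioc) (simp add: distribution_def below)
qed

lemma emeasure_vector_measure_UNIV: "emeasure (vector_measure x) UNIV = ennreal ((norm x)\<^sup>2)"
proof -
  have "emeasure (vector_measure x) UNIV = emeasure (vector_measure x) {..b}"
    by (rule emeasure_eq_AE) (use AE_vector_measure[of x] in \<open>auto elim: eventually_mono\<close>)
  then show ?thesis by (simp add: emeasure_vector_measure_Iic distribution_def upper)
qed

sublocale vector_measure: finite_measure "vector_measure x" for x
  by (rule finite_measureI) (simp add: emeasure_vector_measure_UNIV)

lemma measure_vector_measure_UNIV: "measure (vector_measure x) UNIV = (norm x)\<^sup>2"
  by (simp add: measure_def emeasure_vector_measure_UNIV)

lemma measure_vector_measure_le: "measure (vector_measure x) B \<le> (norm x)\<^sup>2"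
  using vector_measure.bounded_measure[of x B] by (simp add: measure_vector_measure_UNIV)

definition represents :: "real set \<Rightarrow> ('a \<Rightarrow> 'a) \<Rightarrow> bool" where
  "represents B Q \<longleftrightarrow> orth_proj Q \<and> (\<forall>x. inner (Q x) x = measure (vector_measure x) B)"

lemma represents_orth_proj: "represents B Q \<Longrightarrow> orth_proj Q"
  and represents_inner: "represents B Q \<Longrightarrow> inner (Q x) x = measure (vector_measure x) B"
  by (simp_all add: represents_def)

lemma represents_unique: "represents B Q \<Longrightarrow> represents B R \<Longrightarrow> Q = R"
  by (rule self_adjoint_eqI) (auto simp: represents_def intro: orth_proj_self_adjoint)

lemma represents_atMost: "represents {..l} (P l)"
  by (simp add: represents_def orth_proj inner_orth_proj[OF orth_proj] distribution_def[symmetric]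
      measure_def emeasure_vector_measure_Iic) (simp add: distribution_def)

lemma represents_empty: "represents {} (\<lambda>x. 0)"
  by (simp add: represents_def orth_proj_zero)

lemma represents_Compl:
  assumes B_borel: "B \<in> sets borel" and Q: "represents B Q"
  shows "represents (- B) (\<lambda>x. x - Q x)"
proof -
  have "measure (vector_measure x) (- B) = (norm x)\<^sup>2 - measure (vector_measure x) B" for x
    using vector_measure.finite_measure_compl[of B x] B_borel
    by (simp add: measure_vector_measure_UNIV Compl_eq_Diff_UNIV)
  then show ?thesis
    using Q by (simp add: represents_def orth_proj_complement inner_diff_left dot_square_norm)
qed

lemma represents_disjoint:
  assumes Q: "represents B Q" and R: "represents C R"
    and "B \<in> sets borel" "C \<in> sets borel" "B \<inter> C = {}"
  shows "Q (R x) = 0"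
proof (rule orth_proj_orthogonal[OF represents_orth_proj[OF Q] represents_orth_proj[OF R]])
  show "inner (Q x) x + inner (R x) x \<le> (norm x)\<^sup>2" for x
    using vector_measure.finite_measure_Union[of B x C] measure_vector_measure_le[of x "B \<union> C"] assms
    by (simp add: represents_inner)
qed

lemma represents_Un:
  assumes Q: "represents B Q" and R: "represents C R"
    and disjoint: "B \<in> sets borel" "C \<in> sets borel" "B \<inter> C = {}"
  shows "represents (B \<union> C) (\<lambda>x. Q x + R x)"
proof -
  have "Q (R x) = 0" "R (Q x) = 0" for x
    using represents_disjoint[OF Q R] represents_disjoint[OF R Q] disjoint by auto
  then have "orth_proj (\<lambda>x. Q x + R x)"
    using represents_orth_proj[OF Q] represents_orth_proj[OF R]
    by (simp add: orth_proj_def self_adjoint_plus self_adjoint_add)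
  moreover have "inner (Q x + R x) x = measure (vector_measure x) (B \<union> C)" for x
    using vector_measure.finite_measure_Union[of B x C] disjoint
    by (simp add: inner_add_left represents_inner[OF Q] represents_inner[OF R])
  ultimately show ?thesis by (simp add: represents_def)
qed

lemma represents_UN:
  assumes B_disjoint: "range B \<subseteq> sets borel" "disjoint_family B" and Q: "\<And>i. represents (B i) (Q i)"
  obtains R where "represents (\<Union>i. B i) R" "\<And>x. (\<lambda>n. \<Sum>i<n. Q i x) \<longlonglongrightarrow> R x"
proof -
  have "Q i (Q j x) = 0" if "i \<noteq> j" for i j x
    using B_disjoint that by (intro represents_disjoint[OF Q Q]) (auto simp: disjoint_family_on_def)
  from ex_orth_proj_suminf[of Q, OF represents_orth_proj[OF Q] this]
  obtain R where R_orth_proj: "orth_proj R" and lim: "\<And>x. (\<lambda>n. \<Sum>i<n. Q i x) \<longlonglongrightarrow> R x"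
    by blast
  have "inner (R x) x = measure (vector_measure x) (\<Union>i. B i)" for x
  proof (rule LIMSEQ_unique)
    show "(\<lambda>n. inner (\<Sum>i<n. Q i x) x) \<longlonglongrightarrow> inner (R x) x" by (intro tendsto_intros lim)
    have "(\<lambda>i. measure (vector_measure x) (B i)) sums measure (vector_measure x) (\<Union>i. B i)"
      using B_disjoint by (intro vector_measure.finite_measure_UNION) auto
    then show "(\<lambda>n. inner (\<Sum>i<n. Q i x) x) \<longlonglongrightarrow> measure (vector_measure x) (\<Union>i. B i)"
      by (simp add: sums_def inner_sum_left represents_inner[OF Q])
  qed
  then have "represents (\<Union>i. B i) R" using R_orth_proj by (simp add: represents_def)
  then show ?thesis using lim by (rule that)
qed

lemma ex_represents:
  assumes "B \<in> sets borel"
  shows "\<exists>Q. represents B Q"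
  using assms
proof (induction rule: borel_induct_atMost)
  case (union B)
  from union(3) obtain Q where "\<And>i. represents (B i) (Q i)" by metis
  then show ?case using represents_UN[OF union(1,2)] by metis
qed (blast intro: represents_atMost represents_empty represents_Compl)+

definition spec_proj :: "real set \<Rightarrow> 'a \<Rightarrow> 'a" where
  "spec_proj B = (SOME Q. represents B Q)"

lemma represents_spec_proj: "B \<in> sets borel \<Longrightarrow> represents B (spec_proj B)"
  unfolding spec_proj_def using ex_represents by (rule someI_ex)

lemma spec_proj_eq: "B \<in> sets borel \<Longrightarrow> represents B Q \<Longrightarrow> spec_proj B = Q"
  using represents_spec_proj represents_unique by blast

lemma spec_proj_atMost: "spec_proj {..l} = P l"
  by (rule spec_proj_eq[OF _ represents_atMost]) simp

lemma spec_proj_fixed: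
  assumes "B \<in> sets borel" and full: "(norm x)\<^sup>2 \<le> measure (vector_measure x) B"
  shows "spec_proj B x = x"
  using represents_spec_proj[OF assms(1)] full by (simp add: represents_def orth_proj_fixed_iff)

lemma spec_proj_Int:
  assumes B_borel: "B \<in> sets borel" and C_borel: "C \<in> sets borel"
  shows "spec_proj B (spec_proj C x) = spec_proj (B \<inter> C) x"
proof -
  let ?x = "spec_proj (B \<inter> C) x"
  have Int_borel: "B \<inter> C \<in> sets borel" and Diff_borel: "C - B \<in> sets borel"
    using B_borel C_borel by auto
  have split: "B \<inter> C \<union> (C - B) = C" "B \<inter> C \<inter> (C - B) = {}" by auto
  note reps = represents_spec_proj[OF Int_borel] represents_spec_proj[OF Diff_borel]
  have "represents C (\<lambda>x. spec_proj (B \<inter> C) x + spec_proj (C - B) x)"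
    using represents_Un[OF reps Int_borel Diff_borel] by (simp add: split)
  then have "spec_proj C x = ?x + spec_proj (C - B) x" using spec_proj_eq[OF C_borel] by metis
  then have "spec_proj B (spec_proj C x) = spec_proj B ?x + spec_proj B (spec_proj (C - B) x)"
    using orth_proj_add[OF represents_orth_proj[OF represents_spec_proj[OF B_borel]]] by simp
  also have "spec_proj B (spec_proj (C - B) x) = 0"
    by (rule represents_disjoint[OF represents_spec_proj[OF B_borel] reps(2) B_borel Diff_borel]) auto
  also have "spec_proj B ?x = ?x"
  proof (rule spec_proj_fixed[OF B_borel])
    have "(norm ?x)\<^sup>2 = measure (vector_measure ?x) (B \<inter> C)"
      using represents_inner[OF reps(1), of ?x] represents_orth_proj[OF reps(1)]
      by (simp add: orth_proj_idem dot_square_norm)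
    also have "\<dots> \<le> measure (vector_measure ?x) B"
      using B_borel by (intro vector_measure.finite_measure_mono) auto
    finally show "(norm ?x)\<^sup>2 \<le> measure (vector_measure ?x) B" .
  qed
  finally show ?thesis by simp
qed

lemma spec_proj_UN:
  assumes B_disjoint: "range B \<subseteq> sets borel" "disjoint_family B"
  shows "(\<lambda>n. \<Sum>i<n. spec_proj (B i) x) \<longlonglongrightarrow> spec_proj (\<Union>i. B i) x"
proof -
  have B_borel: "B i \<in> sets borel" for i using B_disjoint(1) by auto
  obtain R where R: "represents (\<Union>i. B i) R" and lim: "\<And>x. (\<lambda>n. \<Sum>i<n. spec_proj (B i) x) \<longlonglongrightarrow> R x"
    using represents_UN[OF B_disjoint represents_spec_proj[OF B_borel]] by metis
  have "spec_proj (\<Union>i. B i) = R" by (rule spec_proj_eq[OF _ R]) (use B_borel in auto)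
  then show ?thesis using lim by simp
qed

lemma projection_measure_spec_proj: "projection_measure spec_proj"
  unfolding projection_measure_def
proof (intro conjI ballI allI impI)
  define c where "c = max (- a) (b + 1)"
  have "(norm x)\<^sup>2 \<le> measure (vector_measure x) {-c<..<c}" for x
  proof -
    have "measure (vector_measure x) UNIV = measure (vector_measure x) {-c<..<c}"
      by (rule vector_measure.finite_measure_eq_AE)
        (use AE_vector_measure[of x] in \<open>auto simp: c_def elim: eventually_mono\<close>)
    then show ?thesis by (simp add: measure_vector_measure_UNIV)
  qed
  then show "\<exists>c. \<forall>x. spec_proj {-c<..<c} x = x" by (intro exI allI spec_proj_fixed) simp_all
  show "spec_proj {} x = 0" for x using spec_proj_eq[OF _ represents_empty] by simp
qed (simp_all add: represents_orth_proj[OF represents_spec_proj] spec_proj_Int spec_proj_UN)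

lemma diagonal_measure_spec_proj: "diagonal_measure spec_proj x = vector_measure x"
  by (rule measure_eqI)
    (simp_all add: sets_diagonal_measure emeasure_diagonal_measure projection_measure_spec_proj
      represents_inner[OF represents_spec_proj] vector_measure.emeasure_eq_measure)

end

section \<open>The spectral theorem for positive operators\<close>

lemma eq_of_abs_diff_le_mult_increment:
  fixes h F :: "real \<Rightarrow> real"
  assumes incr: "\<And>a b. a \<le> b \<Longrightarrow> \<bar>h b - h a\<bar> \<le> (b - a) * (F b - F a)" and a_le_b: "a \<le> b"
  shows "h b = h a"
proof (rule ccontr)
  assume neq: "h b \<noteq> h a"
  obtain n :: nat where n_large: "(b - a) * (F b - F a) / \<bar>h b - h a\<bar> < real n"
    using reals_Archimedean2 by blast
  moreover have "0 \<le> (b - a) * (F b - F a)" using incr[OF a_le_b] by linarith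
  ultimately have n_pos: "0 < real n" by (smt (verit) divide_nonneg_nonneg abs_ge_zero)
  define t where "t i = a + real i * ((b - a) / n)" for i
  have t_ends: "t 0 = a" "t n = b" using n_pos by (auto simp: t_def)
  have t_Suc: "t (Suc i) - t i = (b - a) / n" for i
    by (simp add: t_def distrib_right add_divide_distrib)
  have "\<bar>h b - h a\<bar> = \<bar>\<Sum>i<n. h (t (Suc i)) - h (t i)\<bar>"
    using sum_lessThan_telescope[of "\<lambda>i. h (t i)" n] by (simp add: t_ends)
  also have "\<dots> \<le> (\<Sum>i<n. \<bar>h (t (Suc i)) - h (t i)\<bar>)" by (rule sum_abs)
  also have "\<dots> \<le> (\<Sum>i<n. (b - a) / n * (F (t (Suc i)) - F (t i)))"
  proof (rule sum_mono)
    fix i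
    have "0 \<le> (b - a) / n" using a_le_b by simp
    then have "t i \<le> t (Suc i)" using t_Suc[of i] by linarith
    from incr[OF this] show "\<bar>h (t (Suc i)) - h (t i)\<bar> \<le> (b - a) / n * (F (t (Suc i)) - F (t i))"
      by (simp only: t_Suc)
  qed
  also have "\<dots> = (b - a) / n * (F b - F a)"
    by (simp only: sum_distrib_left[symmetric] sum_lessThan_telescope[of "\<lambda>i. F (t i)" n] t_ends)
  finally have "\<bar>h b - h a\<bar> * n \<le> (b - a) * (F b - F a)" using n_pos by (simp add: field_simps)
  moreover have "(b - a) * (F b - F a) < \<bar>h b - h a\<bar> * n"
    using n_large neq by (simp add: field_simps)
  ultimately show False by linarith
qed

context spectral_family
begin

lemma integrable_vector_measure:
  fixes f :: "real \<Rightarrow> real"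
  assumes "f \<in> borel_measurable borel" and f_bound: "\<And>t. a < t \<Longrightarrow> t \<le> b \<Longrightarrow> \<bar>f t\<bar> \<le> K"
  shows "integrable (vector_measure x) f"
proof (rule vector_measure.integrable_const_bound)
  show "AE t in vector_measure x. norm (f t) \<le> K"
    using AE_vector_measure by eventually_elim (use f_bound in auto)
qed (use assms(1) in simp)

lemma integral_indicator_Iic_increment_bounds:
  fixes x :: 'a
  defines "I l \<equiv> \<integral>t. t * indicator {..l} t \<partial>vector_measure x"
  assumes "l \<le> m"
  shows "l * (distribution x m - distribution x l) \<le> I m - I l"
    and "I m - I l \<le> m * (distribution x m - distribution x l)"
proof -
  have integrable_part: "integrable (vector_measure x) (\<lambda>t. t * indicator B t)"
    if "B \<in> sets borel" for B
    by (rule integrable_vector_measure[of _ "max \<bar>a\<bar> \<bar>b\<bar>"]) (use that in \<open>auto simp: indicator_def\<close>)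
  have integrable_const: "integrable (vector_measure x) (\<lambda>t. c * indicator {l<..m} t)" for c :: real
    by (rule integrable_vector_measure[of _ "\<bar>c\<bar>"]) (auto simp: indicator_def)
  have "I m - I l = (\<integral>t. t * indicator {..m} t - t * indicator {..l} t \<partial>vector_measure x)"
    unfolding I_def
    by (rule Bochner_Integration.integral_diff[symmetric]) (auto intro: integrable_part)
  also have "\<dots> = (\<integral>t. t * indicator {l<..m} t \<partial>vector_measure x)"
    using \<open>l \<le> m\<close> by (intro Bochner_Integration.integral_cong) (auto simp: indicator_def)
  finally have diff: "I m - I l = (\<integral>t. t * indicator {l<..m} t \<partial>vector_measure x)" .
  have const: "(\<integral>t. c * indicator {l<..m} t \<partial>vector_measure x)
      = c * (distribution x m - distribution x l)" for c
    by (simp add: measure_def emeasure_vector_measure_Ioc[OF \<open>l \<le> m\<close>] distribution_mono[OF \<open>l \<le> m\<close>])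
  show "l * (distribution x m - distribution x l) \<le> I m - I l"
    unfolding diff const[symmetric]
    by (rule integral_mono[OF integrable_const integrable_part]) (auto simp: indicator_def)
  show "I m - I l \<le> m * (distribution x m - distribution x l)"
    unfolding diff const[symmetric]
    by (rule integral_mono[OF integrable_part integrable_const]) (auto simp: indicator_def)
qed

end

sublocale positive_operator \<subseteq> spectral: spectral_family low_proj "-1" "onorm A"
  by unfold_locales
    (simp_all add: orth_proj_low_proj low_proj_low_proj LIMSEQ_low_proj low_proj_neg low_proj_onorm)

context positive_operator
begin

lemma quadratic_form_low_proj_split:
  "inner (A x) x = inner (A (low_proj l x)) (low_proj l x)
    + inner (A (x - low_proj l x)) (x - low_proj l x)"
proof -
  have "inner (A (low_proj l x)) (x - low_proj l x) = 0"
    using inner_diff_low_proj[of "A (low_proj l x)" l x]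
      low_space_invariant[OF bounded_linear refl low_proj_mem] by (simp add: inner_commute)
  then show ?thesis by (simp add: op_diff op_inner inner_simps inner_commute)
qed

lemma quadratic_form_diff_low_proj_ge:
  "l * (norm (x - low_proj l x))\<^sup>2 \<le> inner (A (x - low_proj l x)) (x - low_proj l x)"
  by (rule quadratic_form_ge_of_low_space_orth) (rule inner_diff_low_proj)

lemma norm_low_proj_sq_ge:
  assumes "inner (A x) x \<le> l * (norm x)\<^sup>2"
  shows "(m - l) * (norm x)\<^sup>2 \<le> m * (norm (low_proj m x))\<^sup>2"
  using quadratic_form_low_proj_split[of x m] nonneg[of "low_proj m x"]
    quadratic_form_diff_low_proj_ge[of m x] assms
  by (simp add: norm_diff_orth_proj[OF orth_proj_low_proj] algebra_simps)

lemma quadratic_form_low_proj_increment_bounds: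
  fixes x :: 'a
  defines "q l \<equiv> inner (A (low_proj l x)) (low_proj l x)"
  assumes "l \<le> m"
  shows "l * (spectral.distribution x m - spectral.distribution x l) \<le> q m - q l"
    and "q m - q l \<le> m * (spectral.distribution x m - spectral.distribution x l)"
proof -
  define z where "z = low_proj m x - low_proj l x"
  have distribution: "spectral.distribution x m - spectral.distribution x l = (norm z)\<^sup>2"
    by (simp add: z_def spectral.distribution_diff[OF \<open>l \<le> m\<close>])
  have low_proj_l: "low_proj l (low_proj m x) = low_proj l x"
    by (rule low_proj_low_proj[OF \<open>l \<le> m\<close>])
  have q_diff: "q m - q l = inner (A z) z"
    using quadratic_form_low_proj_split[of "low_proj m x" l] by (simp add: low_proj_l q_def z_def)
  show "l * (spectral.distribution x m - spectral.distribution x l) \<le> q m - q l"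
    using quadratic_form_diff_low_proj_ge[of l "low_proj m x"]
    by (simp only: distribution q_diff) (simp add: low_proj_l z_def)
  have "z \<in> low_space m"
    unfolding z_def using subspace_low_space low_proj_mem low_space_mono[OF \<open>l \<le> m\<close>]
    by (blast intro: subspace_diff)
  then show "q m - q l \<le> m * (spectral.distribution x m - spectral.distribution x l)"
    unfolding distribution q_diff by (rule quadratic_form_le_of_low_space)
qed

lemma quadratic_form_eq_integral: "inner (A x) x = (\<integral>t. t \<partial>spectral.vector_measure x)"
proof -
  define I where "I l = (\<integral>t. t * indicator {..l} t \<partial>spectral.vector_measure x)" for l
  define h where "h l = inner (A (low_proj l x)) (low_proj l x) - I l" for l
  have "h (onorm A) = h (-1)"
  proof (rule eq_of_abs_diff_le_mult_increment[of h "spectral.distribution x"])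
    fix l m :: real assume "l \<le> m"
    from quadratic_form_low_proj_increment_bounds[OF this, of x]
      spectral.integral_indicator_Iic_increment_bounds[OF this, of x]
    show "\<bar>h m - h l\<bar> \<le> (m - l) * (spectral.distribution x m - spectral.distribution x l)"
      unfolding h_def I_def left_diff_distrib by linarith
  qed (use onorm_pos_le[OF bounded_linear] in simp)
  moreover have "I (onorm A) = (\<integral>t. t \<partial>spectral.vector_measure x)"
    unfolding I_def
    by (rule integral_cong_AE)
      (use spectral.AE_vector_measure[of x] in \<open>auto elim: eventually_mono\<close>)
  moreover have "I (-1) = (\<integral>t. 0 \<partial>spectral.vector_measure x)"
    unfolding I_def
    by (rule integral_cong_AE)
      (use spectral.AE_vector_measure[of x] in \<open>auto elim: eventually_mono\<close>)
  ultimately show ?thesis by (simp add: h_def low_proj_onorm low_proj_neg)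
qed

theorem resolves_spec_proj: "resolves A spectral.spec_proj"
  by (simp add: resolves_def spectral.projection_measure_spec_proj spectral.diagonal_measure_spec_proj
      quadratic_form_eq_integral)

lemma orth_proj_commute_of_split:
  assumes P: "orth_proj P"
    and split: "\<And>x. inner (A x) x = inner (A (P x)) (P x) + inner (A (x - P x)) (x - P x)"
  shows "P (A (P x)) = A (P x)"
proof -
  define y z where "y = P x" and "z = A y - P (A y)"
  have P_y: "P y = y" and P_z: "P z = 0"
    by (simp_all add: y_def z_def orth_proj_idem[OF P] orth_proj_diff[OF P])
  have "inner (A (y + z)) (y + z) = inner (A y) y + inner (A z) z"
    using split[of "y + z"] by (simp add: orth_proj_add[OF P] P_y P_z)
  moreover have "inner (A (y + z)) (y + z) = inner (A y) y + 2 * inner (A y) z + inner (A z) z"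
    using op_inner[of z y] by (simp add: op_add inner_simps inner_commute[of z "A y"])
  ultimately have "inner (A y) z = 0" by simp
  moreover have "inner (P (A y)) z = 0" using orth_proj_inner[OF P, of "A y" z] P_z by simp
  ultimately have "inner z z = 0" by (simp add: z_def inner_diff_left)
  then show ?thesis by (simp add: z_def y_def)
qed

context
  fixes E :: "real set \<Rightarrow> 'a \<Rightarrow> 'a"
  assumes E: "resolves A E"
begin

lemma resolves_projection_measure: "projection_measure E"
  using E by (simp add: resolves_def)

lemma resolves_quadratic_form:
  assumes B_borel: "B \<in> sets borel"
  shows "inner (A (E B x)) (E B x) = (\<integral>t. indicator B t * t \<partial>diagonal_measure E x)"
proof -
  have "inner (A (E B x)) (E B x) = (\<integral>t. t \<partial>diagonal_measure E (E B x))"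
    using E by (simp add: resolves_def)
  also have "\<dots> = (\<integral>t. indicator B t *\<^sub>R t \<partial>diagonal_measure E x)"
    unfolding diagonal_measure_proj[OF resolves_projection_measure B_borel]
    by (rule integral_density)
      (use B_borel in \<open>simp_all add: measurable_diagonal_measure[OF resolves_projection_measure]\<close>)
  finally show ?thesis by simp
qed

lemma resolves_quadratic_form_split:
  assumes B_borel: "B \<in> sets borel"
  shows "inner (A x) x = inner (A (E B x)) (E B x) + inner (A (x - E B x)) (x - E B x)"
proof -
  have "inner (A x) x = (\<integral>t. indicator B t * t + indicator (- B) t * t \<partial>diagonal_measure E x)"
    using E by (auto simp: resolves_def indicator_def intro!: Bochner_Integration.integral_cong)
  also have "\<dots> = (\<integral>t. indicator B t * t \<partial>diagonal_measure E x)
      + (\<integral>t. indicator (- B) t * t \<partial>diagonal_measure E x)"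
    using B_borel by (intro Bochner_Integration.integral_add integrable_diagonal_measure
        resolves_projection_measure) auto
  finally show ?thesis
    using B_borel by (simp add: resolves_quadratic_form[symmetric]
        projection_measure_Compl[OF resolves_projection_measure B_borel, symmetric])
qed

lemma resolves_range_invariant:
  assumes B_borel: "B \<in> sets borel" and x_fixed: "E B x = x"
  shows "E B (A x) = A x"
  using orth_proj_commute_of_split[OF
      projection_measure_orth_proj[OF resolves_projection_measure B_borel]
      resolves_quadratic_form_split[OF B_borel], of x]
  by (simp add: x_fixed)

lemma resolves_quadratic_form_le:
  assumes x_fixed: "E {..l} x = x"
  shows "inner (A x) x \<le> l * (norm x)\<^sup>2"
proof -
  note pm = resolves_projection_measure
  have "inner (A x) x = (\<integral>t. indicator {..l} t * t \<partial>diagonal_measure E x)"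
    using resolves_quadratic_form[of "{..l}" x] x_fixed by simp
  also have "\<dots> \<le> (\<integral>t. indicator {..l} t * l \<partial>diagonal_measure E x)"
    by (rule integral_mono[OF integrable_diagonal_measure[OF pm]]) (auto simp: indicator_def)
  also have "\<dots> = l * (norm x)\<^sup>2"
    using x_fixed
    by (simp add: measure_diagonal_measure[OF pm] space_diagonal_measure[OF pm] dot_square_norm)
  finally show ?thesis .
qed

lemma resolves_range_subset_low_space:
  assumes x_fixed: "E {..l} x = x"
  shows "x \<in> low_space l"
proof (cases "l < 0")
  case True
  have "0 \<le> l * (norm x)\<^sup>2" using resolves_quadratic_form_le[OF x_fixed] nonneg[of x] by linarith
  then show ?thesis using True by (auto simp: zero_le_mult_iff low_space_neg)
next
  case False
  have orbit_fixed: "E {..l} ((A ^^ n) x) = (A ^^ n) x" for n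
    by (induction n) (simp_all add: x_fixed resolves_range_invariant)
  have "norm (A ((A ^^ n) x)) \<le> l * norm ((A ^^ n) x)" for n
    using False orbit_fixed[of n] orbit_fixed[of "Suc n"]
    by (intro norm_le_of_quadratic_form_le resolves_quadratic_form_le) auto
  then show ?thesis by (simp add: low_space_def)
qed

lemma resolves_eq_0_of_quadratic_form_le:
  assumes x_fixed: "E {l<..} x = x" and form_le: "inner (A x) x \<le> l * (norm x)\<^sup>2"
  shows "x = 0"
proof -
  note pm = resolves_projection_measure
  let ?M = "diagonal_measure E x" and ?f = "\<lambda>t. indicator {l<..} t * t - indicator {l<..} t * l"
  have mass_eq: "measure ?M {l<..} = (norm x)\<^sup>2"
    by (simp add: measure_diagonal_measure[OF pm] x_fixed dot_square_norm)
  have integrable_f: "integrable ?M ?f"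
    by (intro Bochner_Integration.integrable_diff integrable_diagonal_measure[OF pm]) auto
  have nonneg: "0 \<le> ?f t" for t by (simp add: indicator_def)
  have "(\<integral>t. ?f t \<partial>?M) = (\<integral>t. indicator {l<..} t * t \<partial>?M) - (\<integral>t. indicator {l<..} t * l \<partial>?M)"
    by (rule Bochner_Integration.integral_diff[OF integrable_diagonal_measure[OF pm]]) simp_all
  also have "\<dots> = inner (A x) x - l * (norm x)\<^sup>2"
    using resolves_quadratic_form[of "{l<..}" x]
    by (simp add: x_fixed mass_eq space_diagonal_measure[OF pm])
  finally have "(\<integral>t. ?f t \<partial>?M) = 0"
    using form_le Bochner_Integration.integral_nonneg[of ?M ?f] nonneg by force
  then have "AE t in ?M. ?f t = 0"
    using integral_nonneg_eq_0_iff_AE[OF integrable_f] nonneg by simp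
  then have "AE t in ?M. t \<notin> {l<..}" by eventually_elim (auto simp: indicator_def split: if_splits)
  then have "measure ?M {l<..} = 0"
    by (subst (asm) AE_iff_measurable[OF _ refl])
      (auto simp: measure_def sets_diagonal_measure[OF pm] space_diagonal_measure[OF pm]
        greaterThan_def)
  then show ?thesis by (simp add: mass_eq)
qed

theorem resolves_atMost_unique: "E {..l} = low_proj l"
  unfolding low_proj_def
proof (rule orth_proj_eq_proj_onto[OF subspace_low_space closed_low_space])
  note pm = resolves_projection_measure
  have P: "orth_proj (E {..l})" by (rule projection_measure_orth_proj[OF pm]) simp
  then show "orth_proj (E {..l})" .
  show mem: "E {..l} x \<in> low_space l" for x
    by (rule resolves_range_subset_low_space) (rule orth_proj_idem[OF P])
  show "E {..l} x = x" if x_low: "x \<in> low_space l" for x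
  proof -
    have "- {..l} = {l<..}" by auto
    then have compl: "E {l<..} y = y - E {..l} y" for y
      using projection_measure_Compl[OF pm, of "{..l}" y] by simp
    have "x - E {..l} x = 0"
    proof (rule resolves_eq_0_of_quadratic_form_le)
      show "E {l<..} (x - E {..l} x) = x - E {..l} x"
        by (simp add: compl orth_proj_idem[OF P] orth_proj_diff[OF P])
      show "inner (A (x - E {..l} x)) (x - E {..l} x) \<le> l * (norm (x - E {..l} x))\<^sup>2"
        using subspace_diff[OF subspace_low_space x_low mem]
        by (rule quadratic_form_le_of_low_space)
    qed
    then show ?thesis by simp
  qed
qed

end

end

section \<open>Square-summable functions as a Hilbert space\<close>

definition square_summable :: "('i \<Rightarrow> complex) \<Rightarrow> bool" where
  "square_summable f \<longleftrightarrow> (\<lambda>i. (cmod (f i))\<^sup>2) summable_on UNIV"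

lemma square_summable_mono:
  assumes "square_summable g" "\<And>i. cmod (f i) \<le> cmod (g i)"
  shows "square_summable f"
  unfolding square_summable_def
  by (rule summable_on_comparison_test[OF assms(1)[unfolded square_summable_def]])
    (auto intro: assms(2) power_mono)

lemma square_summable_scale: "square_summable f \<Longrightarrow> square_summable (\<lambda>i. c * f i)"
  unfolding square_summable_def norm_mult power_mult_distrib by (rule summable_on_cmult_right)

lemma norm_add_sq_le: "(norm (a + b))\<^sup>2 \<le> 2 * (norm a)\<^sup>2 + 2 * (norm b)\<^sup>2"
  for a b :: "'a::real_inner"
proof -
  have "(norm (a + b))\<^sup>2 + (norm (a - b))\<^sup>2 = 2 * (norm a)\<^sup>2 + 2 * (norm b)\<^sup>2"
    unfolding power2_norm_eq_inner by (simp add: inner_simps inner_commute)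
  then show ?thesis using zero_le_power2[of "norm (a - b)"] by linarith
qed

lemma square_summable_add:
  assumes "square_summable f" "square_summable g"
  shows "square_summable (\<lambda>i. f i + g i)"
  unfolding square_summable_def
proof (rule summable_on_comparison_test)
  show "(\<lambda>i. 2 * (cmod (f i))\<^sup>2 + 2 * (cmod (g i))\<^sup>2) summable_on UNIV"
    using assms unfolding square_summable_def by (intro summable_on_add summable_on_cmult_right)
qed (auto intro: norm_add_sq_le)

lemma summable_on_bounded_by_product:
  fixes h :: "'i \<Rightarrow> 'b::banach" and f g :: "'i \<Rightarrow> 'c::real_normed_vector"
  assumes f_summable: "(\<lambda>i. (norm (f i))\<^sup>2) summable_on A"
    and g_summable: "(\<lambda>i. (norm (g i))\<^sup>2) summable_on A"
    and h_le: "\<And>i. i \<in> A \<Longrightarrow> norm (h i) \<le> norm (f i) * norm (g i)"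
  shows "h summable_on A"
proof (rule abs_summable_summable, rule summable_on_comparison_test)
  show "(\<lambda>i. (norm (f i))\<^sup>2 + (norm (g i))\<^sup>2) summable_on A" using f_summable g_summable
    by (rule summable_on_add)
  have "s * t \<le> s\<^sup>2 + t\<^sup>2" if "0 \<le> s" "0 \<le> t" for s t :: real
    using sum_squares_bound[of s t] mult_nonneg_nonneg[OF that] unfolding mult.assoc by linarith
  then show "norm (h i) \<le> (norm (f i))\<^sup>2 + (norm (g i))\<^sup>2" if "i \<in> A" for i
    using h_le[OF that] by (meson norm_ge_zero order_trans)
qed auto

typedef 'i l2 = "{f :: 'i \<Rightarrow> complex. square_summable f}"
  morphisms l2_fun l2_of
  by (intro exI[of _ "\<lambda>_. 0"]) (simp add: square_summable_def)

lemma square_summable_l2_fun: "square_summable (l2_fun x)"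
  using l2_fun[of x] by simp

lemma summable_l2_fun_sq: "(\<lambda>i. (cmod (l2_fun x i))\<^sup>2) summable_on UNIV"
  using square_summable_l2_fun[of x] by (simp add: square_summable_def)

lemma l2_fun_l2_of: "square_summable f \<Longrightarrow> l2_fun (l2_of f) = f"
  by (simp add: l2_of_inverse)

lemma l2_eqI: "(\<And>i. l2_fun x i = l2_fun y i) \<Longrightarrow> x = y"
  using l2_fun_inject by blast

instantiation l2 :: (type) real_vector
begin

definition "0 = l2_of (\<lambda>_. 0)"
definition "x + y = l2_of (\<lambda>i. l2_fun x i + l2_fun y i)"
definition "- x = l2_of (\<lambda>i. - l2_fun x i)"
definition "x - y = l2_of (\<lambda>i. l2_fun x i - l2_fun y i)" for x y :: "'a l2"
definition "r *\<^sub>R x = l2_of (\<lambda>i. of_real r * l2_fun x i)"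

lemma l2_fun_zero: "l2_fun 0 i = 0"
  by (simp add: zero_l2_def l2_fun_l2_of square_summable_def)

lemma l2_fun_add: "l2_fun (x + y) i = l2_fun x i + l2_fun y i"
  by (simp add: plus_l2_def l2_fun_l2_of square_summable_add square_summable_l2_fun)

lemma l2_fun_scaleR: "l2_fun (r *\<^sub>R x) i = of_real r * l2_fun x i"
  by (simp add: scaleR_l2_def l2_fun_l2_of square_summable_scale square_summable_l2_fun)

lemma l2_fun_uminus: "l2_fun (- x) i = - l2_fun x i"
  using square_summable_scale[OF square_summable_l2_fun[of x], of "-1"]
  by (simp add: uminus_l2_def l2_fun_l2_of)

lemma l2_fun_diff: "l2_fun (x - y) i = l2_fun x i - l2_fun y i"
  using square_summable_add[OF square_summable_l2_fun[of x]
      square_summable_scale[OF square_summable_l2_fun[of y], of "-1"]]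
  by (simp add: minus_l2_def l2_fun_l2_of)

instance
  by standard
    (rule l2_eqI;
      simp add: l2_fun_zero l2_fun_add l2_fun_scaleR l2_fun_uminus l2_fun_diff algebra_simps)+

end

instantiation l2 :: (type) real_inner
begin

definition "inner x y = (\<Sum>\<^sub>\<infinity>i. inner (l2_fun x i) (l2_fun y i))"
definition "norm x = sqrt (inner x x)" for x :: "'a l2"
definition "dist x y = norm (x - y)" for x y :: "'a l2"
definition "sgn x = x /\<^sub>R norm x" for x :: "'a l2"
definition [code del]: "uniformity = (INF e\<in>{0<..}. principal {(x :: 'a l2, y). dist x y < e})"
definition [code del]:
  "open (U :: 'a l2 set) \<longleftrightarrow> (\<forall>x\<in>U. eventually (\<lambda>(x', y). x' = x \<longrightarrow> y \<in> U) uniformity)"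

lemma summable_inner_l2_fun: "(\<lambda>i. inner (l2_fun x i) (l2_fun y i)) summable_on UNIV"
  by (rule summable_on_bounded_by_product[OF summable_l2_fun_sq[of x] summable_l2_fun_sq[of y]])
    (simp add: Cauchy_Schwarz_ineq2)

instance
proof
  fix x y z :: "'a l2" and r :: real
  show "inner x y = inner y x" by (simp add: inner_l2_def inner_commute)
  show "inner (x + y) z = inner x z + inner y z"
    unfolding inner_l2_def l2_fun_add inner_add_left by (intro infsum_add summable_inner_l2_fun)
  show "inner (r *\<^sub>R x) y = r * inner x y"
    unfolding inner_l2_def l2_fun_scaleR scaleR_conv_of_real[symmetric] inner_scaleR_left
    by (rule infsum_cmult_right')
  show "0 \<le> inner x x" unfolding inner_l2_def by (rule infsum_nonneg) simp
  show "inner x x = 0 \<longleftrightarrow> x = 0"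
  proof
    assume "inner x x = 0"
    then have "inner (l2_fun x i) (l2_fun x i) = 0" for i
      by (intro nonneg_infsum_le_0D[OF _ summable_inner_l2_fun]) (auto simp: inner_l2_def)
    then show "x = 0" by (intro l2_eqI) (simp add: l2_fun_zero)
  qed (simp add: inner_l2_def l2_fun_zero)
qed (simp_all add: dist_l2_def sgn_l2_def uniformity_l2_def open_l2_def norm_l2_def)

end

lemma norm_l2_sq: "(norm x)\<^sup>2 = (\<Sum>\<^sub>\<infinity>i. (cmod (l2_fun x i))\<^sup>2)"
  unfolding power2_norm_eq_inner inner_l2_def ..

lemma sum_l2_fun_sq_le: "finite F \<Longrightarrow> (\<Sum>i\<in>F. (cmod (l2_fun x i))\<^sup>2) \<le> (norm x)\<^sup>2"
  unfolding norm_l2_sq by (rule finite_sum_le_infsum) (simp_all add: summable_l2_fun_sq)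

lemma cmod_l2_fun_le: "cmod (l2_fun x i) \<le> norm x"
  by (rule power2_le_imp_le) (use sum_l2_fun_sq_le[of "{i}" x] in simp_all)

lemma bounded_linear_l2_fun: "bounded_linear (\<lambda>x. l2_fun x i)"
  by (rule bounded_linear_intro[where K=1])
    (auto simp: l2_fun_add l2_fun_scaleR scaleR_conv_of_real cmod_l2_fun_le)

lemma l2_Fatou:
  assumes lim: "\<And>i. (\<lambda>n. l2_fun (X n) i) \<longlonglongrightarrow> f i"
    and norm_le: "\<forall>\<^sub>F n in sequentially. norm (X n) \<le> c"
  obtains x where "l2_fun x = f" "norm x \<le> c"
proof -
  have sum_le: "(\<Sum>i\<in>F. (cmod (f i))\<^sup>2) \<le> c\<^sup>2" if F_finite: "finite F" for F
  proof (rule tendsto_upperbound)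
    show "(\<lambda>n. \<Sum>i\<in>F. (cmod (l2_fun (X n) i))\<^sup>2) \<longlonglongrightarrow> (\<Sum>i\<in>F. (cmod (f i))\<^sup>2)"
      by (intro tendsto_intros lim)
    show "\<forall>\<^sub>F n in sequentially. (\<Sum>i\<in>F. (cmod (l2_fun (X n) i))\<^sup>2) \<le> c\<^sup>2"
      using norm_le
      by eventually_elim (rule order_trans[OF sum_l2_fun_sq_le[OF F_finite] power_mono], auto)
  qed simp
  then have f_summable: "square_summable f"
    unfolding square_summable_def
    by (intro nonneg_bounded_partial_sums_imp_summable_on[of _ _ "c\<^sup>2"])
      (auto intro!: eventually_finite_subsets_at_top_weakI)
  have "0 \<le> c"
    using eventually_happens'[OF sequentially_bot norm_le] order_trans[OF norm_ge_zero] by blast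
  moreover have "(norm (l2_of f))\<^sup>2 \<le> c\<^sup>2"
    using f_summable sum_le unfolding norm_l2_sq l2_fun_l2_of[OF f_summable] square_summable_def
    by (intro infsum_le_finite_sums) auto
  ultimately show ?thesis using that l2_fun_l2_of[OF f_summable] power2_le_imp_le by blast
qed

instance l2 :: (type) banach
proof
  fix X :: "nat \<Rightarrow> 'a l2"
  assume X_Cauchy: "Cauchy X"
  have "convergent (\<lambda>n. l2_fun (X n) i)" for i
    using bounded_linear.Cauchy[OF bounded_linear_l2_fun X_Cauchy] by (rule Cauchy_convergent)
  then obtain f where f_lim: "\<And>i. (\<lambda>n. l2_fun (X n) i) \<longlonglongrightarrow> f i"
    unfolding convergent_def by metis
  obtain c where "\<And>n. norm (X n) \<le> c"
    using Bseq_eq_bounded Cauchy_Bseq[OF X_Cauchy] by (metis BseqE)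
  then obtain x where x_fun: "l2_fun x = f" using l2_Fatou[OF f_lim, of c] by auto
  have "X \<longlonglongrightarrow> x"
  proof (rule metric_LIMSEQ_I)
    fix e :: real assume e_pos: "0 < e"
    then obtain N where dist_small: "\<And>m n. N \<le> m \<Longrightarrow> N \<le> n \<Longrightarrow> dist (X m) (X n) < e / 2"
      using metric_CauchyD[OF X_Cauchy, of "e / 2"] by auto
    have "dist (X m) x < e" if m_ge: "N \<le> m" for m
    proof -
      have "\<forall>\<^sub>F n in sequentially. norm (X m - X n) \<le> e / 2"
        using eventually_ge_at_top[of N]
        by eventually_elim (use dist_small[OF m_ge] in \<open>simp add: dist_norm less_imp_le\<close>)
      moreover have "(\<lambda>n. l2_fun (X m - X n) i) \<longlonglongrightarrow> l2_fun (X m - x) i" for i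
        unfolding l2_fun_diff x_fun by (intro tendsto_intros f_lim)
      ultimately have "norm (X m - x) \<le> e / 2" using l2_Fatou l2_fun_inject by metis
      then show ?thesis using e_pos by (simp add: dist_norm)
    qed
    then show "\<exists>N. \<forall>n\<ge>N. dist (X n) x < e" by blast
  qed
  then show "convergent X" by (auto simp: convergent_def)
qed

section \<open>Operators on the square-summable functions of a countable group\<close>

lemma has_sum_cong_eq:
  assumes "(f has_sum a) A" "\<And>x. x \<in> A \<Longrightarrow> f x = g x"
  shows "(g has_sum a) A"
  using has_sum_cong[of A f g a] assms by blast

lemma inner_complex_eq_Re: "inner a b = Re (a * cnj b)"
  by (simp add: inner_complex_def)

locale countably_infinite_carrier =
  fixes G :: "('a, 'b) monoid_scheme" (structure)
  assumes countable_carrier: "countable (carrier G)"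
    and infinite_carrier: "infinite (carrier G)"
begin

text \<open>Square-summable functions on the carrier are identified with \<open>\<ell>\<^sup>2(\<nat>)\<close> by an enumeration, so that
  they form a type of class \<open>banach\<close>. This type is a real Hilbert space; complex linearity of an
  operator is expressed by commutation with \<open>cscale\<close>.\<close>

definition to_l2 :: "('a \<Rightarrow> complex) \<Rightarrow> nat l2" where
  "to_l2 f = l2_of (\<lambda>n. f (from_nat_into (carrier G) n))"

definition of_l2 :: "nat l2 \<Rightarrow> 'a \<Rightarrow> complex" where
  "of_l2 h x = (if x \<in> carrier G then l2_fun h (to_nat_on (carrier G) x) else 0)"

lemma bij_enum: "bij_betw (from_nat_into (carrier G)) UNIV (carrier G)"
  by (rule bij_betw_from_nat_into[OF countable_carrier infinite_carrier])

lemma enum_mem: "from_nat_into (carrier G) n \<in> carrier G"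
  using infinite_carrier by (intro from_nat_into) auto

lemma ell2_iff:
  "f \<in> ell2 G \<longleftrightarrow>
    (\<forall>x. x \<notin> carrier G \<longrightarrow> f x = 0) \<and> square_summable (\<lambda>n. f (from_nat_into (carrier G) n))"
  using summable_on_reindex_bij_betw[OF bij_enum, of "\<lambda>x. (cmod (f x))\<^sup>2"]
  by (auto simp: ell2_def square_summable_def)

lemma of_l2_enum: "of_l2 h (from_nat_into (carrier G) n) = l2_fun h n"
  by (simp add: of_l2_def enum_mem
      to_nat_on_from_nat_into_infinite[OF countable_carrier infinite_carrier])

lemma of_l2_outside: "x \<notin> carrier G \<Longrightarrow> of_l2 h x = 0"
  by (simp add: of_l2_def)

lemma of_l2_ell2: "of_l2 h \<in> ell2 G"
  by (simp add: ell2_iff of_l2_enum square_summable_l2_fun of_l2_outside)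

lemma to_l2_of_l2 [simp]: "to_l2 (of_l2 h) = h"
  unfolding to_l2_def of_l2_enum by (rule l2_fun_inverse)

lemma of_l2_to_l2: "f \<in> ell2 G \<Longrightarrow> of_l2 (to_l2 f) = f"
  by (auto simp: of_l2_def to_l2_def ell2_iff l2_fun_l2_of
      from_nat_into_to_nat_on[OF countable_carrier])

lemma of_l2_eqI: "(\<And>x. x \<in> carrier G \<Longrightarrow> of_l2 h x = of_l2 k x) \<Longrightarrow> h = k"
  by (metis ext of_l2_outside to_l2_of_l2)

lemma of_l2_eq_iff: "of_l2 h = of_l2 k \<longleftrightarrow> h = k"
  by (metis to_l2_of_l2)

lemma ball_ell2_iff: "(\<forall>f\<in>ell2 G. Q f) \<longleftrightarrow> (\<forall>h. Q (of_l2 h))"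
  by (metis of_l2_ell2 of_l2_to_l2)

lemma of_l2_simps [simp]:
  "of_l2 0 x = 0" "of_l2 (h + k) x = of_l2 h x + of_l2 k x" "of_l2 (h - k) x = of_l2 h x - of_l2 k x"
  "of_l2 (r *\<^sub>R h) x = of_real r * of_l2 h x" "of_l2 (- h) x = - of_l2 h x"
  by (simp_all add: of_l2_def l2_fun_zero l2_fun_add l2_fun_diff l2_fun_scaleR l2_fun_uminus)

lemma bounded_linear_of_l2: "bounded_linear (\<lambda>h. of_l2 h x)"
  by (cases "x \<in> carrier G") (simp_all add: of_l2_def bounded_linear_l2_fun bounded_linear_zero)

lemma of_l2_sum: "of_l2 (\<Sum>i\<in>I. h i) x = (\<Sum>i\<in>I. of_l2 (h i) x)"
  by (rule linear_sum[OF bounded_linear.linear[OF bounded_linear_of_l2]])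

lemma inner_of_l2: "inner h k = (\<Sum>\<^sub>\<infinity>x\<in>carrier G. inner (of_l2 h x) (of_l2 k x))"
  unfolding inner_l2_def
  by (subst infsum_reindex_bij_betw[OF bij_enum, symmetric]) (simp add: of_l2_enum)

lemma norm_sq_of_l2: "(norm h)\<^sup>2 = (\<Sum>\<^sub>\<infinity>x\<in>carrier G. (cmod (of_l2 h x))\<^sup>2)"
  unfolding power2_norm_eq_inner inner_of_l2 ..

lemma summable_of_l2_sq: "(\<lambda>x. (cmod (of_l2 h x))\<^sup>2) summable_on carrier G"
  using of_l2_ell2[of h] by (simp add: ell2_def)

lemma sum_of_l2_sq_le: "finite F \<Longrightarrow> F \<subseteq> carrier G \<Longrightarrow> (\<Sum>x\<in>F. (cmod (of_l2 h x))\<^sup>2) \<le> (norm h)\<^sup>2"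
  unfolding norm_sq_of_l2 by (rule finite_sum_le_infsum[OF summable_of_l2_sq]) auto

lemma ell2_norm_of_l2: "ell2_norm G (of_l2 h) = norm h"
  by (simp add: ell2_norm_def norm_sq_of_l2[symmetric])

lemma norm_le_of_l2:
  assumes "\<And>x. x \<in> carrier G \<Longrightarrow> cmod (of_l2 h x) \<le> cmod (of_l2 k x)"
  shows "norm h \<le> norm k"
proof (rule power2_le_imp_le)
  show "(norm h)\<^sup>2 \<le> (norm k)\<^sup>2"
    unfolding norm_sq_of_l2
    by (rule infsum_mono[OF summable_of_l2_sq summable_of_l2_sq]) (simp add: assms power_mono)
qed simp

lemma ell2_mono:
  assumes "g \<in> ell2 G" "\<And>x. cmod (f x) \<le> cmod (g x)"
  shows "f \<in> ell2 G"
proof -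
  have "f x = 0" if "x \<notin> carrier G" for x
    using assms(2)[of x] assms(1) that by (simp add: ell2_def)
  then show ?thesis
    using assms square_summable_mono[of "\<lambda>n. g (from_nat_into (carrier G) n)"]
    by (auto simp: ell2_iff)
qed

definition cscale :: "complex \<Rightarrow> nat l2 \<Rightarrow> nat l2" where
  "cscale c h = to_l2 (\<lambda>x. c * of_l2 h x)"

lemma of_l2_cscale [simp]: "of_l2 (cscale c h) x = c * of_l2 h x"
proof -
  have "(\<lambda>x. c * of_l2 h x) \<in> ell2 G"
    using of_l2_ell2[of h] square_summable_scale by (auto simp: ell2_iff)
  then show ?thesis by (simp add: cscale_def of_l2_to_l2)
qed

lemma cscale_of_real: "cscale (of_real r) h = r *\<^sub>R h"
  by (rule of_l2_eqI) simp

lemma norm_cscale: "norm (cscale c h) = cmod c * norm h"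
proof (rule power2_eq_imp_eq)
  show "(norm (cscale c h))\<^sup>2 = (cmod c * norm h)\<^sup>2"
    by (simp add: norm_sq_of_l2 power_mult_distrib norm_mult infsum_cmult_right')
qed simp_all

lemma bounded_linear_cscale: "bounded_linear (cscale c)"
  by (rule bounded_linear_intro[where K="cmod c"])
    (auto simp: norm_cscale algebra_simps intro: of_l2_eqI)

lemma inner_cscale: "inner (cscale c h) k = inner h (cscale (cnj c) k)"
  by (simp add: inner_of_l2 inner_complex_eq_Re mult_ac)

lemma ell2_inner_of_l2: "ell2_inner G (of_l2 h) (of_l2 k) = Complex (inner h k) (inner h (cscale \<i> k))"
proof -
  have "(\<lambda>x. of_l2 h x * cnj (of_l2 k x)) summable_on carrier G"
    by (rule summable_on_bounded_by_product[OF summable_of_l2_sq[of h] summable_of_l2_sq[of k]])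
      (simp add: norm_mult)
  then show ?thesis
    unfolding ell2_inner_def
    by (intro complex_eqI)
      (simp_all add: infsum_Re[symmetric] infsum_Im[symmetric] inner_of_l2 inner_complex_eq_Re
        algebra_simps)
qed

lemma Re_ell2_inner_of_l2: "Re (ell2_inner G (of_l2 h) (of_l2 k)) = inner h k"
  by (simp add: ell2_inner_of_l2)

definition permute :: "('a \<Rightarrow> 'a) \<Rightarrow> nat l2 \<Rightarrow> nat l2" where
  "permute \<pi> h = to_l2 (\<lambda>x. if x \<in> carrier G then of_l2 h (\<pi> x) else 0)"

context
  fixes \<pi> assumes bij: "bij_betw \<pi> (carrier G) (carrier G)"
begin

lemma of_l2_permute:
  assumes "x \<in> carrier G"
  shows "of_l2 (permute \<pi> h) x = of_l2 h (\<pi> x)"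
proof -
  have "(\<lambda>x. (cmod (of_l2 h (\<pi> x)))\<^sup>2) summable_on carrier G"
    using summable_on_reindex_bij_betw[OF bij, of "\<lambda>x. (cmod (of_l2 h x))\<^sup>2"] summable_of_l2_sq
    by simp
  then have "(\<lambda>x. if x \<in> carrier G then of_l2 h (\<pi> x) else 0) \<in> ell2 G"
    by (auto simp: ell2_def cong: summable_on_cong)
  then show ?thesis using assms by (simp add: permute_def of_l2_to_l2)
qed

lemma inner_permute: "inner (permute \<pi> h) (permute \<pi> k) = inner h k"
  unfolding inner_of_l2
  by (subst (2) infsum_reindex_bij_betw[OF bij, symmetric])
    (simp add: of_l2_permute cong: infsum_cong)

lemma norm_permute: "norm (permute \<pi> h) = norm h"
  by (simp add: norm_eq_sqrt_inner inner_permute)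

lemma bounded_linear_permute: "bounded_linear (permute \<pi>)"
  by (rule bounded_linear_intro[where K=1]; (rule of_l2_eqI)?; simp add: of_l2_permute norm_permute)

end

lemma inner_permute_inverse:
  assumes \<pi>: "bij_betw \<pi> (carrier G) (carrier G)" and \<rho>: "bij_betw \<rho> (carrier G) (carrier G)"
    and inverse: "\<And>x. x \<in> carrier G \<Longrightarrow> \<rho> (\<pi> x) = x"
  shows "inner (permute \<pi> h) k = inner h (permute \<rho> k)"
proof -
  have "permute \<pi> (permute \<rho> k) = k"
    using bij_betwE[OF \<pi>] by (intro of_l2_eqI) (simp add: of_l2_permute \<pi> \<rho> inverse)
  then show ?thesis using inner_permute[OF \<pi>, of h "permute \<rho> k"] by simp
qed

definition delta :: "'a \<Rightarrow> nat l2" where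
  "delta x = to_l2 (indicator {x})"

lemma of_l2_delta:
  assumes "x \<in> carrier G"
  shows "of_l2 (delta x) = indicator {x}"
proof -
  have "(\<lambda>z. (cmod (indicator {x} z))\<^sup>2) summable_on carrier G"
    by (rule finite_nonzero_values_imp_summable_on) (auto simp: indicator_def)
  then have "indicator {x} \<in> ell2 G"
    using assms by (auto simp: ell2_def indicator_eq_0_iff)
  then show ?thesis by (simp add: delta_def of_l2_to_l2)
qed

lemma norm_delta:
  assumes x_mem: "x \<in> carrier G"
  shows "norm (delta x) = 1"
proof (rule power2_eq_imp_eq)
  have "(norm (delta x))\<^sup>2 = (\<Sum>\<^sub>\<infinity>z\<in>carrier G. (cmod (indicator {x} z))\<^sup>2)"
    using x_mem by (simp add: norm_sq_of_l2 of_l2_delta)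
  also have "\<dots> = (\<Sum>\<^sub>\<infinity>z\<in>{x}. 1)"
    by (rule infsum_cong_neutral) (use x_mem in \<open>auto simp: indicator_def\<close>)
  finally show "(norm (delta x))\<^sup>2 = 1\<^sup>2" by simp
qed simp_all

definition support :: "nat l2 \<Rightarrow> 'a set" where
  "support h = {x. of_l2 h x \<noteq> 0}"

lemma support_empty_iff: "support h = {} \<longleftrightarrow> h = 0"
  using of_l2_eqI[of h 0] by (auto simp: support_def)

lemma delta_expansion:
  assumes \<Omega>: "finite \<Omega>" "\<Omega> \<subseteq> carrier G" and supp: "support h \<subseteq> \<Omega>"
  shows "h = (\<Sum>x\<in>\<Omega>. cscale (of_l2 h x) (delta x))"
proof (rule of_l2_eqI)
  fix z assume "z \<in> carrier G"
  have "of_l2 (\<Sum>x\<in>\<Omega>. cscale (of_l2 h x) (delta x)) z = (\<Sum>x\<in>\<Omega>. if x = z then of_l2 h x else 0)"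
    unfolding of_l2_sum using \<Omega> by (intro sum.cong) (auto simp: of_l2_delta indicator_def)
  then show "of_l2 h z = of_l2 (\<Sum>x\<in>\<Omega>. cscale (of_l2 h x) (delta x)) z"
    using \<Omega> supp by (auto simp: support_def)
qed

lemma of_l2_fun_simps:
  "(\<lambda>x. of_l2 h x + of_l2 k x) = of_l2 (h + k)"
  "(\<lambda>x. c * of_l2 h x) = of_l2 (cscale c h)"
  "(\<lambda>x. 0) = of_l2 0"
  "(\<lambda>x. of_l2 h x - (\<Sum>i\<in>I. of_l2 (d i) x)) = of_l2 (h - (\<Sum>i\<in>I. d i))"
  by (auto simp: of_l2_sum)

lemma orthogonal_projection_fnI:
  assumes P: "orth_proj P" and cscale: "\<And>c h. P (cscale c h) = cscale c (P h)"
  shows "orthogonal_projection G (\<lambda>f. of_l2 (P (to_l2 f)))"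
  unfolding orthogonal_projection_def bounded_operator_def ball_ell2_iff of_l2_fun_simps to_l2_of_l2
    ell2_norm_of_l2 of_l2_eq_iff ell2_inner_of_l2
  using norm_orth_proj_le[OF P]
  by (auto simp: of_l2_ell2 orth_proj_add[OF P] orth_proj_idem[OF P] orth_proj_inner[OF P] cscale
      intro: exI[of _ 1])

lemma
  assumes P: "orthogonal_projection G P"
  shows of_l2_to_l2_orthogonal_projection: "of_l2 (to_l2 (P (of_l2 h))) = P (of_l2 h)"
    and orth_proj_to_l2: "orth_proj (\<lambda>h. to_l2 (P (of_l2 h)))"
proof -
  define Q where "Q h = to_l2 (P (of_l2 h))" for h
  have of_l2_Q: "P (of_l2 h) = of_l2 (Q h)" for h
    using P of_l2_ell2[of h]
    by (simp add: Q_def of_l2_to_l2 orthogonal_projection_def bounded_operator_def)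
  note Q = P[unfolded orthogonal_projection_def bounded_operator_def ball_ell2_iff of_l2_fun_simps
      of_l2_Q of_l2_eq_iff ell2_norm_of_l2]
  obtain C where Q_bounded: "\<And>h. norm (Q h) \<le> C * norm h" using Q by blast
  have "bounded_linear Q"
  proof (rule bounded_linear_intro[where K=C])
    show "Q (h + k) = Q h + Q k" for h k using Q by blast
    show "Q (r *\<^sub>R h) = r *\<^sub>R Q h" for r h using Q cscale_of_real by metis
    show "norm (Q h) \<le> norm h * C" for h using Q_bounded by (simp add: mult.commute)
  qed
  moreover have "inner (Q h) k = inner h (Q k)" for h k
    using Q Re_ell2_inner_of_l2 by metis
  ultimately show "orth_proj (\<lambda>h. to_l2 (P (of_l2 h)))"
    using Q by (simp add: orth_proj_def self_adjoint_def Q_def[abs_def, symmetric])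
  show "of_l2 (to_l2 (P (of_l2 h))) = P (of_l2 h)" by (simp add: of_l2_Q)
qed

lemma projection_valued_measure_fnI:
  assumes E: "projection_measure E"
    and cscale: "\<And>B c h. B \<in> sets borel \<Longrightarrow> E B (cscale c h) = cscale c (E B h)"
  shows "projection_valued_measure G (\<lambda>B f. of_l2 (E B (to_l2 f)))"
  unfolding projection_valued_measure_def ball_ell2_iff to_l2_of_l2 of_l2_fun_simps of_l2_eq_iff
    ell2_norm_of_l2
proof (intro conjI ballI allI impI)
  show "orthogonal_projection G (\<lambda>f. of_l2 (E B (to_l2 f)))" if "B \<in> sets borel" for B
    using projection_measure_orth_proj[OF E that] cscale[OF that]
    by (rule orthogonal_projection_fnI)
  show "\<exists>a. \<forall>h. E {- a<..<a} h = h" using E unfolding projection_measure_def by blast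
  show "(\<lambda>n. norm (E (\<Union>i. B i) h - (\<Sum>i<n. E (B i) h))) \<longlonglongrightarrow> 0"
    if "range B \<subseteq> sets borel" "disjoint_family B" for B :: "nat \<Rightarrow> real set" and h
    using tendsto_norm[OF tendsto_diff[OF tendsto_const projection_measure_UN[OF E that, of h]],
        of "E (\<Union>i. B i) h"]
    by simp
qed (simp_all add: projection_measure_empty[OF E] projection_measure_Int[OF E])

context
  fixes E
  assumes E: "projection_valued_measure G E"
begin

lemma projection_valued_measure_orthogonal: "B \<in> sets borel \<Longrightarrow> orthogonal_projection G (E B)"
  using E unfolding projection_valued_measure_def by blast

lemmas of_l2_to_l2_projection_valued_measure =
  of_l2_to_l2_orthogonal_projection[OF projection_valued_measure_orthogonal]

lemma projection_measure_to_l2: "projection_measure (\<lambda>B h. to_l2 (E B (of_l2 h)))"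
  unfolding projection_measure_def
proof (intro conjI ballI allI impI)
  note pvm = E[unfolded projection_valued_measure_def ball_ell2_iff]
  show "orth_proj (\<lambda>h. to_l2 (E B (of_l2 h)))" if "B \<in> sets borel" for B
    by (rule orth_proj_to_l2[OF projection_valued_measure_orthogonal[OF that]])
  show "\<exists>a. \<forall>h. to_l2 (E {- a<..<a} (of_l2 h)) = h" "to_l2 (E {} (of_l2 h)) = 0" for h
    using pvm by (metis to_l2_of_l2, metis to_l2_of_l2 of_l2_fun_simps(3))
  show "to_l2 (E B (of_l2 (to_l2 (E C (of_l2 h))))) = to_l2 (E (B \<inter> C) (of_l2 h))"
    if "B \<in> sets borel" "C \<in> sets borel" for B C h
    using pvm that by (simp add: of_l2_to_l2_projection_valued_measure)
  show "(\<lambda>n. \<Sum>i<n. to_l2 (E (B i) (of_l2 h))) \<longlonglongrightarrow> to_l2 (E (\<Union>i. B i) (of_l2 h))"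
    if B_disjoint: "range B \<subseteq> sets borel" "disjoint_family B" for B :: "nat \<Rightarrow> real set" and h
  proof -
    have "B i \<in> sets borel" "(\<Union>i. B i) \<in> sets borel" for i using B_disjoint by auto
    note of_l2_to_l2 = this[THEN of_l2_to_l2_projection_valued_measure]
    have "(\<lambda>n. ell2_norm G (\<lambda>x. E (\<Union>i. B i) (of_l2 h) x - (\<Sum>i<n. E (B i) (of_l2 h) x))) \<longlonglongrightarrow> 0"
      using pvm B_disjoint by blast
    moreover have "ell2_norm G (\<lambda>x. E (\<Union>i. B i) (of_l2 h) x - (\<Sum>i<n. E (B i) (of_l2 h) x))
        = norm (to_l2 (E (\<Union>i. B i) (of_l2 h)) - (\<Sum>i<n. to_l2 (E (B i) (of_l2 h))))" for n
      by (simp only: ell2_norm_of_l2[symmetric] of_l2_fun_simps(4)[symmetric] of_l2_to_l2)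
    ultimately show ?thesis by (simp add: tendsto_iff dist_norm norm_minus_commute)
  qed
qed

lemma scalar_spectral_measure_eq_diagonal_measure:
  "scalar_spectral_measure G E (of_l2 h) = diagonal_measure (\<lambda>B h. to_l2 (E B (of_l2 h))) h"
  unfolding scalar_spectral_measure_def diagonal_measure_def
proof (rule measure_of_eq)
  fix B assume "B \<in> sigma_sets UNIV (sets (borel :: real measure))"
  then have "B \<in> sets borel" using sets.sigma_sets_eq[of "borel :: real measure"] by simp
  then show "ennreal (Re (ell2_inner G (E B (of_l2 h)) (of_l2 h)))
      = ennreal (inner (to_l2 (E B (of_l2 h))) h)"
    using Re_ell2_inner_of_l2[of "to_l2 (E B (of_l2 h))" h]
    by (simp add: of_l2_to_l2_projection_valued_measure)
qed simp

end

context
  fixes A :: "nat l2 \<Rightarrow> nat l2" and T :: "('a \<Rightarrow> complex) \<Rightarrow> 'a \<Rightarrow> complex"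
  assumes A: "positive_operator A" and cscale: "\<And>c h. cscale c (A h) = A (cscale c h)"
    and T: "\<And>h. T (of_l2 h) = of_l2 (A h)"
begin

interpretation positive_operator A by (rule A)

lemma resolves_to_l2:
  assumes E: "spectral_measure_for G T E"
  shows "resolves A (\<lambda>B h. to_l2 (E B (of_l2 h)))"
proof -
  have pvm: "projection_valued_measure G E" using E by (simp add: spectral_measure_for_def)
  have "inner (A h) h = (\<integral>t. t \<partial>diagonal_measure (\<lambda>B h. to_l2 (E B (of_l2 h))) h)" for h
  proof -
    have "ell2_inner G (of_l2 (A h)) (of_l2 h)
        = complex_of_real (\<integral>t. t \<partial>scalar_spectral_measure G E (of_l2 h))"
      using E of_l2_ell2 T unfolding spectral_measure_for_def by metis
    then show ?thesis
      using Re_ell2_inner_of_l2[of "A h" h]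
      by (simp add: scalar_spectral_measure_eq_diagonal_measure[OF pvm])
  qed
  then show ?thesis by (simp add: resolves_def projection_measure_to_l2[OF pvm])
qed

lemma spectral_measure_for_spec_proj:
  "spectral_measure_for G T (\<lambda>B f. of_l2 (spectral.spec_proj B (to_l2 f)))"
proof -
  let ?E = "\<lambda>B f. of_l2 (spectral.spec_proj B (to_l2 f))"
  have "low_proj l (cscale c h) = cscale c (low_proj l h)" for l c h
    by (rule low_proj_commute[OF bounded_linear_cscale cscale bounded_linear_cscale inner_cscale])
  then have "spectral.spec_proj B (cscale c h) = cscale c (spectral.spec_proj B h)"
    if "B \<in> sets borel" for B c h
    using projection_measure_commute[OF spectral.projection_measure_spec_proj
        bounded_linear_cscale _ that]
    by (simp add: spectral.spec_proj_atMost)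
  then have pvm: "projection_valued_measure G ?E"
    by (rule projection_valued_measure_fnI[OF spectral.projection_measure_spec_proj])
  have imaginary: "inner (A h) (cscale \<i> h) = 0" for h
  proof -
    have "inner (A h) (cscale \<i> h) = inner (cscale (cnj \<i>) h) (A h)"
      by (simp add: op_inner cscale[symmetric] inner_cscale)
    also have "cscale (cnj \<i>) h = - cscale \<i> h" by (rule of_l2_eqI) simp
    finally show ?thesis by (simp add: inner_commute)
  qed
  have "ell2_inner G (T (of_l2 h)) (of_l2 h)
      = complex_of_real (\<integral>t. t \<partial>scalar_spectral_measure G ?E (of_l2 h))" for h
    using resolves_spec_proj
    by (simp add: scalar_spectral_measure_eq_diagonal_measure[OF pvm] T ell2_inner_of_l2 imaginary
        resolves_def complex_eq_iff)
  with pvm show ?thesis by (simp add: spectral_measure_for_def ball_ell2_iff)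
qed

theorem spectral_projection_of_l2: "spectral_projection G T l (of_l2 h) = of_l2 (low_proj l h)"
proof -
  let ?E = "spectral_measure G T"
  have E: "spectral_measure_for G T ?E"
    unfolding spectral_measure_def
    by (rule someI[of "spectral_measure_for G T", OF spectral_measure_for_spec_proj])
  then have "projection_valued_measure G ?E" by (simp add: spectral_measure_for_def)
  then have "?E {..l} (of_l2 h) = of_l2 (to_l2 (?E {..l} (of_l2 h)))"
    by (simp add: of_l2_to_l2_projection_valued_measure)
  also have "to_l2 (?E {..l} (of_l2 h)) = low_proj l h"
    using fun_cong[OF resolves_atMost_unique[OF resolves_to_l2[OF E], of l], of h] .
  finally show ?thesis by (simp add: spectral_projection_def)
qed

end

end

section \<open>Symmetric random walks\<close>

lemma has_sum_pmf:
  assumes "set_pmf p \<subseteq> A"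
  shows "(pmf p has_sum 1) A"
proof -
  have "pmf p summable_on A"
    by (rule abs_summable_summable[OF abs_summable_equivalent[THEN iffD2, OF pmf_abs_summable]])
  moreover have "infsum (pmf p) A = 1"
    using infsetsum_pmf_eq_1[OF assms] infsetsum_infsum[OF pmf_abs_summable[of p A]] by simp
  ultimately show ?thesis using has_sum_infsum by metis
qed

lemma has_sum_minus:
  fixes f g :: "'b \<Rightarrow> 'c::topological_ab_group_add"
  assumes "(f has_sum a) A" "(g has_sum b) A"
  shows "((\<lambda>x. f x - g x) has_sum (a - b)) A"
  using has_sum_add[OF assms(1), of "\<lambda>x. - g x" "- b"] assms(2) by (simp add: has_sum_uminus)

lemma (in group) countable_generate:
  assumes S_carrier: "countable S" "S \<subseteq> carrier G"
  shows "countable (generate G S)"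
proof -
  let ?prod = "\<lambda>ws. foldr (\<lambda>x y. x \<otimes> y) ws \<one>" and ?W = "S \<union> m_inv G ` S"
  have W_carrier: "?W \<subseteq> carrier G" using S_carrier(2) by auto
  have closed: "?prod ws \<in> carrier G" if "set ws \<subseteq> carrier G" for ws
    using that by (induction ws) auto
  have append: "?prod (vs @ ws) = ?prod vs \<otimes> ?prod ws"
    if "set vs \<subseteq> carrier G" "set ws \<subseteq> carrier G" for vs ws
    using that by (induction vs) (auto simp: closed m_assoc)
  have "generate G S \<subseteq> ?prod ` lists ?W"
  proof
    fix x assume "x \<in> generate G S"
    then show "x \<in> ?prod ` lists ?W"
    proof induction
      case (eng x y)
      then obtain vs ws where "vs \<in> lists ?W" "ws \<in> lists ?W" "x = ?prod vs" "y = ?prod ws" by blast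
      moreover from this have "set vs \<subseteq> carrier G" "set ws \<subseteq> carrier G"
        using W_carrier by (auto simp: in_lists_conv_set)
      ultimately show ?case
        by (intro image_eqI[of _ _ "vs @ ws"]) (simp_all add: append del: foldr_append)
    next
      case (incl h)
      then show ?case using S_carrier(2) by (intro image_eqI[of _ _ "[h]"]) auto
    next
      case (inv h)
      then show ?case using S_carrier(2) by (intro image_eqI[of _ _ "[inv h]"]) auto
    qed (auto intro: image_eqI[of _ _ "[]"])
  qed
  moreover have "countable (?prod ` lists ?W)"
    using S_carrier(1) by (intro countable_image countable_lists) simp
  ultimately show ?thesis by (rule countable_subset)
qed

locale symmetric_walk = group G + countably_infinite_carrier G for G (structure) +
  fixes \<mu> :: "'a pmf"
  assumes supp: "set_pmf \<mu> \<subseteq> carrier G"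
    and symm: "x \<in> carrier G \<Longrightarrow> pmf \<mu> (inv x) = pmf \<mu> x"
begin

definition right_translate :: "'a \<Rightarrow> nat l2 \<Rightarrow> nat l2" where
  "right_translate y = permute (\<lambda>x. x \<otimes> inv y)"

definition left_translate :: "'a \<Rightarrow> nat l2 \<Rightarrow> nat l2" where
  "left_translate y = permute (\<lambda>x. inv y \<otimes> x)"

lemma bij_right_mult: "y \<in> carrier G \<Longrightarrow> bij_betw (\<lambda>x. x \<otimes> inv y) (carrier G) (carrier G)"
  by (rule bij_betw_byWitness[where f'="\<lambda>x. x \<otimes> y"]) (auto simp: m_assoc)

lemma bij_left_mult: "y \<in> carrier G \<Longrightarrow> bij_betw (\<lambda>x. inv y \<otimes> x) (carrier G) (carrier G)"
  by (rule bij_betw_byWitness[where f'="\<lambda>x. y \<otimes> x"]) (auto simp: m_assoc[symmetric])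

lemmas of_l2_right_translate = of_l2_permute[OF bij_right_mult, folded right_translate_def]
  and norm_right_translate = norm_permute[OF bij_right_mult, folded right_translate_def]
  and bounded_linear_right_translate =
    bounded_linear_permute[OF bij_right_mult, folded right_translate_def]
  and of_l2_left_translate = of_l2_permute[OF bij_left_mult, folded left_translate_def]
  and norm_left_translate = norm_permute[OF bij_left_mult, folded left_translate_def]
  and bounded_linear_left_translate =
    bounded_linear_permute[OF bij_left_mult, folded left_translate_def]

lemma inner_right_translate:
  assumes "y \<in> carrier G"
  shows "inner (right_translate y h) k = inner h (right_translate (inv y) k)"
  unfolding right_translate_def using assms
  by (intro inner_permute_inverse bij_right_mult) (simp_all add: m_assoc)

lemma inner_left_translate:
  assumes "y \<in> carrier G"
  shows "inner (left_translate y h) k = inner h (left_translate (inv y) k)"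
  unfolding left_translate_def using assms
  by (intro inner_permute_inverse bij_left_mult) (simp_all add: m_assoc[symmetric])

definition markov :: "nat l2 \<Rightarrow> nat l2" where
  "markov h = (\<Sum>\<^sub>\<infinity>y\<in>carrier G. pmf \<mu> y *\<^sub>R right_translate y h)"

definition laplacian :: "nat l2 \<Rightarrow> nat l2" where
  "laplacian h = h - markov h"

lemma has_sum_norm_markov:
  "((\<lambda>y. norm (pmf \<mu> y *\<^sub>R right_translate y h)) has_sum norm h) (carrier G)"
proof -
  have "((\<lambda>y. pmf \<mu> y * norm h) has_sum norm h) (carrier G)"
    using has_sum_cmult_left[OF has_sum_pmf[OF supp], of "norm h"] by simp
  then show ?thesis by (rule has_sum_cong_eq) (simp add: norm_right_translate)
qed

lemma has_sum_markov: "((\<lambda>y. pmf \<mu> y *\<^sub>R right_translate y h) has_sum markov h) (carrier G)"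
  unfolding markov_def
  by (rule has_sum_infsum[OF abs_summable_summable[OF has_sum_imp_summable[OF has_sum_norm_markov]]])

lemma has_sum_linear_markov:
  assumes "bounded_linear \<phi>"
  shows "((\<lambda>y. pmf \<mu> y *\<^sub>R \<phi> (right_translate y h)) has_sum \<phi> (markov h)) (carrier G)"
  using has_sum_bounded_linear[OF assms has_sum_markov[of h]]
  by (rule has_sum_cong_eq) (simp add: linear_scale[OF bounded_linear.linear[OF assms]])

lemma norm_markov_le: "norm (markov h) \<le> norm h"
  using norm_infsum_bound[OF has_sum_imp_summable[OF has_sum_norm_markov[of h]]]
    infsumI[OF has_sum_norm_markov]
  unfolding markov_def by simp

lemma markov_commute:
  assumes T: "bounded_linear T"
    and "\<And>y h. y \<in> carrier G \<Longrightarrow> T (right_translate y h) = right_translate y (T h)"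
  shows "T (markov h) = markov (T h)"
  using has_sum_linear_markov[OF T, of h]
  by (rule has_sum_unique[OF has_sum_cong_eq has_sum_markov]) (simp add: assms(2))

lemma bounded_linear_markov: "bounded_linear markov"
proof (rule bounded_linear_intro[where K=1])
  note linear = bounded_linear.linear[OF bounded_linear_right_translate]
  show "markov (h + k) = markov h + markov k" for h k
  proof (rule has_sum_unique[OF has_sum_markov])
    show "((\<lambda>y. pmf \<mu> y *\<^sub>R right_translate y (h + k)) has_sum markov h + markov k) (carrier G)"
      using has_sum_add[OF has_sum_markov[of h] has_sum_markov[of k]]
      by (rule has_sum_cong_eq) (simp add: scaleR_add_right linear_add[OF linear])
  qed
  show "markov (r *\<^sub>R h) = r *\<^sub>R markov h" for r h
    by (rule markov_commute[symmetric, OF bounded_linear_scaleR_right])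
      (simp add: linear_scale[OF linear])
qed (simp add: norm_markov_le)

lemma has_sum_inner_markov:
  "((\<lambda>y. pmf \<mu> y * inner (right_translate y h) k) has_sum inner (markov h) k) (carrier G)"
  using has_sum_linear_markov[OF bounded_linear_inner_left[of k], of h] by simp

lemma inner_markov_commute: "inner (markov h) k = inner h (markov k)"
proof (rule has_sum_unique[OF has_sum_inner_markov])
  have bij: "bij_betw (m_inv G) (carrier G) (carrier G)"
    by (rule bij_betw_byWitness[where f'="m_inv G"]) auto
  have "((\<lambda>y. pmf \<mu> (inv y) * inner (right_translate (inv y) k) h)
      has_sum inner h (markov k)) (carrier G)"
    unfolding has_sum_reindex_bij_betw[OF bij, of "\<lambda>y. pmf \<mu> y * inner (right_translate y k) h"]
      inner_commute[of h] by (rule has_sum_inner_markov)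
  then show "((\<lambda>y. pmf \<mu> y * inner (right_translate y h) k) has_sum inner h (markov k)) (carrier G)"
    by (rule has_sum_cong_eq) (metis symm inner_right_translate inner_commute)
qed

lemma self_adjoint_laplacian: "self_adjoint laplacian"
proof -
  have "self_adjoint markov"
    by (simp add: self_adjoint_def bounded_linear_markov inner_markov_commute)
  then show ?thesis
    unfolding laplacian_def[abs_def] by (intro self_adjoint_minus self_adjoint_ident)
qed

lemma has_sum_dirichlet_form:
  "((\<lambda>y. pmf \<mu> y * (norm (h - right_translate y h))\<^sup>2 / 2) has_sum inner (laplacian h) h) (carrier G)"
proof -
  have "((\<lambda>y. pmf \<mu> y * (norm h)\<^sup>2 - pmf \<mu> y * inner (right_translate y h) h)
      has_sum 1 * (norm h)\<^sup>2 - inner (markov h) h) (carrier G)"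
    by (intro has_sum_minus has_sum_cmult_left has_sum_pmf supp has_sum_inner_markov)
  then have "((\<lambda>y. pmf \<mu> y * (norm h)\<^sup>2 - pmf \<mu> y * inner (right_translate y h) h)
      has_sum inner (laplacian h) h) (carrier G)"
    by (simp add: laplacian_def inner_diff_left power2_norm_eq_inner)
  then show ?thesis
  proof (rule has_sum_cong_eq)
    fix y assume "y \<in> carrier G"
    then have "(norm h)\<^sup>2 - inner (right_translate y h) h = (norm (h - right_translate y h))\<^sup>2 / 2"
      using inner_permute[OF bij_right_mult, of y h h, folded right_translate_def]
      unfolding power2_norm_eq_inner by (simp add: inner_simps inner_commute)
    then show "pmf \<mu> y * (norm h)\<^sup>2 - pmf \<mu> y * inner (right_translate y h) h
        = pmf \<mu> y * (norm (h - right_translate y h))\<^sup>2 / 2"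
      by (simp add: right_diff_distrib[symmetric])
  qed
qed

sublocale laplacian: positive_operator laplacian
proof
  show "0 \<le> inner (laplacian h) h" for h
    by (rule has_sum_nonneg[OF has_sum_dirichlet_form]) simp
qed (rule self_adjoint_laplacian)

lemma dirichlet_form_contraction_le:
  assumes "\<And>x y. x \<in> carrier G \<Longrightarrow> y \<in> carrier G \<Longrightarrow>
    cmod (of_l2 g x - of_l2 g y) \<le> cmod (of_l2 h x - of_l2 h y)"
  shows "inner (laplacian g) g \<le> inner (laplacian h) h"
proof (rule has_sum_mono[OF has_sum_dirichlet_form has_sum_dirichlet_form])
  fix y assume "y \<in> carrier G"
  then have "norm (g - right_translate y g) \<le> norm (h - right_translate y h)"
    by (intro norm_le_of_l2) (simp add: of_l2_right_translate assms)
  then show "pmf \<mu> y * (norm (g - right_translate y g))\<^sup>2 / 2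
      \<le> pmf \<mu> y * (norm (h - right_translate y h))\<^sup>2 / 2"
    by (intro divide_right_mono mult_left_mono power_mono) auto
qed

lemma laplacian_commute:
  assumes T: "bounded_linear T"
    "\<And>y h. y \<in> carrier G \<Longrightarrow> T (right_translate y h) = right_translate y (T h)"
  shows "T (laplacian h) = laplacian (T h)"
  using markov_commute[OF T]
  by (simp add: laplacian_def linear_diff[OF bounded_linear.linear[OF T(1)]])

lemma cscale_laplacian: "cscale c (laplacian h) = laplacian (cscale c h)"
  by (rule laplacian_commute[OF bounded_linear_cscale])
    (auto intro!: of_l2_eqI simp: of_l2_right_translate)

lemma left_translate_laplacian:
  "y \<in> carrier G \<Longrightarrow> left_translate y (laplacian h) = laplacian (left_translate y h)"
  by (rule laplacian_commute[OF bounded_linear_left_translate])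
    (auto intro!: of_l2_eqI simp: of_l2_right_translate of_l2_left_translate m_assoc)

lemma laplace_operator_of_l2: "laplace_operator G \<mu> (of_l2 h) = of_l2 (laplacian h)"
proof
  fix x
  show "laplace_operator G \<mu> (of_l2 h) x = of_l2 (laplacian h) x"
  proof (cases "x \<in> carrier G")
    case True
    have "((\<lambda>y. of_l2 h (x \<otimes> inv y) * of_real (pmf \<mu> y)) has_sum of_l2 (markov h) x) (carrier G)"
      using has_sum_linear_markov[OF bounded_linear_of_l2, of h x]
      by (rule has_sum_cong_eq)
        (simp add: True of_l2_right_translate scaleR_conv_of_real mult.commute)
    then show ?thesis
      using True by (simp add: laplace_operator_def markov_operator_def laplacian_def infsumI)
  qed (simp add: laplace_operator_def markov_operator_def of_l2_outside)
qed

lemma low_proj_cscale: "laplacian.low_proj l (cscale c h) = cscale c (laplacian.low_proj l h)"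
  by (rule laplacian.low_proj_commute[OF bounded_linear_cscale cscale_laplacian
        bounded_linear_cscale inner_cscale])

lemma low_proj_left_translate:
  assumes "y \<in> carrier G"
  shows "laplacian.low_proj l (left_translate y h) = left_translate y (laplacian.low_proj l h)"
  by (rule laplacian.low_proj_commute[of _ "left_translate (inv y)"])
    (use assms in \<open>simp_all add: bounded_linear_left_translate left_translate_laplacian
      inner_left_translate\<close>)

lemma spectral_distribution_eq:
  "spectral_distribution G \<mu> l = (norm (laplacian.low_proj l (delta \<one>)))\<^sup>2"
proof -
  have "spectral_projection G (laplace_operator G \<mu>) l (of_l2 h) = of_l2 (laplacian.low_proj l h)" for h
    using laplacian.positive_operator_axioms cscale_laplacian laplace_operator_of_l2
    by (rule spectral_projection_of_l2)
  then show ?thesis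
    by (simp add: spectral_distribution_def group_trace_def of_l2_delta[symmetric] Re_ell2_inner_of_l2
        inner_orth_proj[OF laplacian.orth_proj_low_proj])
qed

lemma spectral_distribution_nonneg: "0 \<le> spectral_distribution G \<mu> l"
  by (simp add: spectral_distribution_eq)

lemma spectral_distribution_mono:
  "l \<le> m \<Longrightarrow> spectral_distribution G \<mu> l \<le> spectral_distribution G \<mu> m"
  unfolding spectral_distribution_eq laplacian.spectral.distribution_def[symmetric]
  by (rule laplacian.spectral.distribution_mono)

lemma norm_low_proj_delta:
  assumes x_mem: "x \<in> carrier G"
  shows "norm (laplacian.low_proj l (delta x)) = sqrt (spectral_distribution G \<mu> l)"
proof -
  have "delta x = left_translate x (delta \<one>)"
  proof (rule of_l2_eqI)
    fix z assume z_mem: "z \<in> carrier G"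
    then have "inv x \<otimes> z = \<one> \<longleftrightarrow> z = x"
      using x_mem by (metis inv_closed inv_inv inv_equality l_inv)
    then show "of_l2 (delta x) z = of_l2 (left_translate x (delta \<one>)) z"
      using x_mem z_mem by (simp add: of_l2_left_translate of_l2_delta indicator_def)
  qed
  then show ?thesis
    using x_mem by (simp add: low_proj_left_translate norm_left_translate spectral_distribution_eq)
qed

definition rayleigh :: "nat l2 \<Rightarrow> real" where
  "rayleigh h = inner (laplacian h) h / (norm h)\<^sup>2"

lemma rayleigh_nonneg: "0 \<le> rayleigh h"
  by (simp add: rayleigh_def laplacian.nonneg)

lemma lambda1_eq_Inf_rayleigh: "lambda1 G \<mu> \<Omega> = Inf {rayleigh h | h. h \<noteq> 0 \<and> support h \<subseteq> \<Omega>}"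
proof -
  have reindex: "{\<Phi> f | f. f \<in> ell2 G \<and> Q f} = {\<Phi> (of_l2 h) | h. Q (of_l2 h)}"
    for \<Phi> :: "('a \<Rightarrow> complex) \<Rightarrow> real" and Q
  proof safe
    show "\<exists>h. \<Phi> f = \<Phi> (of_l2 h) \<and> Q (of_l2 h)" if "f \<in> ell2 G" "Q f" for f
      using that by (intro exI[of _ "to_l2 f"]) (simp add: of_l2_to_l2)
  qed (use of_l2_ell2 in blast)
  show ?thesis
    by (simp only: lambda1_def reindex laplace_operator_of_l2 Re_ell2_inner_of_l2 ell2_norm_of_l2
        support_def[symmetric] support_empty_iff rayleigh_def)
qed

lemma ex_rayleigh:
  assumes "\<Omega> \<noteq> {}" "\<Omega> \<subseteq> carrier G"
  shows "{rayleigh h | h. h \<noteq> 0 \<and> support h \<subseteq> \<Omega>} \<noteq> {}"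
proof -
  obtain x where "x \<in> \<Omega>" using assms by blast
  then have "support (delta x) = {x}"
    using assms(2) by (auto simp: support_def of_l2_delta subset_iff indicator_eq_0_iff)
  then have "support (delta x) \<subseteq> \<Omega>" "delta x \<noteq> 0"
    using \<open>x \<in> \<Omega>\<close> support_empty_iff[of "delta x"] by auto
  then show ?thesis by blast
qed

lemma isoperimetric_profile_le_rayleigh:
  assumes \<Omega>: "finite \<Omega>" "\<Omega> \<subseteq> carrier G" "real (card \<Omega>) \<le> v" and h: "h \<noteq> 0" "support h \<subseteq> \<Omega>"
  shows "isoperimetric_profile G \<mu> v \<le> rayleigh h"
proof -
  have "0 \<le> lambda1 G \<mu> \<Omega>'" if "\<Omega>' \<subseteq> carrier G" "1 \<le> card \<Omega>'" for \<Omega>'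
    unfolding lambda1_eq_Inf_rayleigh using that
    by (intro cInf_greatest[OF ex_rayleigh]) (auto simp: rayleigh_nonneg)
  moreover have "\<Omega> \<noteq> {}" using h support_empty_iff by blast
  then have "1 \<le> card \<Omega>" using \<Omega>(1) by (simp add: Suc_le_eq card_gt_0_iff)
  ultimately have "isoperimetric_profile G \<mu> v \<le> lambda1 G \<mu> \<Omega>"
    unfolding isoperimetric_profile_def using \<Omega>
    by (intro cInf_lower) (auto intro!: bdd_belowI[of _ 0])
  also have "\<dots> \<le> rayleigh h"
    unfolding lambda1_eq_Inf_rayleigh using h
    by (intro cInf_lower) (auto intro!: bdd_belowI[of _ 0] simp: rayleigh_nonneg)
  finally show ?thesis .
qed

lemma isoperimetric_profile_lessD:
  assumes v_ge_1: "1 \<le> v" and profile_less: "isoperimetric_profile G \<mu> v < l"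
  obtains \<Omega> h where "finite \<Omega>" "\<Omega> \<subseteq> carrier G" "real (card \<Omega>) \<le> v" "h \<noteq> 0" "support h \<subseteq> \<Omega>"
    "rayleigh h < l"
proof -
  let ?S = "{lambda1 G \<mu> \<Omega> | \<Omega>. finite \<Omega> \<and> \<Omega> \<subseteq> carrier G \<and> 1 \<le> card \<Omega> \<and> real (card \<Omega>) \<le> v}"
  have "lambda1 G \<mu> {\<one>} \<in> ?S" using v_ge_1 by (auto intro!: exI[of _ "{\<one>}"])
  then have "?S \<noteq> {}" by blast
  from cInf_lessD[OF this profile_less[unfolded isoperimetric_profile_def]] obtain \<Omega> where
    \<Omega>: "finite \<Omega>" "\<Omega> \<subseteq> carrier G" "1 \<le> card \<Omega>" "real (card \<Omega>) \<le> v" "lambda1 G \<mu> \<Omega> < l"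
    by auto
  then have "\<Omega> \<noteq> {}" by auto
  from cInf_lessD[OF ex_rayleigh[OF this \<Omega>(2)] \<Omega>(5)[unfolded lambda1_eq_Inf_rayleigh]]
  obtain h where "h \<noteq> 0" "support h \<subseteq> \<Omega>" "rayleigh h < l"
    by auto
  then show ?thesis using that \<Omega> by blast
qed

lemma norm_low_proj_sq_le_card:
  assumes \<Omega>: "finite \<Omega>" "\<Omega> \<subseteq> carrier G" and supp: "support h \<subseteq> \<Omega>"
  shows "(norm (laplacian.low_proj l h))\<^sup>2 \<le> card \<Omega> * spectral_distribution G \<mu> l * (norm h)\<^sup>2"
proof -
  let ?P = "laplacian.low_proj l" and ?N = "spectral_distribution G \<mu> l"
    and ?f = "\<lambda>x. cmod (of_l2 h x)"
  have linear: "linear ?P"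
    using laplacian.orth_proj_low_proj by (intro bounded_linear.linear orth_proj_bounded_linear)
  have "?P h = (\<Sum>x\<in>\<Omega>. cscale (of_l2 h x) (?P (delta x)))"
    by (subst delta_expansion[OF \<Omega> supp]) (simp add: linear_sum[OF linear] low_proj_cscale)
  then have "norm (?P h) \<le> (\<Sum>x\<in>\<Omega>. norm (cscale (of_l2 h x) (?P (delta x))))"
    by (simp add: norm_sum)
  also have "\<dots> = (\<Sum>x\<in>\<Omega>. ?f x) * sqrt ?N"
    unfolding sum_distrib_right using \<Omega>
    by (intro sum.cong) (auto simp: norm_cscale norm_low_proj_delta)
  finally have "(norm (?P h))\<^sup>2 \<le> ((\<Sum>x\<in>\<Omega>. ?f x) * sqrt ?N)\<^sup>2"
    by (intro power_mono) auto
  also have "\<dots> = (\<Sum>x\<in>\<Omega>. ?f x)\<^sup>2 * ?N"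
    by (simp add: power_mult_distrib spectral_distribution_nonneg)
  also have "\<dots> \<le> ((\<Sum>x\<in>\<Omega>. (?f x)\<^sup>2) * card \<Omega>) * ?N"
    by (intro mult_right_mono sum_squared_le_sum_of_squares spectral_distribution_nonneg)
  also have "\<dots> \<le> ((norm h)\<^sup>2 * card \<Omega>) * ?N"
    using \<Omega> by (intro mult_right_mono spectral_distribution_nonneg sum_of_l2_sq_le) auto
  finally show ?thesis by (simp add: mult_ac)
qed

lemma spectral_distribution_ge_of_profile_less:
  assumes v_ge_1: "1 \<le> v" and l_pos: "0 < l" and profile_less: "isoperimetric_profile G \<mu> v < l"
  shows "1 / (2 * v) \<le> spectral_distribution G \<mu> (2 * l)"
proof -
  let ?N = "spectral_distribution G \<mu> (2 * l)"
  obtain \<Omega> h where \<Omega>: "finite \<Omega>" "\<Omega> \<subseteq> carrier G" "real (card \<Omega>) \<le> v"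
    and h: "h \<noteq> 0" "support h \<subseteq> \<Omega>" and rayleigh_less: "rayleigh h < l"
    using isoperimetric_profile_lessD[OF v_ge_1 profile_less] .
  have norm_pos: "0 < (norm h)\<^sup>2" using h(1) by simp
  then have "inner (laplacian h) h \<le> l * (norm h)\<^sup>2"
    using rayleigh_less by (simp add: rayleigh_def pos_divide_less_eq)
  from laplacian.norm_low_proj_sq_ge[OF this, of "2 * l"]
  have "l * (norm h)\<^sup>2 \<le> l * (2 * (norm (laplacian.low_proj (2 * l) h))\<^sup>2)"
    by (simp add: algebra_simps)
  then have "(norm h)\<^sup>2 \<le> 2 * (norm (laplacian.low_proj (2 * l) h))\<^sup>2"
    using l_pos by (simp only: mult_le_cancel_left_pos)
  also have "\<dots> \<le> 2 * (card \<Omega> * ?N * (norm h)\<^sup>2)"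
    using norm_low_proj_sq_le_card[OF \<Omega>(1,2) h(2)] by (intro mult_left_mono) auto
  also have "\<dots> \<le> 2 * (v * ?N * (norm h)\<^sup>2)"
    by (intro mult_left_mono mult_right_mono \<Omega>(3) spectral_distribution_nonneg) auto
  finally have "1 * (norm h)\<^sup>2 \<le> (2 * v * ?N) * (norm h)\<^sup>2" by (simp add: mult_ac)
  then have "1 \<le> 2 * v * ?N" using norm_pos by (simp only: mult_le_cancel_right_pos)
  then show ?thesis using v_ge_1 by (simp add: divide_le_eq mult.commute)
qed

end

section \<open>The lazy random walk\<close>

lemma ex_step_ratio_ge:
  fixes a :: "nat \<Rightarrow> real"
  assumes r_nonneg: "0 \<le> r" and T_pos: "0 < T" and total_ge: "r ^ T * a 0 \<le> a T"
  shows "\<exists>n<T. r * a n \<le> a (Suc n)"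
proof (rule ccontr)
  assume "\<not> ?thesis"
  then have step_less: "a (Suc n) < r * a n" if "n < T" for n using that by (auto simp: not_le)
  have decay: "a n \<le> r ^ n * a 0" if "n < T" for n
    using that
  proof (induction n)
    case (Suc n)
    then have "r * a n \<le> r * (r ^ n * a 0)" using r_nonneg by (intro mult_left_mono) auto
    then show ?case using step_less[of n] Suc.prems by (simp add: mult.assoc)
  qed simp
  obtain k where T_Suc: "T = Suc k" using T_pos gr0_implies_Suc by blast
  have "a T < r * a k" using step_less[of k] by (simp add: T_Suc)
  also have "\<dots> \<le> r * (r ^ k * a 0)" using decay[of k] r_nonneg
    by (intro mult_left_mono) (auto simp: T_Suc)
  finally show False using total_ge by (simp add: T_Suc mult.assoc)
qed

lemma ex_power_bounds:
  fixes l v :: real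
  assumes l_bounds: "0 < l" "l \<le> 1" and v_ge_1: "1 \<le> v"
  shows "\<exists>T>0. (1 - l / 2) ^ T \<le> 1 / v \<and> exp (- 4) / v ^ 4 \<le> (1 - l / 2) ^ (2 * T)"
proof -
  define q where "q = 1 - l / 2"
  have q_pos: "0 < q" using l_bounds by (simp add: q_def)
  define T where "T = Suc (nat \<lceil>2 * ln v / l\<rceil>)"
  have "0 \<le> 2 * ln v / l" using v_ge_1 l_bounds by simp
  then have "2 * ln v / l \<le> real T" "real T \<le> 2 * ln v / l + 2"
    unfolding T_def by linarith+
  then have T_bounds: "2 * ln v \<le> real T * l" "real T * l \<le> 2 * ln v + 2 * l"
    using l_bounds by (simp_all add: field_simps)
  have q_le: "q \<le> exp (- (l / 2))" using exp_ge_add_one_self[of "- (l / 2)"] by (simp add: q_def)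
  have ln_q: "- l \<le> ln q"
  proof -
    have "- (l / 2) - 2 * (l / 2)\<^sup>2 \<le> ln (1 - l / 2)"
      using l_bounds by (intro ln_one_minus_pos_lower_bound) auto
    moreover have "(l / 2)\<^sup>2 * 4 \<le> l" using l_bounds by (simp add: power2_eq_square mult_left_le)
    ultimately show ?thesis by (simp add: q_def)
  qed
  have "q ^ T \<le> exp (- (l / 2)) ^ T" using q_pos q_le by (intro power_mono) auto
  also have "\<dots> = exp (- (real T * l / 2))" by (simp add: exp_of_nat_mult[symmetric])
  also have "\<dots> \<le> exp (- ln v)" using T_bounds(1) by simp
  also have "\<dots> = 1 / v" using v_ge_1 by (simp add: exp_minus inverse_eq_divide)
  finally have upper: "q ^ T \<le> 1 / v" .
  have "exp (- 4) / v ^ 4 = exp (- 4 - real 4 * ln v)"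
    using v_ge_1 exp_of_nat_mult[of 4 "ln v"] by (simp add: exp_diff)
  also have "- 4 - real 4 * ln v \<le> real (2 * T) * (- l)" using T_bounds(2) l_bounds by simp
  also have "\<dots> \<le> real (2 * T) * ln q" using ln_q by (intro mult_left_mono) auto
  also have "exp \<dots> = q ^ (2 * T)" using q_pos exp_of_nat_mult[of "2 * T" "ln q"] by simp
  finally have "exp (- 4) / v ^ 4 \<le> q ^ (2 * T)" by simp
  then show ?thesis using upper unfolding q_def[symmetric] by (auto simp: T_def)
qed

context symmetric_walk
begin

definition lazy :: "nat l2 \<Rightarrow> nat l2" where
  "lazy h = h - (1/2) *\<^sub>R laplacian h"

lemma lazy_eq_markov: "lazy h = (1/2) *\<^sub>R h + (1/2) *\<^sub>R markov h"
proof -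
  have "h = (1/2) *\<^sub>R h + (1/2) *\<^sub>R h" by (simp flip: scaleR_left_distrib)
  then show ?thesis by (simp add: lazy_def laplacian_def algebra_simps)
qed

lemma norm_lazy_le: "norm (lazy h) \<le> norm h"
  using norm_triangle_ineq[of "(1/2) *\<^sub>R h" "(1/2) *\<^sub>R markov h"] norm_markov_le[of h]
  by (simp add: lazy_eq_markov)

lemma dirichlet_form_le_lazy_decrement: "inner (laplacian h) h / 2 \<le> (norm h)\<^sup>2 - (norm (lazy h))\<^sup>2"
proof -
  have "norm (laplacian h) \<le> 2 * norm h" for h
    using norm_triangle_ineq4[of h "markov h"] norm_markov_le[of h] by (simp add: laplacian_def)
  then have "(norm (laplacian h))\<^sup>2 \<le> 2 * inner (laplacian h) h"
    by (rule laplacian.norm_sq_le_quadratic_form)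
  moreover have "(norm (lazy h))\<^sup>2 = (norm h)\<^sup>2 - inner (laplacian h) h + (norm (laplacian h))\<^sup>2 / 4"
    unfolding lazy_def power2_norm_eq_inner by (simp add: inner_simps inner_commute)
  ultimately show ?thesis by linarith
qed

lemma norm_lazy_power_ge:
  assumes l_bounds: "0 \<le> l" "l \<le> 2"
  shows "(1 - l / 2) ^ n * norm (laplacian.low_proj l h) \<le> norm ((lazy ^^ n) h)"
proof -
  let ?P = "laplacian.low_proj l"
  note P = laplacian.orth_proj_low_proj[of l]
  have commute: "?P ((lazy ^^ n) h) = (lazy ^^ n) (?P h)" for n
    by (rule funpow_commute)
      (simp add: lazy_def orth_proj_diff[OF P] orth_proj_scaleR[OF P] laplacian.low_proj_op)
  have step: "(1 - l / 2) * norm k \<le> norm (lazy k)" if "k \<in> laplacian.low_space l" for k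
    using norm_triangle_ineq2[of k "(1/2) *\<^sub>R laplacian k"] laplacian.norm_le_of_low_space[OF that]
    by (simp add: lazy_def algebra_simps)
  have "(1 - l / 2) ^ n * norm (?P h) \<le> norm (?P ((lazy ^^ n) h))"
  proof (induction n)
    case (Suc n)
    then have "(1 - l / 2) ^ Suc n * norm (?P h) \<le> (1 - l / 2) * norm (?P ((lazy ^^ n) h))"
      using l_bounds by (simp add: mult.assoc mult_left_mono)
    also have "\<dots> \<le> norm (lazy (?P ((lazy ^^ n) h)))" by (rule step[OF laplacian.low_proj_mem])
    finally show ?case using commute[of n] commute[of "Suc n"] by simp
  qed simp
  also have "\<dots> \<le> norm ((lazy ^^ n) h)" by (rule norm_orth_proj_le[OF P])
  finally show ?thesis .
qed

definition subprobability :: "nat l2 \<Rightarrow> bool" where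
  "subprobability h \<longleftrightarrow>
     (\<forall>x\<in>carrier G. Im (of_l2 h x) = 0 \<and> 0 \<le> Re (of_l2 h x)) \<and>
     (\<forall>F. finite F \<longrightarrow> F \<subseteq> carrier G \<longrightarrow> (\<Sum>x\<in>F. Re (of_l2 h x)) \<le> 1)"

lemma
  assumes "subprobability h"
  shows subprobability_of_real: "of_l2 h x = of_real (Re (of_l2 h x))"
    and subprobability_nonneg: "0 \<le> Re (of_l2 h x)"
    and subprobability_sum_le: "finite F \<Longrightarrow> F \<subseteq> carrier G \<Longrightarrow> (\<Sum>x\<in>F. Re (of_l2 h x)) \<le> 1"
  using assms
  by (cases "x \<in> carrier G"; simp add: subprobability_def of_l2_outside complex_eq_iff)+

lemma subprobability_delta:
  assumes x_mem: "x \<in> carrier G"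
  shows "subprobability (delta x)"
proof -
  have "(\<Sum>z\<in>F. Re (indicator {x} z)) \<le> 1" if "finite F" for F
  proof -
    have "(\<Sum>z\<in>F. Re (indicator {x} z)) = (\<Sum>z\<in>F. if z = x then 1 else 0)"
      by (intro sum.cong) (auto simp: indicator_def)
    then show ?thesis using that by simp
  qed
  then show ?thesis using x_mem by (auto simp: subprobability_def of_l2_delta indicator_def)
qed

lemma subprobability_permute:
  assumes h: "subprobability h" and bij: "bij_betw \<pi> (carrier G) (carrier G)"
  shows "subprobability (permute \<pi> h)"
  unfolding subprobability_def
proof (intro conjI ballI allI impI)
  show "Im (of_l2 (permute \<pi> h) x) = 0" "0 \<le> Re (of_l2 (permute \<pi> h) x)" if "x \<in> carrier G" for x
    using h bij_betwE[OF bij] that by (auto simp: subprobability_def of_l2_permute[OF bij])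
  fix F assume F: "finite F" "F \<subseteq> carrier G"
  have inj: "inj_on \<pi> F" using bij F(2) by (auto simp: bij_betw_def intro: inj_on_subset)
  have "(\<Sum>x\<in>F. Re (of_l2 (permute \<pi> h) x)) = (\<Sum>z\<in>\<pi> ` F. Re (of_l2 h z))"
    unfolding sum.reindex[OF inj] using F by (intro sum.cong) (auto simp: of_l2_permute[OF bij])
  also have "\<dots> \<le> 1"
    using F bij_betwE[OF bij] by (intro subprobability_sum_le[OF h]) auto
  finally show "(\<Sum>x\<in>F. Re (of_l2 (permute \<pi> h) x)) \<le> 1" .
qed

lemma subprobability_has_sum:
  assumes combination: "((\<lambda>i. w i *\<^sub>R k i) has_sum h) I" and total_weight: "(w has_sum 1) I"
    and "\<And>i. i \<in> I \<Longrightarrow> 0 \<le> w i" and subprobability_k: "\<And>i. i \<in> I \<Longrightarrow> subprobability (k i)"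
  shows "subprobability h"
proof -
  have linear: "((\<lambda>i. w i * \<phi> (k i)) has_sum \<phi> h) I" if "bounded_linear \<phi>" for \<phi> :: "nat l2 \<Rightarrow> real"
    using has_sum_bounded_linear[OF that combination]
    by (rule has_sum_cong_eq) (simp add: linear_scale[OF bounded_linear.linear[OF that]])
  have bounded_linear_Re_at: "bounded_linear (\<lambda>h. Re (of_l2 h x))"
    and bounded_linear_Im_at: "bounded_linear (\<lambda>h. Im (of_l2 h x))" for x
    by (rule bounded_linear_compose[OF bounded_linear_Re bounded_linear_of_l2],
        rule bounded_linear_compose[OF bounded_linear_Im bounded_linear_of_l2])
  show ?thesis
    unfolding subprobability_def
  proof (intro conjI ballI allI impI)
    fix x assume x_mem: "x \<in> carrier G"
    have "((\<lambda>i. 0) has_sum Im (of_l2 h x)) I"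
      using linear[OF bounded_linear_Im_at]
      by (rule has_sum_cong_eq) (use subprobability_k x_mem in \<open>auto simp: subprobability_def\<close>)
    then show "Im (of_l2 h x) = 0" using has_sum_unique has_sum_0_simp by metis
    show "0 \<le> Re (of_l2 h x)"
      using linear[OF bounded_linear_Re_at]
      by (rule has_sum_nonneg) (simp add: assms(3) subprobability_nonneg[OF subprobability_k])
  next
    fix F assume F: "finite F" "F \<subseteq> carrier G"
    show "(\<Sum>x\<in>F. Re (of_l2 h x)) \<le> 1"
    proof (rule has_sum_mono[OF linear total_weight])
      show "bounded_linear (\<lambda>h. \<Sum>x\<in>F. Re (of_l2 h x))"
        by (intro bounded_linear_sum bounded_linear_Re_at)
      show "w i * (\<Sum>x\<in>F. Re (of_l2 (k i) x)) \<le> w i" if "i \<in> I" for i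
        using mult_left_mono[OF subprobability_sum_le[OF subprobability_k F] assms(3)] that by simp
    qed
  qed
qed

lemma subprobability_lazy:
  assumes h: "subprobability h"
  shows "subprobability (lazy h)"
proof -
  have "subprobability (right_translate y h)" if "y \<in> carrier G" for y
    unfolding right_translate_def by (rule subprobability_permute[OF h bij_right_mult[OF that]])
  then have markov: "subprobability (markov h)"
    by (intro subprobability_has_sum[OF has_sum_markov has_sum_pmf[OF supp]]) auto
  let ?k = "\<lambda>b. if b then h else markov h"
  have "((\<lambda>b. (1/2) *\<^sub>R ?k b) has_sum lazy h) UNIV"
    by (rule has_sum_finiteI) (simp_all add: UNIV_bool lazy_eq_markov add.commute)
  moreover have "((\<lambda>b. 1/2 :: real) has_sum 1) (UNIV :: bool set)"
    by (rule has_sum_finiteI) simp_all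
  ultimately show ?thesis
    by (rule subprobability_has_sum) (simp_all add: h markov)
qed

definition truncate :: "real \<Rightarrow> nat l2 \<Rightarrow> nat l2" where
  "truncate s h = to_l2 (\<lambda>x. of_real (max 0 (Re (of_l2 h x) - s)))"

lemma of_l2_truncate:
  assumes "0 \<le> s"
  shows "of_l2 (truncate s h) x = of_real (max 0 (Re (of_l2 h x) - s))"
proof -
  have "cmod (of_real (max 0 (Re (of_l2 h x) - s))) \<le> cmod (of_l2 h x)" for x
    unfolding norm_of_real using assms abs_Re_le_cmod[of "of_l2 h x"] by linarith
  then have "(\<lambda>x. complex_of_real (max 0 (Re (of_l2 h x) - s))) \<in> ell2 G"
    by (rule ell2_mono[OF of_l2_ell2])
  then show ?thesis by (simp add: truncate_def of_l2_to_l2)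
qed

lemma support_truncate:
  assumes "0 \<le> s"
  shows "support (truncate s h) \<subseteq> {x \<in> carrier G. s < Re (of_l2 h x)}"
proof
  fix x assume "x \<in> support (truncate s h)"
  then have "s < Re (of_l2 h x)"
    by (simp add: support_def of_l2_truncate[OF assms] max_def split: if_splits)
  then show "x \<in> {x \<in> carrier G. s < Re (of_l2 h x)}"
    using assms of_l2_outside[of x h] by (cases "x \<in> carrier G") auto
qed

lemma
  assumes h: "subprobability h" and s_pos: "0 < s"
  shows finite_superlevel: "finite {x \<in> carrier G. s < Re (of_l2 h x)}"
    and card_superlevel_le: "real (card {x \<in> carrier G. s < Re (of_l2 h x)}) \<le> 1 / s"
proof -
  let ?\<Omega> = "{x \<in> carrier G. s < Re (of_l2 h x)}"
  have card_le: "real (card F) \<le> 1 / s" if F: "F \<subseteq> ?\<Omega>" "finite F" for F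
  proof -
    have "real (card F) * s = (\<Sum>x\<in>F. s)" by simp
    also have "\<dots> \<le> (\<Sum>x\<in>F. Re (of_l2 h x))" using F by (intro sum_mono) auto
    also have "\<dots> \<le> 1" using F by (intro subprobability_sum_le[OF h]) auto
    finally show ?thesis using s_pos by (simp add: le_divide_eq)
  qed
  then have "card F \<le> nat \<lfloor>1 / s\<rfloor>" if "F \<subseteq> ?\<Omega>" "finite F" for F
    using that by (simp add: le_nat_floor)
  then show "finite ?\<Omega>" using finite_if_finite_subsets_card_bdd[of ?\<Omega>] by blast
  then show "real (card ?\<Omega>) \<le> 1 / s" using card_le by blast
qed

lemma norm_truncate_ge:
  assumes h: "subprobability h" and s_nonneg: "0 \<le> s"
  shows "(norm h)\<^sup>2 \<le> (norm (truncate s h))\<^sup>2 + 2 * s"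
  unfolding norm_sq_of_l2[of h]
proof (rule infsum_le_finite_sums[OF summable_of_l2_sq])
  fix F assume F: "finite F" "F \<subseteq> carrier G"
  let ?a = "\<lambda>x. Re (of_l2 h x)" and ?g = "of_l2 (truncate s h)"
  have "(cmod (of_l2 h x))\<^sup>2 \<le> (cmod (?g x))\<^sup>2 + 2 * s * ?a x" for x
  proof -
    have "(?a x)\<^sup>2 \<le> (max 0 (?a x - s))\<^sup>2 + 2 * s * ?a x"
    proof (cases "?a x \<le> s")
      case True
      then have "(?a x)\<^sup>2 \<le> s * ?a x"
        using subprobability_nonneg[OF h] by (simp add: power2_eq_square mult_right_mono)
      moreover have "0 \<le> s * ?a x" using s_nonneg subprobability_nonneg[OF h] by simp
      ultimately show ?thesis using True by (simp add: max_absorb1 mult.assoc)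
    qed (simp add: max_def power2_diff)
    moreover have "(cmod (of_l2 h x))\<^sup>2 = (?a x)\<^sup>2"
      by (subst subprobability_of_real[OF h]) simp
    ultimately show ?thesis by (simp add: of_l2_truncate[OF s_nonneg])
  qed
  then have "(\<Sum>x\<in>F. (cmod (of_l2 h x))\<^sup>2) \<le> (\<Sum>x\<in>F. (cmod (?g x))\<^sup>2 + 2 * s * ?a x)"
    by (rule sum_mono)
  also have "\<dots> = (\<Sum>x\<in>F. (cmod (?g x))\<^sup>2) + 2 * s * (\<Sum>x\<in>F. ?a x)"
    by (simp add: sum.distrib sum_distrib_left)
  also have "\<dots> \<le> (norm (truncate s h))\<^sup>2 + 2 * s * 1"
    using F s_nonneg
    by (intro add_mono sum_of_l2_sq_le mult_left_mono subprobability_sum_le[OF h]) auto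
  finally show "(\<Sum>x\<in>F. (cmod (of_l2 h x))\<^sup>2) \<le> (norm (truncate s h))\<^sup>2 + 2 * s" by simp
qed

lemma dirichlet_form_truncate_le:
  assumes "0 \<le> s"
  shows "inner (laplacian (truncate s h)) (truncate s h) \<le> inner (laplacian h) h"
proof (rule dirichlet_form_contraction_le)
  fix x y
  have "\<bar>max 0 (Re (of_l2 h x) - s) - max 0 (Re (of_l2 h y) - s)\<bar> \<le> \<bar>Re (of_l2 h x - of_l2 h y)\<bar>"
    by (auto simp: max_def)
  also have "\<dots> \<le> cmod (of_l2 h x - of_l2 h y)" by (rule abs_Re_le_cmod)
  finally show "cmod (of_l2 (truncate s h) x - of_l2 (truncate s h) y) \<le> cmod (of_l2 h x - of_l2 h y)"
    by (simp only: of_l2_truncate[OF assms] of_real_diff[symmetric] norm_of_real)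
qed

text \<open>A Nash inequality: truncating \<open>h\<close> from below at a quarter of its squared norm keeps half of that
  norm, does not increase the energy, and leaves a support controlled by the \<open>\<ell>\<^sup>1\<close>-norm.\<close>

lemma isoperimetric_profile_le_subprobability:
  assumes h: "subprobability h" "h \<noteq> 0" and v_ge: "4 / (norm h)\<^sup>2 \<le> v"
  shows "isoperimetric_profile G \<mu> v \<le> 2 * rayleigh h"
proof -
  define s where "s = (norm h)\<^sup>2 / 4"
  have s_pos: "0 < s" using h(2) by (simp add: s_def)
  let ?g = "truncate s h" and ?\<Omega> = "{x \<in> carrier G. s < Re (of_l2 h x)}"
  have norm_half: "(norm h)\<^sup>2 / 2 \<le> (norm ?g)\<^sup>2"
    using norm_truncate_ge[OF h(1), of s] s_pos by (simp add: s_def)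
  have "isoperimetric_profile G \<mu> v \<le> rayleigh ?g"
  proof (rule isoperimetric_profile_le_rayleigh)
    show "finite ?\<Omega>" by (rule finite_superlevel[OF h(1) s_pos])
    have "real (card ?\<Omega>) \<le> 1 / s" by (rule card_superlevel_le[OF h(1) s_pos])
    also have "\<dots> \<le> v" using v_ge by (simp add: s_def)
    finally show "real (card ?\<Omega>) \<le> v" .
    show "?g \<noteq> 0" using norm_half h(2) by auto
    show "support ?g \<subseteq> ?\<Omega>" by (rule support_truncate) (use s_pos in simp)
  qed auto
  also have "\<dots> \<le> inner (laplacian h) h / ((norm h)\<^sup>2 / 2)"
    unfolding rayleigh_def
    using norm_half h(2) s_pos by (intro frac_le dirichlet_form_truncate_le laplacian.nonneg) auto
  finally show ?thesis by (simp add: rayleigh_def mult.commute)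
qed

lemma rayleigh_le_of_lazy_ratio_ge:
  assumes h_nonzero: "h \<noteq> 0" and ratio: "r * (norm h)\<^sup>2 \<le> (norm (lazy h))\<^sup>2"
  shows "rayleigh h \<le> 2 * (1 - r)"
proof -
  have "inner (laplacian h) h \<le> 2 * ((norm h)\<^sup>2 - (norm (lazy h))\<^sup>2)"
    using dirichlet_form_le_lazy_decrement[of h] by simp
  also have "\<dots> \<le> 2 * (1 - r) * (norm h)\<^sup>2" using ratio by (simp add: algebra_simps)
  finally have "inner (laplacian h) h \<le> 2 * (1 - r) * (norm h)\<^sup>2" .
  moreover have "0 < (norm h)\<^sup>2" using h_nonzero by simp
  ultimately show ?thesis by (simp only: rayleigh_def pos_divide_le_eq)
qed

lemma norm_lazy_power_delta_ge:
  assumes l_bounds: "0 \<le> l" "l \<le> 2" and N_ge: "1 / v \<le> spectral_distribution G \<mu> l"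
  shows "(1 - l / 2) ^ (2 * n) / v \<le> (norm ((lazy ^^ n) (delta \<one>)))\<^sup>2"
proof -
  have "(1 - l / 2) ^ (2 * n) / v \<le> (1 - l / 2) ^ (2 * n) * spectral_distribution G \<mu> l"
    using mult_left_mono[OF N_ge, of "(1 - l / 2) ^ (2 * n)"] l_bounds by simp
  also have "\<dots> = ((1 - l / 2) ^ n * norm (laplacian.low_proj l (delta \<one>)))\<^sup>2"
    by (simp add: power_mult_distrib spectral_distribution_eq power_even_eq)
  also have "\<dots> \<le> (norm ((lazy ^^ n) (delta \<one>)))\<^sup>2"
    using norm_lazy_power_ge[OF l_bounds, of n] l_bounds by (intro power_mono) auto
  finally show ?thesis .
qed

text \<open>Running the walk for time \<open>ln v / l\<close> instead of \<open>1 / l\<close> avoids a logarithmic loss in the energy.\<close>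

lemma ex_lazy_power_small_rayleigh:
  assumes l_bounds: "0 < l" "l \<le> 1" and v_ge_1: "1 \<le> v"
    and N_ge: "1 / v \<le> spectral_distribution G \<mu> l"
  obtains n where "exp (- 4) / v ^ 5 \<le> (norm ((lazy ^^ n) (delta \<one>)))\<^sup>2"
    "rayleigh ((lazy ^^ n) (delta \<one>)) \<le> 3 * l"
proof -
  define a where "a n = (norm ((lazy ^^ n) (delta \<one>)))\<^sup>2" for n
  define q where "q = 1 - l / 2"
  have q_pos: "0 < q" using l_bounds by (simp add: q_def)
  have a_0: "a 0 = 1" by (simp add: a_def norm_delta)
  have a_Suc: "a (Suc n) \<le> a n" for n by (simp add: a_def norm_lazy_le)
  have a_ge: "q ^ (2 * n) / v \<le> a n" for n
    unfolding a_def q_def by (rule norm_lazy_power_delta_ge) (use l_bounds N_ge in auto)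
  obtain T where T_bounds: "0 < T" "q ^ T \<le> 1 / v" "exp (- 4) / v ^ 4 \<le> q ^ (2 * T)"
    using ex_power_bounds[OF l_bounds v_ge_1] unfolding q_def by blast
  have "(q ^ 3) ^ T * a 0 = q ^ (2 * T) * q ^ T"
    by (simp add: a_0 power_mult[symmetric] power_add[symmetric])
  also have "\<dots> \<le> q ^ (2 * T) * (1 / v)" using q_pos T_bounds(2) by (intro mult_left_mono) auto
  also have "\<dots> \<le> a T" using a_ge[of T] by simp
  finally obtain n where n_slow: "n < T" "q ^ 3 * a n \<le> a (Suc n)"
    using ex_step_ratio_ge[of "q ^ 3" T a] q_pos T_bounds(1) by auto
  have "exp (- 4) / v ^ 4 / v \<le> q ^ (2 * T) / v" using T_bounds(3) v_ge_1
    by (intro divide_right_mono) auto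
  also note a_ge[of T]
  also have "a T \<le> a n" using n_slow(1) by (intro lift_Suc_antimono_le[of a, OF a_Suc]) simp
  finally have a_n: "exp (- 4) / v ^ 5 \<le> a n"
    by (simp add: power_Suc[of v 4, simplified] mult.commute)
  have "0 < exp (- 4) / v ^ 5" using v_ge_1 by simp
  then have "0 < a n" using a_n by (rule less_le_trans)
  then have "rayleigh ((lazy ^^ n) (delta \<one>)) \<le> 2 * (1 - q ^ 3)"
    using n_slow(2) by (intro rayleigh_le_of_lazy_ratio_ge) (auto simp: a_def)
  also have "\<dots> \<le> 3 * l"
    using Bernoulli_inequality[of "- (l / 2)" 3] l_bounds by (simp add: q_def)
  finally show ?thesis using a_n that by (simp add: a_def)
qed

lemma isoperimetric_profile_le_of_spectral_distribution_ge:
  assumes "0 < l" "l \<le> 1" and v_ge_1: "1 \<le> v" and "1 / v \<le> spectral_distribution G \<mu> l"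
  shows "isoperimetric_profile G \<mu> (4 * exp 4 * v ^ 5) \<le> 6 * l"
proof -
  obtain n where norm_ge: "exp (- 4) / v ^ 5 \<le> (norm ((lazy ^^ n) (delta \<one>)))\<^sup>2"
    and rayleigh_le: "rayleigh ((lazy ^^ n) (delta \<one>)) \<le> 3 * l"
    by (rule ex_lazy_power_small_rayleigh[OF assms])
  let ?f = "(lazy ^^ n) (delta \<one>)"
  have "0 < exp (- 4) / v ^ 5" using v_ge_1 by simp
  then have norm_pos: "0 < (norm ?f)\<^sup>2" using norm_ge by linarith
  have "isoperimetric_profile G \<mu> (4 * exp 4 * v ^ 5) \<le> 2 * rayleigh ?f"
  proof (rule isoperimetric_profile_le_subprobability)
    show "subprobability ?f"
      by (induction n) (simp_all add: subprobability_delta subprobability_lazy)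
    show "?f \<noteq> 0" using norm_pos by auto
    have "4 / (norm ?f)\<^sup>2 \<le> 4 / (exp (- 4) / v ^ 5)"
      using norm_ge norm_pos v_ge_1 by (intro divide_left_mono mult_pos_pos) auto
    then show "4 / (norm ?f)\<^sup>2 \<le> 4 * exp 4 * v ^ 5" by (simp add: exp_minus field_simps)
  qed
  with rayleigh_le show ?thesis by simp
qed

end

section \<open>Comparison of the spectral distribution with the profile\<close>

locale doubling_decay =
  fixes L :: "real \<Rightarrow> real"
  assumes pos: "0 < v \<Longrightarrow> 0 < L v"
    and antimono: "antimono_on {0<..} L"
    and tendsto_0: "(L \<longlongrightarrow> 0) at_top"
    and doubling: "doubling_near_infinity (L \<circ> exp)"
begin

lemma antimonoD: "0 < v \<Longrightarrow> v \<le> w \<Longrightarrow> L w \<le> L v"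
  using antimono by (auto simp: monotone_on_def)

lemma ex_square_bound:
  obtains c V where "0 < c" "1 \<le> V" "\<And>v. V \<le> v \<Longrightarrow> c * L v \<le> L (v\<^sup>2)"
proof -
  obtain c X where c_pos: "0 < c" and exp_bound: "\<And>x. X \<le> x \<Longrightarrow> c * L (exp x) \<le> L (exp (2 * x))"
    using doubling unfolding doubling_near_infinity_def eventually_at_top_linorder by auto
  have "c * L v \<le> L (v\<^sup>2)" if "max 1 (exp X) \<le> v" for v
  proof -
    have "0 < v" "X \<le> ln v" using that by (simp_all add: ln_ge_iff)
    then show ?thesis using exp_bound[of "ln v"] exp_double[of "ln v"] by simp
  qed
  then show ?thesis using that[OF c_pos, of "max 1 (exp X)"] by simp
qed

lemma ex_power_bound:
  assumes a_pos: "0 < a"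
  obtains K V where "0 < K" "1 \<le> V" "\<And>v. V \<le> v \<Longrightarrow> L v \<le> K * L (a * v ^ p)"
proof -
  obtain c V where c_pos: "0 < c" and V_ge_1: "1 \<le> V" and square: "\<And>v. V \<le> v \<Longrightarrow> c * L v \<le> L (v\<^sup>2)"
    using ex_square_bound by blast
  have iterate: "c ^ k * L v \<le> L (v ^ 2 ^ k)" if "V \<le> v" for k v
  proof (induction k)
    case (Suc k)
    have "v ^ 1 \<le> v ^ 2 ^ k" using that V_ge_1 by (intro power_increasing) auto
    then have "c * L (v ^ 2 ^ k) \<le> L ((v ^ 2 ^ k)\<^sup>2)" using that by (intro square) simp
    moreover have "c ^ Suc k * L v \<le> c * L (v ^ 2 ^ k)" using Suc c_pos by simp
    ultimately show ?case by (simp add: power_mult[symmetric] mult.commute)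
  qed simp
  have "L v \<le> (1 / c ^ p) * L (a * v ^ p)" if v_ge: "max V a \<le> v" for v
  proof -
    have v_bounds: "1 \<le> v" "V \<le> v" "a \<le> v" using v_ge V_ge_1 by auto
    have "a * v ^ p \<le> v ^ Suc p" using v_bounds by (simp add: mult_right_mono)
    also have "\<dots> \<le> v ^ 2 ^ p" using v_bounds
      by (intro power_increasing) (auto simp: Suc_le_eq less_exp)
    finally have "L (v ^ 2 ^ p) \<le> L (a * v ^ p)" using a_pos v_bounds by (intro antimonoD) auto
    with iterate[OF v_bounds(2), of p] have "c ^ p * L v \<le> L (a * v ^ p)" by (rule order_trans)
    then show ?thesis using c_pos by (simp add: pos_le_divide_eq mult.commute)
  qed
  then show ?thesis using that[of "1 / c ^ p" "max V a"] c_pos V_ge_1 by simp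
qed

lemma generalized_inverse_le: "0 < v \<Longrightarrow> L v \<le> x \<Longrightarrow> generalized_inverse L x \<le> v"
  unfolding generalized_inverse_def by (rule cInf_lower) (auto intro!: bdd_belowI[of _ 0])

lemma ex_sublevel:
  assumes "0 < x"
  shows "{v. 0 < v \<and> L v \<le> x} \<noteq> {}"
proof -
  have "eventually (\<lambda>v. L v < x \<and> 0 < v) at_top"
    using order_tendstoD(2)[OF tendsto_0 assms] eventually_gt_at_top[of 0] by eventually_elim simp
  from eventually_happens'[OF trivial_limit_at_top_linorder this]
  show ?thesis using less_imp_le by blast
qed

lemma le_generalized_inverse:
  assumes "0 < x" "0 < v" "x < L v"
  shows "v \<le> generalized_inverse L x"
  unfolding generalized_inverse_def
proof (rule cInf_greatest[OF ex_sublevel[OF assms(1)]])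
  show "v \<le> w" if "w \<in> {v. 0 < v \<and> L v \<le> x}" for w
    using that assms antimonoD[of w v] by fastforce
qed

lemma le_of_generalized_inverse_less:
  assumes "0 < x" "generalized_inverse L x < v"
  shows "L v \<le> x"
proof -
  obtain w where "0 < w" "L w \<le> x" "w < v"
    using cInf_lessD[OF ex_sublevel[OF assms(1)]] assms(2) unfolding generalized_inverse_def by auto
  then show ?thesis using antimonoD[of w v] by simp
qed

lemma nonpos_at_0_of_inverse_bound:
  assumes N_mono: "mono N" and K_pos: "0 < K" and V_pos: "0 < V"
    and L_le: "\<And>v l. V \<le> v \<Longrightarrow> 0 < l \<Longrightarrow> l \<le> 1 \<Longrightarrow> 1 / v \<le> N l \<Longrightarrow> L v \<le> K * l"
  shows "N 0 \<le> 0"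
proof (rule ccontr)
  assume "\<not> N 0 \<le> 0"
  define v where "v = max V (1 / N 0)"
  have v_bounds: "V \<le> v" "1 / N 0 \<le> v" "0 < v" using V_pos by (auto simp: v_def)
  define l where "l = min 1 (L v / (2 * K))"
  have l_bounds: "0 < l" "l \<le> 1" "l \<le> L v / (2 * K)" using K_pos pos[OF v_bounds(3)]
    by (auto simp: l_def)
  have "1 / v \<le> N 0" using v_bounds \<open>\<not> N 0 \<le> 0\<close> by (simp add: field_simps)
  also have "\<dots> \<le> N l" using l_bounds by (intro monoD[OF N_mono]) simp
  finally have "L v \<le> K * l" using L_le v_bounds l_bounds by blast
  also have "\<dots> \<le> K * (L v / (2 * K))" using l_bounds K_pos by (intro mult_left_mono) auto
  finally show False using K_pos pos[OF v_bounds(3)] by simp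
qed

lemma dil_preceq_recip_generalized_inverse:
  assumes N: "mono N" "\<And>l. 0 \<le> N l" and K_pos: "0 < K" and V_pos: "0 < V"
    and L_le: "\<And>v l. V \<le> v \<Longrightarrow> 0 < l \<Longrightarrow> l \<le> 1 \<Longrightarrow> 1 / v \<le> N l \<Longrightarrow> L v \<le> K * l"
  shows "dil_preceq_near_zero N (recip_generalized_inverse L)"
proof -
  define \<epsilon> where "\<epsilon> = min 1 (L V / K)"
  have \<epsilon>_pos: "0 < \<epsilon>" using K_pos pos[OF V_pos] by (simp add: \<epsilon>_def)
  have "N l \<le> 1 / generalized_inverse L (K * l)" if l_bounds: "0 < l" "l < \<epsilon>" for l
  proof -
    have Kl_bounds: "0 < K * l" "K * l < L V" "l \<le> 1" using l_bounds K_pos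
      by (auto simp: \<epsilon>_def field_simps)
    have "V \<le> generalized_inverse L (K * l)"
      by (rule le_generalized_inverse[OF Kl_bounds(1) V_pos Kl_bounds(2)])
    then have inverse_pos: "0 < generalized_inverse L (K * l)" using V_pos by simp
    show ?thesis
    proof (cases "N l = 0")
      case False
      then have N_pos: "0 < N l" using N(2)[of l] by simp
      have "\<not> 1 / V \<le> N l" using L_le[OF order_refl l_bounds(1) Kl_bounds(3)] Kl_bounds(2) by auto
      then have "V \<le> 1 / N l" using N_pos V_pos by (simp add: field_simps)
      from L_le[OF this l_bounds(1) Kl_bounds(3)] have "L (1 / N l) \<le> K * l" by simp
      then have "generalized_inverse L (K * l) \<le> 1 / N l"
        using N_pos by (intro generalized_inverse_le) auto
      then show ?thesis using N_pos inverse_pos by (simp add: field_simps)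
    qed (use inverse_pos in simp)
  qed
  moreover have "N 0 \<le> 0" by (rule nonpos_at_0_of_inverse_bound[OF N(1) K_pos V_pos L_le])
  ultimately have "N l \<le> recip_generalized_inverse L (K * l)" if "0 \<le> l \<and> l < \<epsilon>" for l
    using that K_pos by (cases "l = 0") (auto simp: recip_generalized_inverse_def)
  then show ?thesis unfolding dil_preceq_near_zero_def using K_pos \<epsilon>_pos by blast
qed

lemma recip_generalized_inverse_dil_preceq:
  assumes N_nonneg: "\<And>l. 0 \<le> N l" and K_pos: "0 < K" and V_pos: "0 < V"
    and N_ge: "\<And>v l. V \<le> v \<Longrightarrow> 0 < l \<Longrightarrow> L (2 * v) \<le> l \<Longrightarrow> 1 / v \<le> N (K * l)"
  shows "dil_preceq_near_zero (recip_generalized_inverse L) N"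
proof -
  have "recip_generalized_inverse L l \<le> N (K * l)" if l_bounds: "0 \<le> l \<and> l < L V" for l
  proof (cases "l = 0")
    case False
    then have l_pos: "0 < l" using l_bounds by simp
    then have "V \<le> generalized_inverse L l" using l_bounds V_pos
      by (intro le_generalized_inverse) auto
    moreover from this have "L (2 * generalized_inverse L l) \<le> l"
      using V_pos by (intro le_of_generalized_inverse_less l_pos) simp
    ultimately show ?thesis
      using N_ge[OF _ l_pos] l_pos by (simp add: recip_generalized_inverse_def)
  qed (simp add: recip_generalized_inverse_def N_nonneg)
  then show ?thesis unfolding dil_preceq_near_zero_def using K_pos pos[OF V_pos] by blast
qed

end

locale walk_with_comparison = symmetric_walk + doubling_decay
begin

theorem spectral_distribution_preceq:
  assumes "preceq_near_infinity L (isoperimetric_profile G \<mu>)"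
  shows "dil_preceq_near_zero (spectral_distribution G \<mu>) (recip_generalized_inverse L)"
proof -
  obtain C D x0 where C_pos: "0 < C" and D_pos: "0 < D"
    and L_le_profile: "\<And>x. x0 \<le> x \<Longrightarrow> L x \<le> C * isoperimetric_profile G \<mu> (D * x)"
    using assms unfolding preceq_near_infinity_def by blast
  obtain K V where K_pos: "0 < K" and V_ge_1: "1 \<le> V"
    and power: "\<And>v. V \<le> v \<Longrightarrow> L v \<le> K * L (4 * exp 4 / D * v ^ 5)"
    using ex_power_bound[of "4 * exp 4 / D" 5] D_pos by auto
  show ?thesis
  proof (rule dil_preceq_recip_generalized_inverse[of _ "K * (C * 6)" "max V (x0 * D)"])
    fix v l :: real
    assume v_ge: "max V (x0 * D) \<le> v" and l_bounds: "0 < l" "l \<le> 1"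
      and N_ge: "1 / v \<le> spectral_distribution G \<mu> l"
    let ?y = "4 * exp 4 / D * v ^ 5"
    have v_bounds: "1 \<le> v" "V \<le> v" "x0 * D \<le> v" using v_ge V_ge_1 by auto
    have "x0 * D \<le> 1 * v ^ 5" using v_bounds power_increasing[of 1 5 v] by simp
    also have "\<dots> \<le> 4 * exp 4 * v ^ 5"
      using v_bounds exp_ge_add_one_self[of "4::real"] by (intro mult_right_mono) auto
    finally have "x0 \<le> ?y" using D_pos by (simp add: pos_le_divide_eq)
    then have "L ?y \<le> C * isoperimetric_profile G \<mu> (4 * exp 4 * v ^ 5)"
      using L_le_profile[of ?y] D_pos by simp
    also have "\<dots> \<le> C * (6 * l)"
      using C_pos isoperimetric_profile_le_of_spectral_distribution_ge[OF l_bounds v_bounds(1) N_ge]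
      by (intro mult_left_mono) auto
    finally have "K * L ?y \<le> K * (C * (6 * l))" using K_pos by (intro mult_left_mono) auto
    then show "L v \<le> K * (C * 6) * l" using power[OF v_bounds(2)] by simp
  qed (use K_pos C_pos V_ge_1 in \<open>auto simp: spectral_distribution_nonneg
      intro!: monoI spectral_distribution_mono\<close>)
qed

theorem spectral_distribution_succeq:
  assumes "preceq_near_infinity (isoperimetric_profile G \<mu>) L"
  shows "dil_preceq_near_zero (recip_generalized_inverse L) (spectral_distribution G \<mu>)"
proof -
  obtain C D x0 where C_pos: "0 < C" and D_pos: "0 < D"
    and profile_le_L: "\<And>x. x0 \<le> x \<Longrightarrow> isoperimetric_profile G \<mu> x \<le> C * L (D * x)"
    using assms unfolding preceq_near_infinity_def by blast
  obtain K V where K_pos: "0 < K"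
    and linear: "\<And>v. V \<le> v \<Longrightarrow> L v \<le> K * L (4 / D * v ^ 1)"
    by (rule ex_power_bound[of "4 / D" 1]) (use D_pos in simp, blast intro: that)
  define V' where "V' = Max {2, 2 * x0, 2 * V / D}"
  have V'_bounds: "2 \<le> V'" "2 * x0 \<le> V'" "2 * V / D \<le> V'" by (auto simp: V'_def)
  show ?thesis
  proof (rule recip_generalized_inverse_dil_preceq[of _ "4 * (C * K)" V'])
    fix v l :: real
    assume v_ge: "V' \<le> v" and l_bounds: "0 < l" "L (2 * v) \<le> l"
    have "2 * V / D \<le> v" using v_ge V'_bounds by linarith
    then have "V \<le> D * (v / 2)" using D_pos by (simp add: pos_divide_le_eq mult.commute)
    from linear[OF this] have "L (D * (v / 2)) \<le> K * L (2 * v)" using D_pos by simp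
    also have "\<dots> \<le> K * l" using l_bounds K_pos by simp
    finally have "C * L (D * (v / 2)) \<le> C * (K * l)" using C_pos by simp
    moreover have "isoperimetric_profile G \<mu> (v / 2) \<le> C * L (D * (v / 2))"
      using v_ge V'_bounds by (intro profile_le_L) simp
    moreover have "0 < C * (K * l)" using C_pos K_pos l_bounds by simp
    ultimately have "isoperimetric_profile G \<mu> (v / 2) < 2 * (C * (K * l))" by linarith
    from spectral_distribution_ge_of_profile_less[OF _ _ this]
    show "1 / v \<le> spectral_distribution G \<mu> (4 * (C * K) * l)"
      using v_ge V'_bounds C_pos K_pos l_bounds by (simp add: mult.assoc)
  qed (use C_pos K_pos V'_bounds in \<open>auto simp: spectral_distribution_nonneg\<close>)
qed

end

theorem theorem1p4:
  fixes G :: "('g, 'b) monoid_scheme" and \<mu> :: "'g pmf" and L :: "real \<Rightarrow> real"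
  assumes "group G"
    and "infinite (carrier G)"
    and "finitely_generated_group G"
    and "amenable_group G"
    and "admissible_measure G \<mu>"
    and "\<And>v. 0 < v \<Longrightarrow> 0 < L v"
    and "antimono_on {0<..} L"
    and "(L \<longlongrightarrow> 0) at_top"
    and "doubling_near_infinity (L \<circ> exp)"
  shows "(preceq_near_infinity L (isoperimetric_profile G \<mu>) \<longrightarrow>
            dil_preceq_near_zero (spectral_distribution G \<mu>) (recip_generalized_inverse L)) \<and>
         (preceq_near_infinity (isoperimetric_profile G \<mu>) L \<longrightarrow>
            dil_preceq_near_zero (recip_generalized_inverse L) (spectral_distribution G \<mu>))"
proof -
  interpret group G by fact
  obtain S where "finite S" "S \<subseteq> carrier G" "generate G S = carrier G"
    using assms(3) unfolding finitely_generated_group_def finite_generating_set_def by blast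
  then have "countable (carrier G)" using countable_generate[OF countable_finite] by metis
  moreover have "set_pmf \<mu> \<subseteq> carrier G" "\<And>x. x \<in> carrier G \<Longrightarrow> pmf \<mu> (inv\<^bsub>G\<^esub> x) = pmf \<mu> x"
    using assms(5) unfolding admissible_measure_def by metis+
  ultimately interpret walk_with_comparison G \<mu> L
    by unfold_locales (use assms in simp_all)
  show ?thesis using spectral_distribution_preceq spectral_distribution_succeq by blast
qed

end
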